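(* Let $G$ be a bicyclic graph of size $m \geq 5$. Then the following hold. (i) If $m=5$, then $Mo_e(G)\le 4$, with equality if and only if $G$ is isomorphic to $B^3_m$ or $B^4_m$. (ii) If $6\le m\le 8$, then $Mo_e(G)\le m^2-3m-6$, with equality if and only if $G$ is isomorphic to $B^2_m$ or $B^3_m$. (iii) If $m=9$, then $Mo_e(G)\le 48$, with equality if and only if $G$ is isomorphic to one of $B_m, B^1_m, B^2_m, B^3_m, B^4_m$. (iv) If $m\ge 10$, then $Mo_e(G)\le m^2-m-24$, with equality if and only if $G\cong B_m$.
   Context: All graphs are finite, simple and connected; the size of a graph is its number of edges. A bicyclic graph is a connected graph $G$ with $|E(G)|=|V(G)|+1$. For an edge $e=uv$ of $G$, $m_u(e|G)$ is the number of edges of $G$ lying closer to $u$ than to $v$, and $m_v(e|G)$ is the number of edges lying closer to $v$ than to $u$, where the distance from a vertex $x$ to an edge $f=ab$ is $\min\{d_G(x,a),d_G(x,b)\}$. The edge Mostar index is $Mo_e(G)=\sum_{e=uv\in E(G)}|m_u(e|G)-m_v(e|G)|$. $\Theta(l_1,l_2,l_3)$, with $l_1\le l_2\le l_3$, is the graph formed by two fixed vertices connected by three internally disjoint paths of lengths $l_1,l_2,l_3$. A pendent edge attached at a vertex $v$ is an edge joining $v$ to a new vertex of degree one. The following graphs have size $m$: - $B_m$ ($m\ge 8$): two 4-cycles sharing exactly one vertex, with $m-8$ pendent edges attached at the shared vertex. - $B^1_m$ ($m\ge 7$): a 3-cycle and a 4-cycle sharing exactly one vertex, with $m-7$ pendent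 edges attached at the shared vertex. - $B^2_m$ ($m\ge 6$): two 3-cycles sharing exactly one vertex, with $m-6$ pendent edges attached at the shared vertex. - $B^3_m$ ($m\ge 5$): $\Theta(1,2,2)$ with $m-5$ pendent edges attached at one of its vertices of degree 3. - $B^4_m$ ($m\ge 5$): $\Theta(1,2,2)$ with $m-5$ pendent edges attached at one of its vertices of degree 2. *)

theory Defs
  imports Main
begin

section \<open>Finite simple graphs\<close>

datatype 'v ugraph = UGraph (verts: "'v set") (edges: "'v set set")

definition simple_graph :: "'v ugraph \<Rightarrow> bool" where
  "simple_graph G \<longleftrightarrow> finite (verts G) \<and> (\<forall>e\<in>edges G. e \<subseteq> verts G \<and> card e = 2)"

definition walk :: "'v ugraph \<Rightarrow> 'v list \<Rightarrow> bool" where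
  "walk G xs \<longleftrightarrow> xs \<noteq> [] \<and> set xs \<subseteq> verts G \<and>
     (\<forall>i. Suc i < length xs \<longrightarrow> {xs ! i, xs ! Suc i} \<in> edges G)"

definition connected_graph :: "'v ugraph \<Rightarrow> bool" where
  "connected_graph G \<longleftrightarrow> verts G \<noteq> {} \<and>
     (\<forall>u\<in>verts G. \<forall>v\<in>verts G. \<exists>xs. walk G xs \<and> hd xs = u \<and> last xs = v)"

definition bicyclic :: "'v ugraph \<Rightarrow> bool" where
  "bicyclic G \<longleftrightarrow> simple_graph G \<and> connected_graph G \<and> card (edges G) = card (verts G) + 1"

definition degree :: "'v ugraph \<Rightarrow> 'v \<Rightarrow> nat" where
  "degree G v = card {e \<in> edges G. v \<in> e}"

definition isomorphic :: "'v ugraph \<Rightarrow> 'w ugraph \<Rightarrow> bool"  (infix \<open>\<simeq>\<close> 50) where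
  "G \<simeq> H \<longleftrightarrow> (\<exists>f. bij_betw f (verts G) (verts H) \<and>
     (\<forall>u\<in>verts G. \<forall>v\<in>verts G. {u, v} \<in> edges G \<longleftrightarrow> {f u, f v} \<in> edges H))"


section \<open>The edge Mostar index\<close>

text \<open>The length of a walk is its number of edges, one less than the length of its vertex list.
  The distance is only meaningful for vertices joined by a walk.\<close>

definition dist_graph :: "'v ugraph \<Rightarrow> 'v \<Rightarrow> 'v \<Rightarrow> nat" where
  "dist_graph G u v =
     (LEAST n. \<exists>xs. walk G xs \<and> hd xs = u \<and> last xs = v \<and> length xs = Suc n)"

definition dist_edge :: "'v ugraph \<Rightarrow> 'v \<Rightarrow> 'v set \<Rightarrow> nat" where
  "dist_edge G x f = Min (dist_graph G x ` f)"

text \<open>For an edge \<open>e = {u, v}\<close>, \<open>closer_edges G u v\<close> is $m_u(e|G)$ and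
  \<open>closer_edges G v u\<close> is $m_v(e|G)$.\<close>

definition closer_edges :: "'v ugraph \<Rightarrow> 'v \<Rightarrow> 'v \<Rightarrow> nat" where
  "closer_edges G u v = card {f \<in> edges G. dist_edge G u f < dist_edge G v f}"

text \<open>The summand does not depend on the order in which the ends of the edge are named.\<close>

definition edge_contribution :: "'v ugraph \<Rightarrow> 'v set \<Rightarrow> int" where
  "edge_contribution G e =
     (THE k. \<exists>u v. e = {u, v} \<and> k = \<bar>int (closer_edges G u v) - int (closer_edges G v u)\<bar>)"

lemma edge_contribution_insert:
  "edge_contribution G {u, v} = \<bar>int (closer_edges G u v) - int (closer_edges G v u)\<bar>"
  unfolding edge_contribution_def by (rule the_equality) (auto simp: doubleton_eq_iff)

definition edge_mostar :: "'v ugraph \<Rightarrow> int" where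
  "edge_mostar G = (\<Sum>e\<in>edges G. edge_contribution G e)"


section \<open>Constructions\<close>

definition map_graph :: "('v \<Rightarrow> 'w) \<Rightarrow> 'v ugraph \<Rightarrow> 'w ugraph" where
  "map_graph f G = UGraph (f ` verts G) ((`) f ` edges G)"

definition union_graph :: "'v ugraph \<Rightarrow> 'v ugraph \<Rightarrow> 'v ugraph" where
  "union_graph G H = UGraph (verts G \<union> verts H) (edges G \<union> edges H)"

definition path_graph :: "nat \<Rightarrow> nat ugraph" where
  "path_graph l = UGraph {..l} {{j, Suc j} | j. j < l}"

definition cycle_graph :: "nat \<Rightarrow> nat ugraph" where
  "cycle_graph p = UGraph {..<p} {{j, Suc j mod p} | j. j < p}"

text \<open>The \<open>i\<close>-th path of a theta graph: its two ends are sent to the common vertices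
  \<open>(0, 0)\<close> and \<open>(0, 1)\<close>, and its \<open>j\<close>-th vertex is \<open>(i, j)\<close> if it is internal.
  For \<open>i \<ge> 1\<close> the internal vertices of different paths are thus distinct.\<close>

definition theta_path :: "nat \<Rightarrow> nat \<Rightarrow> (nat \<times> nat) ugraph" where
  "theta_path i l =
     map_graph (\<lambda>j. if j = 0 then (0, 0) else if j = l then (0, 1) else (i, j)) (path_graph l)"

definition theta_graph :: "nat \<Rightarrow> nat \<Rightarrow> nat \<Rightarrow> (nat \<times> nat) ugraph" where
  "theta_graph l1 l2 l3 =
     union_graph (theta_path 1 l1) (union_graph (theta_path 2 l2) (theta_path 3 l3))"

text \<open>A \<open>p\<close>-cycle and a \<open>q\<close>-cycle whose only common vertex is \<open>(0, 0)\<close>.\<close>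

definition based_cycle :: "nat \<Rightarrow> nat \<Rightarrow> (nat \<times> nat) ugraph" where
  "based_cycle i p = map_graph (\<lambda>j. if j = 0 then (0, 0) else (i, j)) (cycle_graph p)"

definition two_cycles :: "nat \<Rightarrow> nat \<Rightarrow> (nat \<times> nat) ugraph" where
  "two_cycles p q = union_graph (based_cycle 1 p) (based_cycle 2 q)"

definition attach_pendent :: "'v ugraph \<Rightarrow> 'v \<Rightarrow> nat \<Rightarrow> ('v + nat) ugraph" where
  "attach_pendent G v k =
     UGraph (Inl ` verts G \<union> Inr ` {..<k})
            ((`) Inl ` edges G \<union> {{Inl v, Inr i} | i. i < k})"


section \<open>The extremal graphs\<close>

text \<open>The parameter \<open>m\<close> is the size. The truncated subtractions make this correct only for
  \<open>m \<ge> 8, 7, 6, 5, 5\<close> respectively.\<close>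

definition B :: "nat \<Rightarrow> (nat \<times> nat + nat) ugraph" where
  "B m = attach_pendent (two_cycles 4 4) (0, 0) (m - 8)"

definition B1 :: "nat \<Rightarrow> (nat \<times> nat + nat) ugraph" where
  "B1 m = attach_pendent (two_cycles 3 4) (0, 0) (m - 7)"

definition B2 :: "nat \<Rightarrow> (nat \<times> nat + nat) ugraph" where
  "B2 m = attach_pendent (two_cycles 3 3) (0, 0) (m - 6)"

text \<open>In \<open>theta_graph 1 2 2\<close> the vertices of degree 3 are \<open>(0, 0)\<close> and \<open>(0, 1)\<close>, those of
  degree 2 are \<open>(2, 1)\<close> and \<open>(3, 1)\<close>. An automorphism exchanges the two vertices of equal degree,
  so the choice of one of them does not matter.\<close>

definition B3 :: "nat \<Rightarrow> (nat \<times> nat + nat) ugraph" where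
  "B3 m = attach_pendent (theta_graph 1 2 2) (0, 0) (m - 5)"

definition B4 :: "nat \<Rightarrow> (nat \<times> nat + nat) ugraph" where
  "B4 m = attach_pendent (theta_graph 1 2 2) (2, 1) (m - 5)"

lemma path_graph_edges: "edges (path_graph l) = (\<lambda>j. {j, Suc j}) ` {..<l}"
  by (auto simp: path_graph_def)

lemma cycle_graph_edges: "edges (cycle_graph p) = (\<lambda>j. {j, Suc j mod p}) ` {..<p}"
  by (auto simp: cycle_graph_def)

lemmas construction_simps =
  map_graph_def union_graph_def theta_path_def theta_graph_def based_cycle_def two_cycles_def
  path_graph_edges cycle_graph_edges

lemma lessThan_small:
  "{..<Suc 0} = {0}" "{..<2::nat} = {0, 1}" "{..<3::nat} = {0, 1, 2}" "{..<4::nat} = {0, 1, 2, 3}"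
  by auto

lemma edges_theta_graph_1_2_2:
  "edges (theta_graph 1 2 2) =
     {{(0, 0), (0, 1)}, {(0, 0), (2, 1)}, {(2, 1), (0, 1)}, {(0, 0), (3, 1)}, {(3, 1), (0, 1)}}"
  by (simp add: construction_simps lessThan_small insert_commute flip: numeral_2_eq_2)

lemma degree_theta_graph_1_2_2:
  "degree (theta_graph 1 2 2) (0, 0) = 3" "degree (theta_graph 1 2 2) (0, 1) = 3"
  "degree (theta_graph 1 2 2) (2, 1) = 2" "degree (theta_graph 1 2 2) (3, 1) = 2"
proof -
  have *: "{e \<in> insert x A. v \<in> e} = (if v \<in> x then insert x {e \<in> A. v \<in> e} else {e \<in> A. v \<in> e})"
    for x :: "(nat \<times> nat) set" and A v by auto
  show "degree (theta_graph 1 2 2) (0, 0) = 3" "degree (theta_graph 1 2 2) (0, 1) = 3"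
    "degree (theta_graph 1 2 2) (2, 1) = 2" "degree (theta_graph 1 2 2) (3, 1) = 2"
    unfolding degree_def edges_theta_graph_1_2_2 *
    by (simp_all add: card_insert_if doubleton_eq_iff)
qed

lemma edges_two_cycles_3_3:
  "edges (two_cycles 3 3) =
     {{(0, 0), (1, 1)}, {(1, 1), (1, 2)}, {(1, 2), (0, 0)},
      {(0, 0), (2, 1)}, {(2, 1), (2, 2)}, {(2, 2), (0, 0)}}"
  by (simp add: construction_simps lessThan_small insert_commute flip: numeral_2_eq_2)

lemma edges_two_cycles_3_4:
  "edges (two_cycles 3 4) =
     {{(0, 0), (1, 1)}, {(1, 1), (1, 2)}, {(1, 2), (0, 0)},
      {(0, 0), (2, 1)}, {(2, 1), (2, 2)}, {(2, 2), (2, 3)}, {(2, 3), (0, 0)}}"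
  by (simp add: construction_simps lessThan_small insert_commute flip: numeral_2_eq_2)

lemma edges_two_cycles_4_4:
  "edges (two_cycles 4 4) =
     {{(0, 0), (1, 1)}, {(1, 1), (1, 2)}, {(1, 2), (1, 3)}, {(1, 3), (0, 0)},
      {(0, 0), (2, 1)}, {(2, 1), (2, 2)}, {(2, 2), (2, 3)}, {(2, 3), (0, 0)}}"
  by (simp add: construction_simps lessThan_small insert_commute flip: numeral_2_eq_2)

lemma card_edges_attach_pendent:
  assumes "finite (edges G)"
  shows "card (edges (attach_pendent G v k)) = card (edges G) + k"
proof -
  let ?g = "\<lambda>i. {Inl v, Inr i} :: ('a + nat) set"
  have new: "{{Inl v, Inr i} | i. i < k} = ?g ` {..<k}" by auto
  have "Inr i \<notin> Inl ` A" for i :: nat and A :: "'a set" by blast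
  then have disj: "(`) Inl ` edges G \<inter> ?g ` {..<k} = {}" by blast
  have "inj_on ((`) Inl :: 'a set \<Rightarrow> ('a + nat) set) (edges G)"
    by (meson inj_Inl inj_image_eq_iff inj_onI)
  moreover have "inj_on ?g {..<k}"
    by (auto simp: inj_on_def doubleton_eq_iff)
  ultimately show ?thesis
    using assms disj by (simp add: attach_pendent_def new card_Un_disjoint card_image)
qed

lemma card_edges_B: "m \<ge> 8 \<Longrightarrow> card (edges (B m)) = m"
  by (simp add: B_def card_edges_attach_pendent edges_two_cycles_4_4 card_insert_if doubleton_eq_iff)

lemma card_edges_B1: "m \<ge> 7 \<Longrightarrow> card (edges (B1 m)) = m"
  by (simp add: B1_def card_edges_attach_pendent edges_two_cycles_3_4 card_insert_if doubleton_eq_iff)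

lemma card_edges_B2: "m \<ge> 6 \<Longrightarrow> card (edges (B2 m)) = m"
  by (simp add: B2_def card_edges_attach_pendent edges_two_cycles_3_3 card_insert_if doubleton_eq_iff)

lemma card_edges_B3: "m \<ge> 5 \<Longrightarrow> card (edges (B3 m)) = m"
  by (simp add: B3_def card_edges_attach_pendent edges_theta_graph_1_2_2[simplified] card_insert_if doubleton_eq_iff)

lemma card_edges_B4: "m \<ge> 5 \<Longrightarrow> card (edges (B4 m)) = m"
  by (simp add: B4_def card_edges_attach_pendent edges_theta_graph_1_2_2[simplified] card_insert_if doubleton_eq_iff)

end

theory Submission
  imports Defs
begin

text \<open>Call $m - 1 - |m_u(e|G) - m_v(e|G)|$ the deficit of the edge $e = uv$. It is the
  number of other edges equidistant from $u$ and $v$ plus twice the smaller of $m_u$ and $m_v$,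
  and the theorem asks for the least total deficit: it is $\min(2m + 6, 24)$ up to the
  description of the equality cases. Pendent edges have deficit 0, every other edge has deficit
  at least 2, and an edge whose shortest cycle has length $g$ has deficit at least $g - 1$. The
  three sides of a triangle together have deficit at least $m + 3$, because every edge is
  equidistant from the ends of some side.

  Take a shortest cycle. Either an ear joins two of its vertices, or it is edge-disjoint from a
  second cycle which meets it in at most one vertex. The bounds above settle all situations but
  a few small cores. For these the rest of the graph consists of trees hanging at the vertices
  of the core, and the total deficit is an explicit function of the sizes of these trees.\<close>

section \<open>Walks and distances\<close>

text \<open>Distances are never found by listing walks. They are bounded above by a single walk and
  below by a function on the vertices that changes by at most 1 along every edge; deleting an edge,
  unfolding an ear and entering a hanging tree each come down to choosing such a function.

  An edge of a hanging tree is farther away than the root of the tree by the same amount from every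
  core vertex, so the ends of a core edge see the tree only as a number of edges at its root. This
  turns graphs of unbounded size into eight fixed cores with natural numbers as weights.

  Three values compete: 24 for two 4-cycles; 2m + 6 for two triangles, and for Theta(1,2,2) with
  pendent edges at a vertex of degree 3; m + 15 for a triangle and a 4-cycle, and for Theta(1,2,2)
  with at least one pendent edge, all at one vertex of degree 2. Since m + 15 is the mean of the
  other two, it reaches the minimum only when all three agree, at m = 9. Hence the five graphs of
  that size and the change of formula there. For m = 5 no pendent edge is left and the two variants
  of Theta(1,2,2) are one graph, of deficit 16.\<close>

lemma walk_single [simp]: "walk G [x] \<longleftrightarrow> x \<in> verts G"
  by (auto simp: walk_def)

lemma walk_Cons [simp]:
  "walk G (x # y # xs) \<longleftrightarrow> x \<in> verts G \<and> {x, y} \<in> edges G \<and> walk G (y # xs)"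
proof -
  have "(\<forall>i. Suc i < length (x # y # xs) \<longrightarrow> {(x # y # xs) ! i, (x # y # xs) ! Suc i} \<in> edges G)
    \<longleftrightarrow> {x, y} \<in> edges G \<and> (\<forall>i. Suc i < length (y # xs) \<longrightarrow> {(y # xs) ! i, (y # xs) ! Suc i} \<in> edges G)"
    (is "?l \<longleftrightarrow> ?r")
  proof
    assume l: ?l
    have "{x, y} \<in> edges G" using l[rule_format, of 0] by simp
    moreover have "{(y # xs) ! i, (y # xs) ! Suc i} \<in> edges G" if "Suc i < length (y # xs)" for i
      using l[rule_format, of "Suc i"] that by simp
    ultimately show ?r by blast
  next
    assume r: ?r
    show ?l
    proof (intro allI impI)
      fix i assume "Suc i < length (x # y # xs)"
      then show "{(x # y # xs) ! i, (x # y # xs) ! Suc i} \<in> edges G"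
        using r by (cases i) auto
    qed
  qed
  then show ?thesis by (auto simp: walk_def)
qed

lemma walk_Nil [simp]: "\<not> walk G []"
  by (simp add: walk_def)

lemma walk_hd_verts: "walk G (y # ys) \<Longrightarrow> y \<in> verts G"
  by (simp add: walk_def)

lemma walk_append:
  "walk G (xs @ [x]) \<Longrightarrow> walk G (x # ys) \<Longrightarrow> walk G (xs @ x # ys)"
proof (induction xs)
  case (Cons a xs)
  then show ?case by (cases xs) auto
qed simp

lemma walk_appendD:
  "walk G (xs @ x # ys) \<Longrightarrow> walk G (xs @ [x]) \<and> walk G (x # ys)"
proof (induction xs)
  case Nil
  then show ?case by (cases ys) auto
next
  case (Cons a xs)
  then show ?case by (cases xs) auto
qed

lemma walk_append_iff: "walk G (xs @ x # ys) \<longleftrightarrow> walk G (xs @ [x]) \<and> walk G (x # ys)"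
  using walk_append[of G xs x ys] walk_appendD[of G xs x ys] by argo

lemma walk_rev: "walk G xs \<Longrightarrow> walk G (rev xs)"
proof (induction xs)
  case (Cons x xs)
  show ?case
  proof (cases xs)
    case Nil
    then show ?thesis using Cons.prems by simp
  next
    case (Cons y ys)
    with Cons.prems have *: "x \<in> verts G" "{y, x} \<in> edges G" "walk G xs"
      by (simp_all add: insert_commute)
    then have "walk G (rev ys @ [y])" "y \<in> verts G"
      using Cons.IH Cons walk_hd_verts by simp_all
    with * walk_append[of G "rev ys" y "[x]"] Cons show ?thesis by simp
  qed
qed simp

lemma walk_mono: "walk G xs \<Longrightarrow> verts G \<subseteq> verts H \<Longrightarrow> edges G \<subseteq> edges H \<Longrightarrow> walk H xs"
  by (auto simp: walk_def)

definition reach :: "'v ugraph \<Rightarrow> 'v \<Rightarrow> 'v \<Rightarrow> bool" where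
  "reach G u v \<longleftrightarrow> (\<exists>xs. walk G xs \<and> hd xs = u \<and> last xs = v)"

lemma walk_reach: "walk G xs \<Longrightarrow> reach G (hd xs) (last xs)"
  by (auto simp: reach_def)

lemma reach_refl: "u \<in> verts G \<Longrightarrow> reach G u u"
  unfolding reach_def by (rule exI[of _ "[u]"]) simp

lemma reach_sym: "reach G u v \<Longrightarrow> reach G v u"
  unfolding reach_def using walk_rev by (force simp: hd_rev last_rev)

lemma walk_join:
  assumes "walk G xs" "walk G ys" "last xs = hd ys"
  shows "walk G (xs @ tl ys)" "hd (xs @ tl ys) = hd xs" "last (xs @ tl ys) = last ys"
    "length (xs @ tl ys) = length xs + length ys - 1"
proof -
  obtain zs z where xs: "xs = zs @ [z]"
    using assms(1) by (cases xs rule: rev_cases) auto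
  obtain a bs where ys: "ys = a # bs"
    using assms(2) by (cases ys) auto
  show "walk G (xs @ tl ys)"
    using assms xs ys walk_append[of G zs a bs] by simp
  show "hd (xs @ tl ys) = hd xs" using xs by (cases zs) auto
  show "last (xs @ tl ys) = last ys" using assms(3) ys by (auto simp: last_append)
  show "length (xs @ tl ys) = length xs + length ys - 1" using ys by simp
qed

lemma reach_trans: "reach G u v \<Longrightarrow> reach G v w \<Longrightarrow> reach G u w"
proof -
  assume "reach G u v" "reach G v w"
  then obtain xs ys where "walk G xs" "walk G ys" "last xs = hd ys" "hd xs = u" "last ys = w"
    by (auto simp: reach_def)
  with walk_join(1-3)[of G xs ys] walk_reach[of G "xs @ tl ys"] show "reach G u w" by simp
qed

lemma reach_edge: "{u, v} \<in> edges G \<Longrightarrow> u \<in> verts G \<Longrightarrow> v \<in> verts G \<Longrightarrow> reach G u v"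
  unfolding reach_def by (rule exI[of _ "[u, v]"]) simp

lemma reach_mono: "reach G u v \<Longrightarrow> verts G \<subseteq> verts H \<Longrightarrow> edges G \<subseteq> edges H \<Longrightarrow> reach H u v"
  unfolding reach_def using walk_mono by blast

lemma reach_verts: "reach G u v \<Longrightarrow> u \<in> verts G \<and> v \<in> verts G"
  by (auto simp: reach_def walk_def)

section \<open>Distances, bounded above by walks and below by 1-Lipschitz functions\<close>

lemma walk_Lipschitz:
  fixes \<phi> :: "'v \<Rightarrow> int"
  assumes "\<And>a b. a \<in> verts G \<Longrightarrow> b \<in> verts G \<Longrightarrow> {a, b} \<in> edges G \<Longrightarrow> \<phi> b \<le> \<phi> a + 1"
  shows "walk G xs \<Longrightarrow> \<phi> (last xs) - \<phi> (hd xs) \<le> int (length xs) - 1"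
proof (induction xs)
  case (Cons x xs)
  show ?case
  proof (cases xs)
    case (Cons y ys)
    then have "\<phi> y \<le> \<phi> x + 1"
      using Cons.prems assms by (auto dest: walk_hd_verts)
    then show ?thesis using Cons.prems Cons.IH Cons by auto
  qed simp
qed simp

text \<open>Also used contraposed: if \<open>P\<close> holds at one vertex and fails at a reachable
  one, some edge leaves the set described by \<open>P\<close>.\<close>

lemma reach_invariant:
  assumes "\<And>a b. a \<in> verts G \<Longrightarrow> b \<in> verts G \<Longrightarrow> {a, b} \<in> edges G \<Longrightarrow> P a \<Longrightarrow> P b"
    and "reach G u v" "P u"
  shows "P v"
proof -
  have "walk G xs \<Longrightarrow> P (hd xs) \<Longrightarrow> P (last xs)" for xs
  proof (induction xs)
    case (Cons x xs)
    then show ?case using assms(1) by (cases xs) (auto dest: walk_hd_verts)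
  qed simp
  then show ?thesis using assms by (auto simp: reach_def)
qed

lemma reachE_dist:
  assumes "reach G u v"
  obtains xs where "walk G xs" "hd xs = u" "last xs = v" "length xs = Suc (dist_graph G u v)"
proof -
  obtain xs where xs: "walk G xs" "hd xs = u" "last xs = v" using assms by (auto simp: reach_def)
  then have "length xs = Suc (length xs - 1)" by (cases xs) auto
  then have "\<exists>n xs. walk G xs \<and> hd xs = u \<and> last xs = v \<and> length xs = Suc n"
    using xs by blast
  from LeastI_ex[OF this] obtain ys where
    "walk G ys" "hd ys = u" "last ys = v" "length ys = Suc (dist_graph G u v)"
    unfolding dist_graph_def by blast
  then show thesis by (rule that)
qed

lemma dist_le_walk: "walk G xs \<Longrightarrow> dist_graph G (hd xs) (last xs) \<le> length xs - 1"
  unfolding dist_graph_def by (rule Least_le) (cases xs; auto)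

text \<open>Telescoping along a shortest walk. The hypothesis covers both orders of the ends of an
  edge, so \<open>\<phi>\<close> is 1-Lipschitz. This is the main source of lower bounds on
  distances.\<close>

lemma dist_ge:
  fixes \<phi> :: "'v \<Rightarrow> int"
  assumes "reach G u v"
    and "\<And>a b. a \<in> verts G \<Longrightarrow> b \<in> verts G \<Longrightarrow> {a, b} \<in> edges G \<Longrightarrow> \<phi> b \<le> \<phi> a + 1"
  shows "\<phi> v - \<phi> u \<le> int (dist_graph G u v)"
proof -
  obtain xs where "walk G xs" "hd xs = u" "last xs = v" "length xs = Suc (dist_graph G u v)"
    by (rule reachE_dist[OF assms(1)])
  with walk_Lipschitz[of G \<phi> xs] assms(2) show ?thesis by simp
qed

lemma dist_self [simp]: "u \<in> verts G \<Longrightarrow> dist_graph G u u = 0"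
  using dist_le_walk[of G "[u]"] by simp

lemma dist_eq_0: "reach G u v \<Longrightarrow> dist_graph G u v = 0 \<Longrightarrow> u = v"
proof -
  assume "reach G u v" "dist_graph G u v = 0"
  then obtain xs where "hd xs = u" "last xs = v" "length xs = 1"
    by (auto elim!: reachE_dist)
  then show "u = v" by (cases xs) auto
qed

lemma dist_triangle:
  assumes "reach G u v" "reach G v w"
  shows "dist_graph G u w \<le> dist_graph G u v + dist_graph G v w"
proof -
  obtain xs where xs: "walk G xs" "hd xs = u" "last xs = v" "length xs = Suc (dist_graph G u v)"
    by (rule reachE_dist[OF assms(1)])
  obtain ys where ys: "walk G ys" "hd ys = v" "last ys = w" "length ys = Suc (dist_graph G v w)"
    by (rule reachE_dist[OF assms(2)])
  have "last xs = hd ys" using xs ys by simp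
  from dist_le_walk[OF walk_join(1)[OF xs(1) ys(1) this]] walk_join(2-4)[OF xs(1) ys(1) this]
  show ?thesis using xs ys by simp
qed

lemma dist_edge_le:
  "{u, v} \<in> edges G \<Longrightarrow> u \<in> verts G \<Longrightarrow> v \<in> verts G \<Longrightarrow> dist_graph G u v \<le> 1"
  using dist_le_walk[of G "[u, v]"] by simp

lemma dist_commute: "reach G u v \<Longrightarrow> dist_graph G u v = dist_graph G v u"
proof -
  have "dist_graph G v u \<le> dist_graph G u v" if uv: "reach G u v" for u v
  proof -
    obtain xs where xs: "walk G xs" "hd xs = u" "last xs = v" "length xs = Suc (dist_graph G u v)"
      by (rule reachE_dist[OF uv])
    then show ?thesis using dist_le_walk[OF walk_rev[OF xs(1)]] by (simp add: hd_rev last_rev)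
  qed
  then show "reach G u v \<Longrightarrow> dist_graph G u v = dist_graph G v u"
    by (intro antisym) (auto intro: reach_sym)
qed

lemma dist_step:
  assumes "reach G u a" "{a, b} \<in> edges G" "a \<in> verts G" "b \<in> verts G"
  shows "dist_graph G u b \<le> dist_graph G u a + 1"
  using dist_triangle[OF assms(1) reach_edge[OF assms(2-4)]] dist_edge_le[OF assms(2-4)] by simp

text \<open>Cutting a shortest walk at position \<open>i\<close> gives pieces of lengths
  \<open>i\<close> and \<open>L - i\<close>, and the triangle inequality leaves no slack, so both
  pieces are shortest. The distance from \<open>u\<close> then numbers the vertices of the walk,
  which makes them distinct.\<close>

lemma geodesic:
  assumes "reach G u v"
  obtains xs where "walk G xs" "hd xs = u" "last xs = v" "length xs = Suc (dist_graph G u v)"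
    "\<And>i. i < length xs \<Longrightarrow> dist_graph G u (xs ! i) = i"
    "\<And>i. i < length xs \<Longrightarrow> dist_graph G v (xs ! i) = dist_graph G u v - i"
    "distinct xs"
proof -
  let ?L = "dist_graph G u v"
  obtain xs where xs: "walk G xs" "hd xs = u" "last xs = v" "length xs = Suc ?L"
    by (rule reachE_dist[OF assms])
  have *: "dist_graph G u (xs ! i) = i \<and> dist_graph G v (xs ! i) = ?L - i" if i: "i < length xs" for i
  proof -
    let ?x = "xs ! i"
    have sp: "take i xs @ ?x # drop (Suc i) xs = xs" using id_take_nth_drop[OF i] by simp
    with xs(1) have w: "walk G (take i xs @ [?x])" "walk G (?x # drop (Suc i) xs)"
      using walk_append_iff[of G "take i xs" ?x "drop (Suc i) xs"] by simp_all
    have h: "hd (take i xs @ [?x]) = u" using xs(2) i by (cases i; cases xs) auto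
    have l: "last (?x # drop (Suc i) xs) = v" using xs(3) sp last_appendR[of "?x # drop (Suc i) xs" "take i xs"] by simp
    have 1: "dist_graph G u ?x \<le> i" "dist_graph G ?x v \<le> ?L - i"
      using dist_le_walk[OF w(1)] dist_le_walk[OF w(2)] h l i xs(4) by auto
    have r: "reach G u ?x" "reach G ?x v"
      using walk_reach[OF w(1)] walk_reach[OF w(2)] h l by auto
    have "?L \<le> dist_graph G u ?x + dist_graph G ?x v" by (rule dist_triangle[OF r])
    then show ?thesis using 1 i xs(4) dist_commute[OF r(2)] by linarith
  qed
  have "distinct xs"
    unfolding distinct_conv_nth by (metis *)
  then show thesis using that[of xs] xs * by simp
qed

lemma dist_pred:
  assumes "reach G u x" "dist_graph G u x = Suc n"
  obtains y where "y \<in> verts G" "{y, x} \<in> edges G" "dist_graph G u y = n"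
proof -
  obtain xs where xs: "walk G xs" "last xs = x" "length xs = Suc (Suc n)"
    "\<And>i. i < length xs \<Longrightarrow> dist_graph G u (xs ! i) = i"
    by (rule geodesic[OF assms(1)]) (simp add: assms(2))
  have "last xs = xs ! Suc n" using xs by (subst last_conv_nth) auto
  then have "{xs ! n, x} \<in> edges G" "xs ! n \<in> verts G" "dist_graph G u (xs ! n) = n"
    using xs by (auto simp: walk_def)
  then show thesis using that by blast
qed

definition del_edge :: "'v ugraph \<Rightarrow> 'v set \<Rightarrow> 'v ugraph" where
  "del_edge G e = UGraph (verts G) (edges G - {e})"

lemma del_edge_simps [simp]: "verts (del_edge G e) = verts G" "edges (del_edge G e) = edges G - {e}"
  by (simp_all add: del_edge_def)

section \<open>Deficits of edges\<close>

lemma simple_edgeE: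
  assumes "simple_graph G" "e \<in> edges G"
  obtains u v where "e = {u, v}" "u \<noteq> v" "u \<in> verts G" "v \<in> verts G"
proof -
  have "card e = 2" "e \<subseteq> verts G" using assms by (auto simp: simple_graph_def)
  then show thesis using that by (auto simp: card_2_iff)
qed

lemma simple_finite_verts: "simple_graph G \<Longrightarrow> finite (verts G)"
  by (simp add: simple_graph_def)

lemma simple_finite_edges: "simple_graph G \<Longrightarrow> finite (edges G)"
  by (rule finite_subset[of _ "Pow (verts G)"]) (auto simp: simple_graph_def)

lemma simple_edge_verts:
  "simple_graph G \<Longrightarrow> {u, v} \<in> edges G \<Longrightarrow> u \<in> verts G \<and> v \<in> verts G \<and> u \<noteq> v"
  by (auto simp: simple_graph_def card_2_iff doubleton_eq_iff)

lemma connected_reach: "connected_graph G \<Longrightarrow> u \<in> verts G \<Longrightarrow> v \<in> verts G \<Longrightarrow> reach G u v"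
  by (auto simp: connected_graph_def reach_def)

lemma dist_edge_pair: "dist_edge G x {a, b} = min (dist_graph G x a) (dist_graph G x b)"
  by (simp add: dist_edge_def)

lemma dist_edge_mem:
  assumes "simple_graph G" "connected_graph G" "{u, v} \<in> edges G" "x \<in> verts G"
  shows "dist_edge G x {u, v} = 0 \<longleftrightarrow> x = u \<or> x = v"
  using simple_edge_verts[OF assms(1,3)] connected_reach[OF assms(2,4)] dist_eq_0[of G x] assms(4)
  by (auto simp: dist_edge_pair min_def)

definition deficit :: "'v ugraph \<Rightarrow> 'v set \<Rightarrow> int" where
  "deficit G e = int (card (edges G)) - 1 - edge_contribution G e"

definition deficit_sum :: "'v ugraph \<Rightarrow> int" where
  "deficit_sum G = (\<Sum>e\<in>edges G. deficit G e)"

definition equidistant_edges :: "'v ugraph \<Rightarrow> 'v \<Rightarrow> 'v \<Rightarrow> nat" where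
  "equidistant_edges G u v = card {f \<in> edges G. dist_edge G u f = dist_edge G v f}"

lemma edge_mostar_deficit:
  "edge_mostar G = int (card (edges G)) * (int (card (edges G)) - 1) - deficit_sum G"
  by (simp add: edge_mostar_def deficit_sum_def deficit_def sum_subtractf right_diff_distrib)

lemma card_edges_split:
  assumes "finite (edges G)"
  shows "card (edges G) = closer_edges G u v + closer_edges G v u + equidistant_edges G u v"
proof -
  let ?A = "{f \<in> edges G. dist_edge G u f < dist_edge G v f}"
  let ?B = "{f \<in> edges G. dist_edge G v f < dist_edge G u f}"
  let ?C = "{f \<in> edges G. dist_edge G u f = dist_edge G v f}"
  have "edges G = (?A \<union> ?B) \<union> ?C" by auto
  then have "card (edges G) = card ((?A \<union> ?B) \<union> ?C)" by simp
  also have "\<dots> = card ?A + card ?B + card ?C"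
    using assms by (subst card_Un_disjoint; (subst card_Un_disjoint)?; auto)
  finally show ?thesis by (simp add: closer_edges_def equidistant_edges_def)
qed

lemma deficit_pair:
  assumes "finite (edges G)"
  shows "deficit G {u, v} = int (equidistant_edges G u v) - 1
           + 2 * int (min (closer_edges G u v) (closer_edges G v u))"
  using card_edges_split[OF assms, of u v]
  by (auto simp: deficit_def edge_contribution_insert)

text \<open>The form in which deficits are bounded: exhibit some edges of each of the three kinds.
  The edge \<open>{u, v}\<close> itself is meant to be a member of \<open>Z\<close>; the
  \<open>- 1\<close> removes it again.\<close>

lemma deficit_ge:
  assumes "finite (edges G)" "X \<subseteq> edges G" "Y \<subseteq> edges G" "Z \<subseteq> edges G"
    "\<And>f. f \<in> X \<Longrightarrow> dist_edge G u f < dist_edge G v f"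
    "\<And>f. f \<in> Y \<Longrightarrow> dist_edge G v f < dist_edge G u f"
    "\<And>f. f \<in> Z \<Longrightarrow> dist_edge G u f = dist_edge G v f"
    "n \<le> card X" "n \<le> card Y" "k \<le> card Z"
  shows "int k - 1 + 2 * int n \<le> deficit G {u, v}"
proof -
  have "card X \<le> closer_edges G u v" "card Y \<le> closer_edges G v u"
    "card Z \<le> equidistant_edges G u v"
    unfolding closer_edges_def equidistant_edges_def using assms by (auto intro!: card_mono)
  then show ?thesis using assms(8-10) unfolding deficit_pair[OF assms(1)] by simp
qed

lemma deficit_nonneg:
  assumes "simple_graph G" "connected_graph G" "e \<in> edges G"
  shows "0 \<le> deficit G e"
proof -
  obtain u v where e: "e = {u, v}" "u \<in> verts G" "v \<in> verts G"
    using simple_edgeE[OF assms(1,3)] by metis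
  have "dist_edge G u e = dist_edge G v e"
    using e by (simp add: dist_edge_pair)
  then have "int 1 - 1 + 2 * int 0 \<le> deficit G {u, v}"
    using assms e by (intro deficit_ge[where X = "{}" and Y = "{}" and Z = "{e}"])
      (auto simp: simple_finite_edges)
  then show ?thesis using e by simp
qed

text \<open>The edge \<open>{u, a}\<close> touches \<open>u\<close> but not \<open>v\<close>, and
  \<open>{v, b}\<close> touches \<open>v\<close> but not \<open>u\<close>, so both sides of the
  difference are at least 1.\<close>

lemma deficit_nonpendent:
  assumes "simple_graph G" "connected_graph G" "{u, v} \<in> edges G"
    "{u, a} \<in> edges G" "a \<noteq> v" "{v, b} \<in> edges G" "b \<noteq> u"
  shows "2 \<le> deficit G {u, v}"
proof -
  note D = dist_edge_mem[OF assms(1,2)]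
  have V: "u \<in> verts G" "v \<in> verts G" "u \<noteq> v" using simple_edge_verts[OF assms(1,3)] by auto
  have "dist_edge G u {u, a} = 0" "dist_edge G v {u, a} \<noteq> 0"
    "dist_edge G v {v, b} = 0" "dist_edge G u {v, b} \<noteq> 0"
    "dist_edge G u {u, v} = 0" "dist_edge G v {u, v} = 0"
    unfolding D[OF assms(3) V(1)] D[OF assms(3) V(2)] D[OF assms(4) V(1)] D[OF assms(4) V(2)]
      D[OF assms(6) V(1)] D[OF assms(6) V(2)]
    using V assms(5,7) by simp_all
  then have "int 1 - 1 + 2 * int 1 \<le> deficit G {u, v}"
    by (intro deficit_ge[where X = "{{u, a}}" and Y = "{{v, b}}" and Z = "{{u, v}}"])
      (simp_all add: simple_finite_edges[OF assms(1)] assms(3,4,6))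
  then show ?thesis by simp
qed

lemma deficit_pendent:
  assumes "simple_graph G" "connected_graph G" "{u, v} \<in> edges G"
    and only: "\<And>f. f \<in> edges G \<Longrightarrow> v \<in> f \<Longrightarrow> f = {u, v}"
  shows "deficit G {u, v} = 0"
proof -
  have fin: "finite (edges G)" by (rule simple_finite_edges[OF assms(1)])
  have V: "u \<in> verts G" "v \<in> verts G" "u \<noteq> v" using simple_edge_verts[OF assms(1,3)] by auto
  have d: "dist_graph G u x < dist_graph G v x" if x: "x \<in> verts G" "x \<noteq> v" for x
  proof -
    \<comment> \<open>The distance from \<open>u\<close>, except that the value at \<open>v\<close>
      is lowered from 1 to -1. This is still 1-Lipschitz because \<open>u\<close>, with value 0, is
      the only neighbour of \<open>v\<close>, and it shows that every other vertex is farther from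
      \<open>v\<close> than from \<open>u\<close>.\<close>
    define \<phi> where "\<phi> y = (if y = v then - 1 else int (dist_graph G u y))" for y
    have "\<phi> b \<le> \<phi> a + 1" if ab: "a \<in> verts G" "b \<in> verts G" "{a, b} \<in> edges G" for a b
    proof -
      have "a = v \<longrightarrow> b = u" "b = v \<longrightarrow> a = u"
        using only[OF ab(3)] V by (auto simp: doubleton_eq_iff)
      then show ?thesis
        using dist_step[OF connected_reach[OF assms(2) V(1) ab(1)] ab(3,1,2)] V by (auto simp: \<phi>_def)
    qed
    from dist_ge[where \<phi> = \<phi>, OF connected_reach[OF assms(2) V(2) x(1)] this]
    show ?thesis using x V by (simp add: \<phi>_def)
  qed
  have "dist_edge G u f < dist_edge G v f" if f: "f \<in> edges G - {{u, v}}" for f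
  proof -
    obtain a b where ab: "f = {a, b}" "a \<in> verts G" "b \<in> verts G"
      using simple_edgeE[OF assms(1)] f by (metis DiffD1)
    then have "a \<noteq> v" "b \<noteq> v" using only[of f] f by auto
    then show ?thesis using d[of a] d[of b] ab by (auto simp: dist_edge_pair)
  qed
  then have "card (edges G - {{u, v}}) \<le> closer_edges G u v"
    unfolding closer_edges_def using fin by (intro card_mono) auto
  moreover have "card {{u, v}} \<le> equidistant_edges G u v"
    unfolding equidistant_edges_def using fin assms(3) V by (intro card_mono) (auto simp: dist_edge_pair)
  moreover have "card (edges G) > 0" using assms(3) fin by (auto simp: card_gt_0_iff)
  ultimately show ?thesis
    unfolding deficit_pair[OF fin] using card_edges_split[OF fin, of u v] assms(3)
    by (simp add: card_Diff_singleton)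
qed

section \<open>Deleting an edge that lies on a cycle\<close>

lemma dist_mono:
  assumes "reach H u v" "verts H \<subseteq> verts G" "edges H \<subseteq> edges G"
  shows "dist_graph G u v \<le> dist_graph H u v"
proof -
  obtain xs where xs: "walk H xs" "hd xs = u" "last xs = v" "length xs = Suc (dist_graph H u v)"
    by (rule reachE_dist[OF assms(1)])
  then show ?thesis using dist_le_walk[OF walk_mono[OF xs(1) assms(2,3)]] by simp
qed

lemma reach_del_edge:
  assumes "simple_graph G" "connected_graph G" "reach (del_edge G {u, v}) u v" "{u, v} \<in> edges G"
    and "x \<in> verts G"
  shows "reach (del_edge G {u, v}) u x"
proof (rule reach_invariant[of G "reach (del_edge G {u, v}) u" u])
  have V: "u \<in> verts G" "v \<in> verts G" using simple_edge_verts[OF assms(1,4)] by auto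
  show "reach G u x" using connected_reach[OF assms(2) V(1) assms(5)] .
  show "reach (del_edge G {u, v}) u u" using V by (simp add: reach_refl)
  fix a b assume ab: "a \<in> verts G" "b \<in> verts G" "{a, b} \<in> edges G" "reach (del_edge G {u, v}) u a"
  show "reach (del_edge G {u, v}) u b"
  proof (cases "{a, b} = {u, v}")
    case True
    then have "b = u \<or> b = v" by (auto simp: doubleton_eq_iff)
    then show ?thesis using assms(3) V by (auto simp: reach_refl)
  next
    case False
    then show ?thesis
      using reach_trans[OF ab(4) reach_edge[of a b]] ab by simp
  qed
qed

text \<open>A shortest walk from \<open>u\<close> either avoids the edge or starts with it. For the
  lower bound the right-hand side serves as the 1-Lipschitz function: it is 0 at \<open>u\<close>
  and at most 1 at \<open>v\<close>, and along any other edge both distances in \<open>H\<close>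
  change by at most 1.\<close>

lemma dist_del_edge:
  assumes "simple_graph G" "connected_graph G" "reach (del_edge G {u, v}) u v" "{u, v} \<in> edges G"
    and "x \<in> verts G"
  defines "H \<equiv> del_edge G {u, v}"
  shows "dist_graph G u x = min (dist_graph H u x) (1 + dist_graph H v x)"
proof -
  have V: "u \<in> verts G" "v \<in> verts G" using simple_edge_verts[OF assms(1,4)] by auto
  have R: "reach H u y" "reach H v y" if "y \<in> verts G" for y
    using reach_del_edge[OF assms(1-4) that] reach_trans[OF reach_sym[OF assms(3)]]
    by (auto simp: H_def)
  have sub: "verts H \<subseteq> verts G" "edges H \<subseteq> edges G" by (auto simp: H_def)
  have "dist_graph G u x \<le> dist_graph H u x" "dist_graph G v x \<le> dist_graph H v x"
    using dist_mono[OF _ sub] R[OF assms(5)] by auto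
  moreover have "dist_graph G u x \<le> dist_graph G u v + dist_graph G v x"
    using connected_reach[OF assms(2)] V assms(5) by (intro dist_triangle) auto
  moreover have "dist_graph G u v \<le> 1" using dist_edge_le[OF assms(4) V] .
  moreover have "min (dist_graph H u x) (1 + dist_graph H v x) \<le> dist_graph G u x"
  proof -
    define \<phi> where "\<phi> y = int (min (dist_graph H u y) (1 + dist_graph H v y))" for y
    have "\<phi> b \<le> \<phi> a + 1" if ab: "a \<in> verts G" "b \<in> verts G" "{a, b} \<in> edges G" for a b
    proof (cases "{a, b} = {u, v}")
      case True
      have "dist_graph H u u = 0" "dist_graph H v v = 0" using V by (auto simp: H_def)
      then show ?thesis using True by (auto simp: \<phi>_def doubleton_eq_iff)
    next
      case False
      then have "{a, b} \<in> edges H" "a \<in> verts H" "b \<in> verts H" using ab by (auto simp: H_def)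
      from dist_step[OF R(1)[OF ab(1)] this] dist_step[OF R(2)[OF ab(1)] this]
      show ?thesis by (auto simp: \<phi>_def)
    qed
    from dist_ge[where \<phi> = \<phi>, OF connected_reach[OF assms(2) V(1) assms(5)] this]
    show ?thesis using V by (simp add: \<phi>_def H_def)
  qed
  ultimately show ?thesis by simp
qed

lemma edge_ends_distinct:
  assumes "distinct xs" "Suc i < length xs" "Suc j < length xs" "{xs ! i, xs ! Suc i} = {xs ! j, xs ! Suc j}"
  shows "i = j"
  using assms by (auto simp: doubleton_eq_iff nth_eq_iff_index_eq)

text \<open>An edge on a shortest cycle of length \<open>L + 1\<close> splits the remaining \<open>L\<close> edges of the
  cycle evenly between its two ends, up to one opposite edge if \<open>L\<close> is odd.\<close>

lemma deficit_nonbridge: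
  assumes "simple_graph G" "connected_graph G" "reach (del_edge G {u, v}) u v" "{u, v} \<in> edges G"
  shows "int (dist_graph (del_edge G {u, v}) u v) \<le> deficit G {u, v}"
proof -
  define H where "H = del_edge G {u, v}"
  define L where "L = dist_graph H u v"
  have V: "u \<in> verts G" "v \<in> verts G" using simple_edge_verts[OF assms(1,4)] by auto
  obtain xs where xs: "walk H xs" "hd xs = u" "last xs = v" "length xs = Suc L"
    "\<And>i. i < length xs \<Longrightarrow> dist_graph H u (xs ! i) = i"
    "\<And>i. i < length xs \<Longrightarrow> dist_graph H v (xs ! i) = L - i"
    "distinct xs"
    using geodesic[OF assms(3)] unfolding H_def L_def by blast
  have inV: "xs ! i \<in> verts G" if "i \<le> L" for i
    using xs(1,4) that by (auto simp: walk_def H_def)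
  \<comment> \<open>The two ways around the cycle of length \<open>L + 1\<close>: along the path, or
    over the deleted edge and back from \<open>v\<close>.\<close>
  have du: "dist_graph G u (xs ! i) = min i (Suc L - i)" if "i \<le> L" for i
    using dist_del_edge[OF assms inV[OF that]] xs(4,5,6) that by (auto simp: H_def)
  have assms': "reach (del_edge G {v, u}) v u" "{v, u} \<in> edges G"
    using assms(3,4) by (auto simp: insert_commute intro: reach_sym)
  have dv: "dist_graph G v (xs ! i) = min (L - i) (Suc i)" if "i \<le> L" for i
    using dist_del_edge[OF assms(1,2) assms' inV[OF that]] xs(4,5,6) that
    by (auto simp: H_def insert_commute)
  define f where "f i = {xs ! i, xs ! Suc i}" for i
  have fE: "f i \<in> edges G" "f i \<noteq> {u, v}" if "i < L" for i
    using xs(1,4) that by (auto simp: walk_def f_def H_def)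
  have fu: "dist_edge G u (f i) = min i (L - i)" "dist_edge G v (f i) = min (L - Suc i) (Suc i)"
    if "i < L" for i
    using du[of i] du[of "Suc i"] dv[of i] dv[of "Suc i"] that
    by (auto simp: f_def dist_edge_pair min_def)
  have inj: "inj_on f {..<L}"
    using edge_ends_distinct[OF xs(7)] xs(4) by (auto simp: inj_on_def f_def)
  define C where "C = (if odd L then {{u, v}, f (L div 2)} else {{u, v}})"
  have "int (1 + L mod 2) - 1 + 2 * int (L div 2) \<le> deficit G {u, v}"
  proof (rule deficit_ge)
    show "finite (edges G)" by (rule simple_finite_edges[OF assms(1)])
    show "f ` {..<L div 2} \<subseteq> edges G" using fE by auto
    show "f ` {(L + 1) div 2..<L} \<subseteq> edges G" using fE by auto
    have h: "L div 2 < L" if "odd L" using that by (cases L) auto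
    then show "C \<subseteq> edges G" using fE assms(4) by (auto simp: C_def)
    show "dist_edge G u e < dist_edge G v e" if "e \<in> f ` {..<L div 2}" for e
      using that fu by auto
    show "dist_edge G v e < dist_edge G u e" if "e \<in> f ` {(L + 1) div 2..<L}" for e
      using that fu by auto
    have "dist_edge G u {u, v} = 0" "dist_edge G v {u, v} = 0"
      using V by (auto simp: dist_edge_pair)
    moreover have "dist_edge G u (f (L div 2)) = dist_edge G v (f (L div 2))" if "odd L"
      using fu[OF h[OF that]] that by (auto elim!: oddE)
    ultimately show "dist_edge G u e = dist_edge G v e" if "e \<in> C" for e
      using that by (auto simp: C_def split: if_splits)
    show "L div 2 \<le> card (f ` {..<L div 2})"
      by (subst card_image[OF inj_on_subset[OF inj]]) auto
    show "L div 2 \<le> card (f ` {(L + 1) div 2..<L})"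
      by (subst card_image[OF inj_on_subset[OF inj]]) auto
    show "1 + L mod 2 \<le> card C"
    proof (cases "odd L")
      case True
      then have "{u, v} \<noteq> f (L div 2)" using fE(2)[OF h[OF True]] by simp
      then show ?thesis using True by (simp add: C_def odd_iff_mod_2_eq_one)
    qed (simp add: C_def even_iff_mod_2_eq_zero)
  qed
  also have "int (1 + L mod 2) - 1 + 2 * int (L div 2) = int L"
    by presburger
  finally show ?thesis by (simp add: L_def H_def)
qed

text \<open>Distances from the corners of a triangle to an edge differ by at most 1, so two of
  them agree: every edge is equidistant from the ends of some side.\<close>

lemma deficit_triangle:
  assumes "simple_graph G" "connected_graph G" "{a, b} \<in> edges G" "{b, c} \<in> edges G" "{c, a} \<in> edges G"
  shows "int (card (edges G)) + 3 \<le> deficit G {a, b} + deficit G {b, c} + deficit G {c, a}"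
proof -
  have fin: "finite (edges G)" by (rule simple_finite_edges[OF assms(1)])
  have V: "a \<in> verts G" "b \<in> verts G" "c \<in> verts G" "a \<noteq> b" "b \<noteq> c" "c \<noteq> a"
    using simple_edge_verts[OF assms(1)] assms(3-5) by blast+
  note R = connected_reach[OF assms(2)]
  have near: "dist_edge G x f \<le> dist_edge G y f + 1"
    if xy: "{x, y} \<in> edges G" and fE: "f \<in> edges G" for x y f
  proof -
    obtain s t where f: "f = {s, t}" "s \<in> verts G" "t \<in> verts G"
      using simple_edgeE[OF assms(1) fE] by metis
    have "x \<in> verts G" "y \<in> verts G" using simple_edge_verts[OF assms(1) xy] by auto
    then have "dist_graph G x z \<le> dist_graph G y z + 1" if "z \<in> verts G" for z
      using dist_triangle[OF R R, of x y z] dist_edge_le[OF xy] that by simp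
    from this[of s] this[of t] f show ?thesis by (auto simp: dist_edge_pair)
  qed
  let ?Q = "\<lambda>x y. {f \<in> edges G. dist_edge G x f = dist_edge G y f}"
  have "edges G \<subseteq> ?Q a b \<union> ?Q b c \<union> ?Q c a"
  proof
    fix f assume f: "f \<in> edges G"
    have "dist_edge G a f = dist_edge G b f \<or> dist_edge G b f = dist_edge G c f
        \<or> dist_edge G c f = dist_edge G a f"
      using near[of a b f] near[of b a f] near[of b c f] near[of c b f] near[of c a f] near[of a c f]
        f assms(3-5) by (simp add: insert_commute) linarith
    then show "f \<in> ?Q a b \<union> ?Q b c \<union> ?Q c a" using f by auto
  qed
  then have "card (edges G) \<le> card (?Q a b \<union> ?Q b c \<union> ?Q c a)"
    using fin by (intro card_mono) auto
  also have "\<dots> \<le> card (?Q a b) + card (?Q b c) + card (?Q c a)"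
    using card_Un_le[of "?Q a b \<union> ?Q b c" "?Q c a"] card_Un_le[of "?Q a b" "?Q b c"] by linarith
  finally have m: "card (edges G)
      \<le> equidistant_edges G a b + equidistant_edges G b c + equidistant_edges G c a"
    by (simp add: equidistant_edges_def)
  \<comment> \<open>At each corner the two incident sides separate it from the other corners, so all
    six numbers m_u, m_v of the three sides are at least 1. The three sides then add 3 * (2 - 1) to
    the count of equidistant edges.\<close>
  have pos: "1 \<le> closer_edges G x y" if "x \<in> verts G" "y \<in> verts G" "{x, z} \<in> edges G"
    "y \<noteq> x" "y \<noteq> z" for x y z
  proof -
    have "card {{x, z}} \<le> closer_edges G x y"
      unfolding closer_edges_def
    proof (rule card_mono)
      have "dist_edge G x {x, z} = 0" "dist_edge G y {x, z} \<noteq> 0"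
        using dist_edge_mem[OF assms(1,2) that(3)] that by auto
      then show "{{x, z}} \<subseteq> {f \<in> edges G. dist_edge G x f < dist_edge G y f}"
        using that by auto
    qed (use fin in auto)
    then show ?thesis by simp
  qed
  have "1 \<le> closer_edges G a b" "1 \<le> closer_edges G b a" "1 \<le> closer_edges G b c"
    "1 \<le> closer_edges G c b" "1 \<le> closer_edges G c a" "1 \<le> closer_edges G a c"
    using pos[of a b c] pos[of b a c] pos[of b c a] pos[of c b a] pos[of c a b] pos[of a c b]
      V assms(3-5) by (simp_all add: insert_commute)
  then show ?thesis using m unfolding deficit_pair[OF fin] by simp
qed

section \<open>Cycles and ears\<close>

text \<open>\<open>T\<close> is a spanning forest with exactly one vertex of \<open>W\<close> in
  each tree, and \<open>r\<close> maps each vertex to the one of its tree. The induction enlarges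
  \<open>W\<close> by a vertex \<open>y\<close> adjacent to it until \<open>W\<close> is everything;
  on the way back \<open>y\<close> stops being a root.\<close>

lemma grow_spanning:
  assumes "simple_graph G" "connected_graph G" "W \<subseteq> verts G" "W \<noteq> {}"
  shows "\<exists>T r. T \<subseteq> edges G \<and> card T + card W = card (verts G) \<and> T \<inter> Pow W = {}
    \<and> (\<forall>x\<in>verts G. r x \<in> W) \<and> (\<forall>x\<in>W. r x = x) \<and> (\<forall>s t. {s, t} \<in> T \<longrightarrow> r s = r t)
    \<and> (\<forall>x\<in>verts G. reach (UGraph (verts G) T) x (r x))"
  using assms(3,4)
proof (induction "card (verts G - W)" arbitrary: W)
  case 0
  then have "W = verts G" using simple_finite_verts[OF assms(1)] by auto
  then show ?case
    by (intro exI[of _ "{}"] exI[of _ "\<lambda>x. x"]) (auto intro: reach_refl)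
next
  case (Suc n)
  note fin = simple_finite_verts[OF assms(1)]
  obtain w where w: "w \<in> W" using Suc.prems by blast
  have "verts G - W \<noteq> {}" using Suc.hyps(2) by (metis card.empty nat.distinct(1))
  then obtain z where z: "z \<in> verts G" "z \<notin> W" by blast
  have "\<exists>x y. x \<in> W \<and> y \<in> verts G \<and> y \<notin> W \<and> {x, y} \<in> edges G"
  proof (rule ccontr)
    assume "\<not> ?thesis"
    then have "z \<in> W"
      using reach_invariant[of G "\<lambda>x. x \<in> W" w z] connected_reach[OF assms(2), of w z] w z Suc.prems
      by blast
    then show False using z by blast
  qed
  then obtain x y where xy: "x \<in> W" "y \<in> verts G" "y \<notin> W" "{x, y} \<in> edges G" by blast
  have "card (verts G - insert y W) = n"
  proof -
    have "verts G - insert y W = (verts G - W) - {y}" by auto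
    then show ?thesis using Suc.hyps(2) xy fin by simp
  qed
  moreover have "insert y W \<subseteq> verts G" using xy Suc.prems by auto
  ultimately obtain T r where "T \<subseteq> edges G \<and> card T + card (insert y W) = card (verts G) \<and>
    T \<inter> Pow (insert y W) = {} \<and> (\<forall>x\<in>verts G. r x \<in> insert y W) \<and> (\<forall>x\<in>insert y W. r x = x) \<and>
    (\<forall>s t. {s, t} \<in> T \<longrightarrow> r s = r t) \<and> (\<forall>x\<in>verts G. reach (UGraph (verts G) T) x (r x))"
    using Suc.hyps(1)[of "insert y W"] by blast
  then have T: "T \<subseteq> edges G" "card T + card (insert y W) = card (verts G)"
    "T \<inter> Pow (insert y W) = {}" "\<And>x. x \<in> verts G \<Longrightarrow> r x \<in> insert y W"
    "\<And>x. x \<in> insert y W \<Longrightarrow> r x = x" "\<And>s t. {s, t} \<in> T \<Longrightarrow> r s = r t"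
    "\<And>x. x \<in> verts G \<Longrightarrow> reach (UGraph (verts G) T) x (r x)"
    by blast+
  \<comment> \<open>The new edge \<open>{x, y}\<close> joins the tree of \<open>y\<close> to that of
    \<open>x\<close>, so the vertices rooted at \<open>y\<close> get the root
    \<open>x\<close>.\<close>
  define r' where "r' s = (if r s = y then x else r s)" for s
  let ?T = "insert {x, y} T"
  have finT: "finite T" using T(1) simple_finite_edges[OF assms(1)] finite_subset by blast
  have finW: "finite W" using Suc.prems fin finite_subset by blast
  have new: "{x, y} \<notin> T" using T(3) xy by auto
  show ?case
  proof (intro exI[of _ ?T] exI[of _ r'] conjI ballI allI impI)
    show "?T \<subseteq> edges G" using T(1) xy by auto
    show "card ?T + card W = card (verts G)"
      using T(2) new finT finW xy by simp
    show "?T \<inter> Pow W = {}" using T(3) xy by auto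
    show "r' v \<in> W" if "v \<in> verts G" for v
      using T(4)[OF that] xy by (auto simp: r'_def)
    show "r' v = v" if "v \<in> W" for v
      using T(5)[of v] that xy by (auto simp: r'_def)
    show "r' s = r' t" if "{s, t} \<in> ?T" for s t
      using that T(6)[of s t] T(5)[of x] T(5)[of y] xy by (auto simp: r'_def doubleton_eq_iff)
    show "reach (UGraph (verts G) ?T) v (r' v)" if "v \<in> verts G" for v
    proof -
      have 1: "reach (UGraph (verts G) ?T) v (r v)"
        using T(7)[OF that] by (rule reach_mono) auto
      have "reach (UGraph (verts G) ?T) y x"
        using xy Suc.prems by (intro reach_edge) (auto simp: insert_commute)
      then show ?thesis using 1 reach_trans[of _ v y x] by (auto simp: r'_def)
    qed
  qed
qed

text \<open>A forest rooted at \<open>W\<close> has |V| - |W| edges, none inside \<open>W\<close>.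
  With the |W| + 1 edges of \<open>F\<close> this makes |V| + 1, which is already the number of all
  edges of a bicyclic graph. So outside \<open>F\<close> only trees hang at \<open>W\<close>, and
  \<open>r\<close> is constant on each of them.\<close>

lemma core_retraction:
  assumes "bicyclic G" "W \<subseteq> verts G" "W \<noteq> {}" "F \<subseteq> edges G" "F \<subseteq> Pow W" "card F = card W + 1"
  obtains r where "\<And>x. x \<in> verts G \<Longrightarrow> r x \<in> W" "\<And>x. x \<in> W \<Longrightarrow> r x = x"
    "\<And>s t. {s, t} \<in> edges G \<Longrightarrow> {s, t} \<notin> F \<Longrightarrow> r s = r t"
proof -
  have G: "simple_graph G" "connected_graph G" "card (edges G) = card (verts G) + 1"
    using assms(1) by (auto simp: bicyclic_def)
  obtain T r where T: "T \<subseteq> edges G" "card T + card W = card (verts G)" "T \<inter> Pow W = {}"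
    "\<forall>x\<in>verts G. r x \<in> W" "\<forall>x\<in>W. r x = x" "\<forall>s t. {s, t} \<in> T \<longrightarrow> r s = r t"
    using grow_spanning[OF G(1,2) assms(2,3)] by blast
  have fin: "finite (edges G)" by (rule simple_finite_edges[OF G(1)])
  have "card (T \<union> F) = card T + card F"
    using T(1,3) assms(4,5) fin finite_subset by (intro card_Un_disjoint) blast+
  then have "T \<union> F = edges G"
    using T(1,2) assms(4,6) G(3) fin by (intro card_subset_eq) auto
  then show thesis using that[of r] T(4-6) by blast
qed

section \<open>Paths and cycles as lists of vertices\<close>

fun path_edges :: "'v list \<Rightarrow> 'v set set" where
  "path_edges (x # y # xs) = insert {x, y} (path_edges (y # xs))"
| "path_edges _ = {}"

text \<open>The first vertex of a cycle is not repeated at the end of its list; the length of the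
  list is thus the length of the cycle.\<close>

definition cycle_edges :: "'v list \<Rightarrow> 'v set set" where
  "cycle_edges cs = insert {last cs, hd cs} (path_edges cs)"

definition is_cycle :: "'v ugraph \<Rightarrow> 'v list \<Rightarrow> bool" where
  "is_cycle G cs \<longleftrightarrow> walk G cs \<and> distinct cs \<and> 3 \<le> length cs \<and> {last cs, hd cs} \<in> edges G"

definition nonbridge :: "'v ugraph \<Rightarrow> 'v set \<Rightarrow> bool" where
  "nonbridge G e \<longleftrightarrow> e \<in> edges G \<and> (\<forall>u v. e = {u, v} \<longrightarrow> reach (del_edge G e) u v)"

lemma path_edges_subset: "e \<in> path_edges xs \<Longrightarrow> e \<subseteq> set xs"
  by (induction xs rule: path_edges.induct) auto

lemma walk_path_edges: "walk G xs \<longleftrightarrow> xs \<noteq> [] \<and> set xs \<subseteq> verts G \<and> path_edges xs \<subseteq> edges G"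
  by (induction xs rule: path_edges.induct) auto

lemma path_edges_append: "path_edges (xs @ x # ys) = path_edges (xs @ [x]) \<union> path_edges (x # ys)"
proof (induction xs)
  case (Cons a xs)
  then show ?case by (cases xs) auto
qed simp

lemma path_edges_split:
  assumes "e \<in> path_edges xs"
  shows "\<exists>ys a b zs. xs = ys @ a # b # zs \<and> e = {a, b}"
  using assms
proof (induction xs rule: path_edges.induct)
  case (1 x y xs)
  show ?case
  proof (cases "e = {x, y}")
    case True
    then show ?thesis by (intro exI[of _ "[]"]) auto
  next
    case False
    with 1 obtain ys a b zs where "y # xs = ys @ a # b # zs" "e = {a, b}" by auto
    then show ?thesis by (intro exI[of _ "x # ys"]) auto
  qed
qed auto

lemma finite_path_edges: "finite (path_edges xs)"
  by (induction xs rule: path_edges.induct) auto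

lemma card_path_edges: "distinct xs \<Longrightarrow> card (path_edges xs) = length xs - 1"
proof (induction xs rule: path_edges.induct)
  case (1 x y xs)
  have "{x, y} \<notin> path_edges (y # xs)" using path_edges_subset[of "{x, y}" "y # xs"] 1 by auto
  then show ?case using 1 finite_path_edges[of "y # xs"] by simp
qed auto

lemma closing_edge_notin:
  assumes "distinct cs" "3 \<le> length cs"
  shows "{last cs, hd cs} \<notin> path_edges cs"
proof
  assume "{last cs, hd cs} \<in> path_edges cs"
  then obtain ys a b zs where cs: "cs = ys @ a # b # zs" "{last cs, hd cs} = {a, b}"
    using path_edges_split by blast
  show False
  proof (cases ys)
    case Nil
    then have "last (b # zs) = b" "distinct (b # zs)" "zs \<noteq> []"
      using cs assms by (auto simp: doubleton_eq_iff)
    then show False by (cases zs rule: rev_cases) auto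
  next
    case (Cons c ys')
    then have "c \<in> {a, b}" using cs(2) by (auto simp: cs(1))
    then show False using assms(1) Cons by (auto simp: cs(1))
  qed
qed

lemma card_cycle_edges: "distinct cs \<Longrightarrow> 3 \<le> length cs \<Longrightarrow> card (cycle_edges cs) = length cs"
  by (simp add: cycle_edges_def closing_edge_notin card_path_edges finite_path_edges)

lemma finite_cycle_edges: "finite (cycle_edges cs)"
  by (simp add: cycle_edges_def finite_path_edges)

lemma cycle_edges_subset: "cs \<noteq> [] \<Longrightarrow> e \<in> cycle_edges cs \<Longrightarrow> e \<subseteq> set cs"
  using path_edges_subset[of e cs] by (auto simp: cycle_edges_def)

lemma is_cycle_edges:
  "is_cycle G cs \<longleftrightarrow> set cs \<subseteq> verts G \<and> distinct cs \<and> 3 \<le> length cs \<and> cycle_edges cs \<subseteq> edges G"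
  by (auto simp: is_cycle_def walk_path_edges cycle_edges_def)

lemma nonbridgeI:
  "{u, v} \<in> edges G \<Longrightarrow> reach (del_edge G {u, v}) u v \<Longrightarrow> nonbridge G {u, v}"
  by (auto simp: nonbridge_def doubleton_eq_iff insert_commute intro: reach_sym)

lemma path_reach_hd_last:
  assumes "set xs \<subseteq> verts G" "path_edges xs \<subseteq> edges G" "x \<in> set xs"
  shows "reach G (hd xs) x" "reach G x (last xs)"
proof -
  obtain ys zs where xs: "xs = ys @ x # zs" using assms(3) split_list by metis
  have "walk G xs" using assms by (auto simp: walk_path_edges)
  then have w: "walk G (ys @ [x])" "walk G (x # zs)"
    using walk_appendD[of G ys x zs] unfolding xs by blast+
  show "reach G (hd xs) x" using walk_reach[OF w(1)] by (cases ys) (auto simp: xs)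
  show "reach G x (last xs)" using walk_reach[OF w(2)] by (simp add: xs)
qed

lemma cycle_nonbridge:
  assumes "is_cycle G cs" "e \<in> cycle_edges cs"
  shows "nonbridge G e"
proof (cases "e = {last cs, hd cs}")
  case True
  have "{last cs, hd cs} \<notin> path_edges cs"
    using closing_edge_notin assms(1) by (auto simp: is_cycle_def)
  then have "walk (del_edge G e) cs"
    using assms(1) True by (auto simp: is_cycle_def walk_path_edges)
  from walk_reach[OF this] show ?thesis
    using True assms(1) by (auto simp: is_cycle_def intro!: nonbridgeI intro: reach_sym)
next
  case False
  then have "e \<in> path_edges cs" using assms(2) by (simp add: cycle_edges_def)
  then obtain ys a b zs where cs: "cs = ys @ a # b # zs" and e: "e = {a, b}"
    using path_edges_split by blast
  have C: "distinct cs" "3 \<le> length cs" "set cs \<subseteq> verts G" "path_edges cs \<subseteq> edges G"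
    "{last cs, hd cs} \<in> edges G" "e \<in> edges G"
    using assms by (auto simp: is_cycle_def walk_path_edges cycle_edges_def)
  have ends: "hd cs \<in> verts G" "last cs \<in> verts G"
    using C(3) hd_in_set[of cs] last_in_set[of cs] by (auto simp: cs)
  let ?H = "del_edge G e"
  have pe: "path_edges cs = path_edges (ys @ [a]) \<union> insert {a, b} (path_edges (b # zs))"
    unfolding cs path_edges_append[of ys a "b # zs"] by simp
  have "e \<notin> path_edges (ys @ [a])" "e \<notin> path_edges (b # zs)"
    using path_edges_subset[of e "ys @ [a]"] path_edges_subset[of e "b # zs"] C(1)
    by (auto simp: cs e)
  then have "walk ?H (ys @ [a])" "walk ?H (b # zs)"
    using C(3,4) pe by (auto simp: walk_path_edges cs)
  moreover have "hd (ys @ [a]) = hd cs" "last (b # zs) = last cs"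
    by (cases ys; simp add: cs)+
  ultimately have "reach ?H (hd cs) a" "reach ?H b (last cs)"
    using walk_reach[of ?H "ys @ [a]"] walk_reach[of ?H "b # zs"] by auto
  moreover have "reach ?H (last cs) (hd cs)"
    using C(5) False ends by (intro reach_edge) auto
  ultimately have "reach ?H a b" by (meson reach_sym reach_trans)
  then show ?thesis using C(6) e nonbridgeI by simp
qed

text \<open>A shortest path between the ends that avoids the edge closes up with it. Recording the
  length of the resulting cycle turns the bound of \<open>deficit_nonbridge\<close> into a bound in
  terms of cycle lengths.\<close>

lemma nonbridge_cycle:
  assumes "simple_graph G" "nonbridge G {u, v}"
  obtains cs where "is_cycle G cs" "hd cs = u" "last cs = v"
    "length cs = Suc (dist_graph (del_edge G {u, v}) u v)"
proof -
  let ?H = "del_edge G {u, v}"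
  have r: "reach ?H u v" and e: "{u, v} \<in> edges G"
    using assms(2) by (auto simp: nonbridge_def)
  have ne: "u \<noteq> v" using simple_edge_verts[OF assms(1) e] by simp
  obtain xs where xs: "walk ?H xs" "hd xs = u" "last xs = v" "length xs = Suc (dist_graph ?H u v)"
    "distinct xs"
    by (rule geodesic[OF r]) (rule that; assumption)
  have "3 \<le> length xs"
  proof (rule ccontr)
    assume "\<not> ?thesis"
    then have "length xs \<le> 2" by simp
    moreover obtain a ys where "xs = a # ys" using xs(1) by (cases xs) auto
    ultimately have "xs = [u] \<or> xs = [u, v]" using xs(2,3) by (cases ys) auto
    then show False
    proof
      assume "xs = [u]" then show False using xs(3) ne by simp
    next
      assume "xs = [u, v]" then show False using xs(1) by simp
    qed
  qed
  moreover have "walk G xs" using xs(1) by (rule walk_mono) auto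
  ultimately have "is_cycle G xs" using xs e by (auto simp: is_cycle_def insert_commute)
  then show thesis using that xs by blast
qed

lemma deficit_ge_girth:
  assumes "simple_graph G" "connected_graph G" "nonbridge G e"
    and "\<And>cs. is_cycle G cs \<Longrightarrow> e \<in> cycle_edges cs \<Longrightarrow> Suc k \<le> length cs"
  shows "int k \<le> deficit G e"
proof -
  obtain u v where e: "e = {u, v}"
    using assms(1,3) simple_edgeE unfolding nonbridge_def by metis
  obtain cs where cs: "is_cycle G cs" "hd cs = u" "last cs = v"
    "length cs = Suc (dist_graph (del_edge G {u, v}) u v)"
    using nonbridge_cycle assms(1,3) unfolding e by metis
  have "k \<le> dist_graph (del_edge G {u, v}) u v"
    using assms(4)[OF cs(1)] cs by (simp add: e cycle_edges_def insert_commute)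
  also have "int \<dots> \<le> deficit G {u, v}"
    using assms(3) by (intro deficit_nonbridge[OF assms(1,2)]) (auto simp: e nonbridge_def)
  finally show ?thesis by (simp add: e)
qed

lemma deficit_sum_ge:
  assumes "simple_graph G" "connected_graph G" "S \<subseteq> edges G"
  shows "(\<Sum>e\<in>S. deficit G e) \<le> deficit_sum G"
  unfolding deficit_sum_def
  using assms simple_finite_edges deficit_nonneg by (intro sum_mono2) auto

text \<open>A forest with the single root \<open>w\<close> is a spanning tree. It has |V| - 1 edges,
  so some edge is left out, and the tree joins the ends of this edge without using it.\<close>

lemma bicyclic_has_cycle:
  assumes "bicyclic G"
  shows "\<exists>cs. is_cycle G cs"
proof -
  have G: "simple_graph G" "connected_graph G" "card (edges G) = card (verts G) + 1"
    using assms by (auto simp: bicyclic_def)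
  obtain w where w: "w \<in> verts G" using G(2) by (auto simp: connected_graph_def)
  obtain T r where T: "T \<subseteq> edges G" "card T + card {w} = card (verts G)"
    "\<forall>x\<in>verts G. r x \<in> {w}" "\<forall>x\<in>verts G. reach (UGraph (verts G) T) x (r x)"
    using grow_spanning[OF G(1,2), of "{w}"] w by blast
  have "T \<noteq> edges G" using T(2) G(3) by auto
  then obtain e where e: "e \<in> edges G" "e \<notin> T" using T(1) by blast
  then obtain u v where uv: "e = {u, v}" "u \<in> verts G" "v \<in> verts G"
    using simple_edgeE[OF G(1)] by metis
  have "reach (UGraph (verts G) T) u w" "reach (UGraph (verts G) T) v w"
    using T(3,4) uv by auto
  then have "reach (UGraph (verts G) T) u v" by (meson reach_sym reach_trans)
  then have "reach (del_edge G e) u v" using T(1) e by (elim reach_mono) auto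
  then have "nonbridge G {u, v}" using e uv nonbridgeI by metis
  then show ?thesis using nonbridge_cycle[OF G(1)] by metis
qed

section \<open>Ears, and second cycles in the absence of ears\<close>

lemma shortest_connection:
  assumes "reach H x y" "x \<in> S" "y \<in> S" "x \<noteq> y"
  shows "\<exists>P. walk H P \<and> distinct P \<and> 2 \<le> length P \<and> hd P \<in> S \<and> last P \<in> S
           \<and> set (butlast (tl P)) \<inter> S = {}"
proof -
  \<comment> \<open>The path is a shortest walk between different vertices of \<open>S\<close>. An
    inner vertex in \<open>S\<close> would give a shorter walk of this kind, ending or starting
    there, and a repeated vertex would allow a loop to be cut out.\<close>
  let ?Q = "\<lambda>P. walk H P \<and> hd P \<in> S \<and> last P \<in> S \<and> hd P \<noteq> last P"
  have "\<exists>P. ?Q P" using assms by (auto simp: reach_def)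
  then obtain P where P: "?Q P" and least: "\<And>R. ?Q R \<Longrightarrow> length P \<le> length R"
    using ex_has_least_nat[of ?Q _ length] by metis
  obtain a P' where "P = a # P'" using P by (cases P) auto
  then obtain Q b where PQ: "P = a # Q @ [b]"
    using P by (cases P' rule: rev_cases) auto
  have "z \<notin> S" if zQ: "z \<in> set Q" for z
  proof
    assume z: "z \<in> S"
    obtain Q1 Q2 where Q: "Q = Q1 @ z # Q2" using split_list[OF zQ] by blast
    have "walk H ((a # Q1) @ z # (Q2 @ [b]))" using P by (simp add: PQ Q)
    then have w: "walk H ((a # Q1) @ [z])" "walk H (z # (Q2 @ [b]))"
      using walk_appendD[of H "a # Q1" z "Q2 @ [b]"] by blast+
    show False
    proof (cases "z = a")
      case True
      then have "?Q (z # (Q2 @ [b]))" using w(2) P PQ by simp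
      from least[OF this] show False by (simp add: PQ Q)
    next
      case False
      then have "?Q ((a # Q1) @ [z])" using w(1) P PQ z by simp
      from least[OF this] show False by (simp add: PQ Q)
    qed
  qed
  moreover have "distinct P"
  proof (rule ccontr)
    assume "\<not> distinct P"
    then obtain X Y Z z where d: "P = X @ [z] @ Y @ [z] @ Z"
      using not_distinct_decomp by blast
    then have "P = X @ z # (Y @ z # Z)" by simp
    then have "walk H (X @ [z])" "walk H ((z # Y) @ z # Z)"
      using P walk_append_iff[of H X z "Y @ z # Z"] by auto
    then have "walk H (X @ z # Z)"
      using walk_appendD[of H "z # Y" z Z] walk_append[of H X z Z] by blast
    moreover have "hd (X @ z # Z) = hd P" "last (X @ z # Z) = last P"
      unfolding d by (cases X) (auto simp: last_append)
    ultimately have "?Q (X @ z # Z)" using P by simp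
    from least[OF this] show False by (simp add: d)
  qed
  ultimately show ?thesis using P by (intro exI[of _ P]) (auto simp: PQ)
qed

text \<open>The ends are different because \<open>P\<close> is distinct with at least two entries. A
  chord is an ear without inner vertices; only the condition on edges keeps an edge of the cycle
  itself from counting as one.\<close>

definition ear :: "'v ugraph \<Rightarrow> 'v list \<Rightarrow> 'v list \<Rightarrow> bool" where
  "ear G cs P \<longleftrightarrow> walk G P \<and> distinct P \<and> 2 \<le> length P \<and> hd P \<in> set cs \<and> last P \<in> set cs
     \<and> set (butlast (tl P)) \<inter> set cs = {} \<and> path_edges P \<inter> cycle_edges cs = {}"

definition separated :: "'v ugraph \<Rightarrow> 'v list \<Rightarrow> bool" where
  "separated G cs \<longleftrightarrow> (\<forall>x\<in>set cs. \<forall>y\<in>set cs.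
     reach (UGraph (verts G) (edges G - cycle_edges cs)) x y \<longrightarrow> x = y)"

lemma not_separated_ear:
  assumes "\<not> separated G cs"
  shows "\<exists>P. ear G cs P"
proof -
  let ?H = "UGraph (verts G) (edges G - cycle_edges cs)"
  obtain x y where "reach ?H x y" "x \<in> set cs" "y \<in> set cs" "x \<noteq> y"
    using assms by (auto simp: separated_def)
  from shortest_connection[OF this] obtain P where
    P: "walk ?H P" "distinct P" "2 \<le> length P" "hd P \<in> set cs" "last P \<in> set cs"
      "set (butlast (tl P)) \<inter> set cs = {}" by blast
  moreover have "walk G P" using P(1) by (rule walk_mono) auto
  moreover have "path_edges P \<inter> cycle_edges cs = {}" using P(1) by (auto simp: walk_path_edges)
  ultimately show ?thesis by (auto simp: ear_def)
qed

text \<open>The cycle and a spanning forest rooted at it have |V| edges together, so some edge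
  \<open>g\<close> is left over. Its ends have the same root, since otherwise \<open>g\<close> and
  two trees would join two vertices of the cycle off the cycle. Hence \<open>g\<close> closes a
  cycle with edges of the forest only.\<close>

lemma separated_second_cycle:
  assumes "bicyclic G" "is_cycle G cs" "separated G cs"
  shows "\<exists>cs'. is_cycle G cs' \<and> cycle_edges cs' \<inter> cycle_edges cs = {}"
proof -
  have G: "simple_graph G" "connected_graph G" "card (edges G) = card (verts G) + 1"
    using assms(1) by (auto simp: bicyclic_def)
  note fin = simple_finite_edges[OF G(1)]
  have C: "set cs \<subseteq> verts G" "distinct cs" "3 \<le> length cs" "cycle_edges cs \<subseteq> edges G"
    using assms(2) by (auto simp: is_cycle_edges)
  then have ne: "cs \<noteq> []" by auto
  let ?C = "cycle_edges cs"
  obtain T r where T: "T \<subseteq> edges G" "card T + card (set cs) = card (verts G)" "T \<inter> Pow (set cs) = {}"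
    "\<forall>x\<in>verts G. r x \<in> set cs" "\<forall>s t. {s, t} \<in> T \<longrightarrow> r s = r t"
    "\<forall>x\<in>verts G. reach (UGraph (verts G) T) x (r x)"
    using grow_spanning[OF G(1,2) C(1)] ne by auto
  have CW: "?C \<subseteq> Pow (set cs)" using cycle_edges_subset[OF ne] by blast
  have "card (T \<union> ?C) \<le> card T + card ?C" by (rule card_Un_le)
  also have "\<dots> < card (edges G)"
    using T(2) G(3) C by (simp add: card_cycle_edges distinct_card)
  finally have "T \<union> ?C \<noteq> edges G" by auto
  then obtain g where g: "g \<in> edges G" "g \<notin> T" "g \<notin> ?C" using T(1) C(4) by blast
  then obtain s t where st: "g = {s, t}" "s \<in> verts G" "t \<in> verts G"
    using simple_edgeE[OF G(1)] by metis
  let ?H = "UGraph (verts G) (edges G - ?C)"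
  have TH: "T \<subseteq> edges G - ?C" using T(1,3) CW by blast
  have "reach ?H z (r z)" if "z \<in> verts G" for z
    using reach_mono[OF T(6)[rule_format, OF that], of ?H] TH by simp
  then have "reach ?H s (r s)" "reach ?H t (r t)" using st by blast+
  moreover have "reach ?H s t" using g st by (intro reach_edge) auto
  ultimately have "reach ?H (r s) (r t)" by (meson reach_sym reach_trans)
  then have "r s = r t" using assms(3) T(4) st by (auto simp: separated_def)
  then have "reach (UGraph (verts G) T) s t"
    using T(6) st by (metis reach_sym reach_trans)
  define K where "K = UGraph (verts G) (insert g T)"
  have "del_edge K g = UGraph (verts G) T" using g by (simp add: del_edge_def K_def)
  then have "nonbridge K {s, t}"
    using \<open>reach (UGraph (verts G) T) s t\<close> st by (intro nonbridgeI) (auto simp: K_def)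
  moreover have "simple_graph K" using G(1) T(1) g by (auto simp: K_def simple_graph_def)
  ultimately obtain cs' where cs': "is_cycle K cs'" using nonbridge_cycle by metis
  then have "is_cycle G cs'" "cycle_edges cs' \<inter> ?C = {}"
    using T(1) g TH by (auto simp: is_cycle_edges K_def)
  then show ?thesis by blast
qed

text \<open>Deleting an edge of the ear, unfold the cycle through the ear onto a line: the rest of the
  ear is stretched out isometrically and the base cycle is folded onto two adjacent points.\<close>

lemma deficit_ear:
  assumes "bicyclic G" "is_cycle G cs" "ear G cs P" "e \<in> path_edges P"
  shows "int (length P) - 1 \<le> deficit G e" "nonbridge G e"
proof -
  have G: "simple_graph G" "connected_graph G" using assms(1) by (auto simp: bicyclic_def)
  have C: "set cs \<subseteq> verts G" "distinct cs" "3 \<le> length cs" "cycle_edges cs \<subseteq> edges G"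
    using assms(2) by (auto simp: is_cycle_edges)
  then have ne: "cs \<noteq> []" by auto
  have P: "set P \<subseteq> verts G" "path_edges P \<subseteq> edges G" "distinct P" "2 \<le> length P"
    "hd P \<in> set cs" "last P \<in> set cs" "set (butlast (tl P)) \<inter> set cs = {}"
    "path_edges P \<inter> cycle_edges cs = {}"
    using assms(3) by (auto simp: ear_def walk_path_edges)
  have eE: "e \<in> edges G" using P(2) assms(4) by blast
  obtain x P' where "P = x # P'" using P(4) by (cases P) auto
  then obtain Q y where PQ: "P = x # Q @ [y]"
    using P(4) by (cases P' rule: rev_cases) auto
  have Q: "set Q \<inter> set cs = {}" "x \<in> set cs" "y \<in> set cs" "x \<noteq> y" "x \<notin> set Q" "y \<notin> set Q" "distinct Q"
    using P by (auto simp: PQ)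
  obtain ys a b zs where sp: "P = ys @ a # b # zs" and e: "e = {a, b}"
    using path_edges_split[OF assms(4)] by blast
  let ?H = "del_edge G e"
  \<comment> \<open>Without \<open>e\<close> both halves of the ear still hang on the cycle, which
    contains the two ends of the ear and stays intact.\<close>
  have nb: "reach ?H a b"
  proof -
    have pe: "path_edges P = path_edges (ys @ [a]) \<union> insert {a, b} (path_edges (b # zs))"
      unfolding sp path_edges_append[of ys a "b # zs"] by simp
    have "e \<notin> path_edges (ys @ [a])" "e \<notin> path_edges (b # zs)"
      using path_edges_subset[of e "ys @ [a]"] path_edges_subset[of e "b # zs"] P(3)
      by (auto simp: sp e)
    then have "walk ?H (ys @ [a])" "walk ?H (b # zs)"
      using P(1,2) pe by (auto simp: walk_path_edges sp)
    moreover have "hd (ys @ [a]) = x" "last (b # zs) = y"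
      using sp PQ by (metis hd_append2 hd_append list.sel(1) append_Cons append_is_Nil_conv)
        (metis sp PQ last_appendR last_ConsR append_Cons last_snoc list.distinct(1))
    ultimately have 1: "reach ?H x a" "reach ?H b y"
      using walk_reach[of ?H "ys @ [a]"] walk_reach[of ?H "b # zs"] by auto
    have "e \<notin> cycle_edges cs" using P(8) assms(4) by blast
    then have "path_edges cs \<subseteq> edges ?H" "set cs \<subseteq> verts ?H" using C by (auto simp: cycle_edges_def)
    then have "reach ?H x (last cs)" "reach ?H y (last cs)"
      using path_reach_hd_last(2)[of cs ?H] Q by auto
    then show ?thesis using 1 by (meson reach_sym reach_trans)
  qed
  then show "nonbridge G e" using eE nonbridgeI by (simp add: e)
  \<comment> \<open>Cycle and ear together have one more edge than vertices, so the rest of the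
    graph retracts onto them along trees and the potential has to be defined on \<open>?W\<close>
    only.\<close>
  let ?W = "set cs \<union> set P" and ?F = "cycle_edges cs \<union> path_edges P"
  have W: "?W = set cs \<union> set Q" using Q by (auto simp: PQ)
  have cW: "card ?W = length cs + length Q"
    unfolding W using Q C by (subst card_Un_disjoint) (auto simp: distinct_card)
  have cF: "card ?F = length cs + (length Q + 1)"
    using C P(3,8) by (subst card_Un_disjoint)
      (auto simp: finite_cycle_edges finite_path_edges card_cycle_edges card_path_edges PQ)
  obtain r where r: "\<And>x. x \<in> verts G \<Longrightarrow> r x \<in> ?W" "\<And>x. x \<in> ?W \<Longrightarrow> r x = x"
    "\<And>s t. {s, t} \<in> edges G \<Longrightarrow> {s, t} \<notin> ?F \<Longrightarrow> r s = r t"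
  proof (rule core_retraction[OF assms(1), of ?W ?F])
    show "?F \<subseteq> Pow ?W" using cycle_edges_subset[OF ne] path_edges_subset by blast
    show "card ?F = card ?W + 1" using cW cF by simp
  qed (use C P ne in auto)
  define l where "l = length Q + 1"
  define i where "i = length ys"
  have len: "length P = Suc l" by (simp add: PQ l_def)
  have il: "i < l" using len by (simp add: sp i_def)
  have ai: "P ! i = a" "P ! Suc i = b" by (simp_all add: sp i_def nth_append)
  have P0: "P ! 0 = x" and Pl: "P ! l = y" by (simp_all add: PQ l_def nth_append)
  \<comment> \<open>Along the ear \<open>f\<close> falls in unit steps from 0 at \<open>x\<close> to
    \<open>- i\<close> at \<open>a\<close>, jumps by \<open>l\<close> to \<open>l - i\<close> at
    \<open>b\<close> over the deleted edge, and falls again to 1 at \<open>y\<close>. This agrees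
    with the values 0 at \<open>x\<close> and 1 at all other vertices of the cycle.\<close>
  define f :: "nat \<Rightarrow> int" where "f j = (if j \<le> i then - int j else int l - int j + 1)" for j
  define \<phi> where "\<phi> z = (if z \<in> set cs then (if z = x then 0 else 1)
      else f (THE j. j < length P \<and> P ! j = z))" for z
  have phiP: "\<phi> (P ! j) = f j" if j: "j \<le> l" for j
  proof (cases "P ! j \<in> set cs")
    case True
    have "j = 0 \<or> j = l"
    proof (rule ccontr)
      assume "\<not> ?thesis"
      then have "P ! j \<in> set Q" using j by (auto simp: PQ l_def nth_Cons' nth_append)
      then show False using True Q by blast
    qed
    then show ?thesis using True P0 Pl Q il by (auto simp: \<phi>_def f_def)
  next
    case False
    have "(THE k. k < length P \<and> P ! k = P ! j) = j"
      using P(3) j len by (intro the_equality) (auto simp: nth_eq_iff_index_eq)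
    then show ?thesis using False by (simp add: \<phi>_def)
  qed
  have step: "\<phi> (r t) \<le> \<phi> (r s) + 1"
    if st: "s \<in> verts G" "t \<in> verts G" "{s, t} \<in> edges G" "{s, t} \<noteq> e" for s t
  proof (cases "{s, t} \<in> ?F")
    case False
    then show ?thesis using r(3)[OF st(3)] by simp
  next
    case True
    then have "{s, t} \<subseteq> ?W" using cycle_edges_subset[OF ne] path_edges_subset by blast
    then have rs: "r s = s" "r t = t" using r(2) by auto
    show ?thesis
    proof (cases "{s, t} \<in> cycle_edges cs")
      case True
      then have "s \<in> set cs" "t \<in> set cs" using cycle_edges_subset[OF ne] by blast+
      then show ?thesis by (simp add: rs \<phi>_def)
    next
      case False
      then have "{s, t} \<in> path_edges P" using True by blast
      then obtain ys' c d zs' where sp': "P = ys' @ c # d # zs'" "{s, t} = {c, d}"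
        using path_edges_split by blast
      define j where "j = length ys'"
      have cd: "P ! j = c" "P ! Suc j = d" by (simp_all add: sp'(1) j_def nth_append)
      have jl: "j < l" using len sp'(1) by (simp add: j_def)
      have "j \<noteq> i" using st(4) sp'(2) e cd ai by auto
      then have "f j \<le> f (Suc j) + 1" "f (Suc j) \<le> f j + 1" by (auto simp: f_def)
      then show ?thesis
        using phiP[of j] phiP[of "Suc j"] jl cd sp'(2) by (auto simp: rs doubleton_eq_iff)
    qed
  qed
  have "\<phi> (r b) - \<phi> (r a) \<le> int (dist_graph ?H a b)"
    by (rule dist_ge[where \<phi> = "\<lambda>z. \<phi> (r z)", OF nb]) (use step in auto)
  moreover have "\<phi> (r a) = f i" "\<phi> (r b) = f (Suc i)"
  proof -
    have "a \<in> ?W" "b \<in> ?W" by (auto simp: sp)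
    then show "\<phi> (r a) = f i" "\<phi> (r b) = f (Suc i)" using r(2) phiP[of i] phiP[of "Suc i"] ai il by auto
  qed
  moreover have "int (dist_graph ?H a b) \<le> deficit G e"
    unfolding e using deficit_nonbridge[OF G] nb eE by (simp add: e)
  ultimately show "int (length P) - 1 \<le> deficit G e" by (simp add: f_def len)
qed

section \<open>Cores with hanging trees\<close>

text \<open>Summed over all edges this sign gives m_u - m_v. Its invariance under a common shift,
  \<open>cmp_add\<close>, lets an edge of a hanging tree count as if it were the root of the
  tree.\<close>

definition cmp :: "nat \<Rightarrow> nat \<Rightarrow> int" where
  "cmp p q = (if p < q then 1 else if q < p then - 1 else 0)"

lemma cmp_add [simp]: "cmp (p + k) (q + k) = cmp p q"
  by (simp add: cmp_def)

lemma closer_edges_diff: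
  assumes "finite (edges G)"
  shows "int (closer_edges G u v) - int (closer_edges G v u)
    = (\<Sum>f\<in>edges G. cmp (dist_edge G u f) (dist_edge G v f))"
proof -
  have "int (card {f \<in> edges G. dist_edge G x f < dist_edge G y f})
      = (\<Sum>f\<in>edges G. if dist_edge G x f < dist_edge G y f then 1 else 0)" for x y
    using assms by (simp add: sum.If_cases Int_def)
  then show ?thesis
    unfolding closer_edges_def by (simp add: sum_subtractf[symmetric] cmp_def) (rule sum.cong; simp)
qed

text \<open>A certificate that \<open>M\<close> is the distance matrix of the graph with edge list
  \<open>A\<close>: each row is 1-Lipschitz along the edges, which bounds distances below, and each
  entry off the diagonal has a neighbour with an entry smaller by 1, which bounds them above. The
  quantifiers range over lists so that it can be evaluated.\<close>

definition path_metric :: "nat \<Rightarrow> (nat \<times> nat) list \<Rightarrow> (nat \<Rightarrow> nat \<Rightarrow> nat) \<Rightarrow> bool" where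
  "path_metric n A M \<longleftrightarrow> (\<forall>i\<in>set [0..<n]. M i i = 0) \<and>
     (\<forall>i\<in>set [0..<n]. \<forall>(a, b)\<in>set A. M i a \<le> M i b + 1 \<and> M i b \<le> M i a + 1) \<and>
     (\<forall>i\<in>set [0..<n]. \<forall>j\<in>set [0..<n]. i \<noteq> j \<longrightarrow>
        (\<exists>(a, b)\<in>set A. a = j \<and> M i j = M i b + 1 \<or> b = j \<and> M i j = M i a + 1))"

definition index_edges :: "'v list \<Rightarrow> (nat \<times> nat) list \<Rightarrow> 'v set set" where
  "index_edges vs A = (\<lambda>(i, j). {vs ! i, vs ! j}) ` set A"

text \<open>A core is given by its list of vertices, its edges as pairs of indices, and its distance
  matrix; the rest of the graph enters only through the number \<open>w z\<close> of edges hanging at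
  \<open>vs ! z\<close>. The balance of \<open>i\<close> and \<open>j\<close> is then $m_u - m_v$ for
  \<open>u = vs ! i\<close> and \<open>v = vs ! j\<close>.\<close>

definition balance :: "(nat \<times> nat) list \<Rightarrow> (nat \<Rightarrow> nat \<Rightarrow> nat) \<Rightarrow> nat \<Rightarrow> (nat \<Rightarrow> nat) \<Rightarrow> nat \<Rightarrow> nat \<Rightarrow> int" where
  "balance A M n w i j = (\<Sum>(a, b)\<leftarrow>A. cmp (min (M i a) (M i b)) (min (M j a) (M j b)))
     + (\<Sum>z\<leftarrow>[0..<n]. cmp (M i z) (M j z) * int (w z))"

text \<open>One more edge than vertices means that the core already carries both independent cycles
  of the graph, so that by \<open>core_retraction\<close> the rest is a forest hanging at it.
  \<open>M\<close> is the metric of the core alone; that it agrees with the distances in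
  \<open>G\<close> is a consequence.\<close>

locale core =
  fixes G :: "'v ugraph" and vs :: "'v list" and A :: "(nat \<times> nat) list" and M :: "nat \<Rightarrow> nat \<Rightarrow> nat"
  assumes bicyclic: "bicyclic G"
    and vs: "distinct vs" "set vs \<subseteq> verts G"
    and A: "distinct A" "\<forall>(i, j)\<in>set A. i < j \<and> j < length vs" "length A = length vs + 1"
    and edges: "index_edges vs A \<subseteq> edges G"
    and metric: "path_metric (length vs) A M"
begin

abbreviation "n \<equiv> length vs"
abbreviation "F \<equiv> index_edges vs A"

lemma simple: "simple_graph G" and connected: "connected_graph G"
  and card_E: "card (edges G) = card (verts G) + 1"
  using bicyclic by (auto simp: bicyclic_def)

lemma finite_E: "finite (edges G)"
  by (rule simple_finite_edges[OF simple])

lemma vs_ne: "vs \<noteq> []"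
  using A by (cases A) auto

lemma inj_A: "inj_on (\<lambda>(i, j). {vs ! i, vs ! j}) (set A)"
proof (rule inj_onI, clarify)
  fix i j k l assume "(i, j) \<in> set A" "(k, l) \<in> set A" "{vs ! i, vs ! j} = {vs ! k, vs ! l}"
  moreover from this have "i < j" "j < n" "k < l" "l < n" using A(2) by auto
  ultimately show "i = k \<and> j = l"
    using vs(1) by (auto simp: doubleton_eq_iff nth_eq_iff_index_eq)
qed

lemma card_F: "card F = length A"
  by (simp add: index_edges_def card_image[OF inj_A] distinct_card A)

lemma vs_verts: "i < n \<Longrightarrow> vs ! i \<in> verts G"
  using vs by auto

lemma reach_all: "u \<in> verts G \<Longrightarrow> v \<in> verts G \<Longrightarrow> reach G u v"
  by (rule connected_reach[OF connected])

lemma metric_self: "i < n \<Longrightarrow> M i i = 0"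
  using metric by (simp add: path_metric_def)

lemma metric_step: "i < n \<Longrightarrow> (a, b) \<in> set A \<Longrightarrow> M i a \<le> M i b + 1 \<and> M i b \<le> M i a + 1"
proof -
  assume i: "i < n" and ab: "(a, b) \<in> set A"
  have "\<forall>i\<in>set [0..<n]. \<forall>(a, b)\<in>set A. M i a \<le> M i b + 1 \<and> M i b \<le> M i a + 1"
    using metric unfolding path_metric_def by (elim conjE)
  then have "\<forall>(a, b)\<in>set A. M i a \<le> M i b + 1 \<and> M i b \<le> M i a + 1"
    by (rule bspec) (simp add: i)
  from bspec[OF this ab] show ?thesis by simp
qed

lemma metric_pred:
  assumes "i < n" "j < n" "i \<noteq> j"
  shows "\<exists>a b. (a, b) \<in> set A \<and> (a = j \<and> M i j = M i b + 1 \<or> b = j \<and> M i j = M i a + 1)"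
proof -
  have "\<forall>i\<in>set [0..<n]. \<forall>j\<in>set [0..<n]. i \<noteq> j \<longrightarrow>
      (\<exists>(a, b)\<in>set A. a = j \<and> M i j = M i b + 1 \<or> b = j \<and> M i j = M i a + 1)"
    using metric unfolding path_metric_def by (elim conjE)
  from bspec[OF bspec[OF this]]
  have "\<exists>(a, b)\<in>set A. a = j \<and> M i j = M i b + 1 \<or> b = j \<and> M i j = M i a + 1"
    using assms by simp
  then show ?thesis by blast
qed

lemma gate_exists:
  "\<exists>r. (\<forall>x\<in>verts G. r x < n) \<and> (\<forall>i<n. r (vs ! i) = i) \<and>
     (\<forall>s t. {s, t} \<in> edges G - F \<longrightarrow> r s = r t)"
proof -
  have FW: "F \<subseteq> Pow (set vs)" using A(2) by (auto simp: index_edges_def)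
  obtain r where r: "\<And>x. x \<in> verts G \<Longrightarrow> r x \<in> set vs" "\<And>x. x \<in> set vs \<Longrightarrow> r x = x"
    "\<And>s t. {s, t} \<in> edges G \<Longrightarrow> {s, t} \<notin> F \<Longrightarrow> r s = r t"
    using core_retraction[OF bicyclic vs(2) _ edges FW] vs_ne vs(1) card_F A(3)
    by (metis distinct_card set_empty)
  define k where "k x = (THE i. i < n \<and> vs ! i = x)" for x
  have k: "k (vs ! i) = i" if "i < n" for i
    unfolding k_def using that vs(1) by (intro the_equality) (auto simp: nth_eq_iff_index_eq)
  have "k (r x) < n" if "x \<in> verts G" for x
    using r(1)[OF that] k by (metis in_set_conv_nth)
  moreover have "k (r (vs ! i)) = i" if "i < n" for i
    using r(2)[of "vs ! i"] k that by simp
  ultimately show ?thesis using r(3) by (intro exI[of _ "\<lambda>x. k (r x)"]) auto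
qed

text \<open>The index of the core vertex at which the tree of a given vertex hangs.\<close>

definition gate :: "'v \<Rightarrow> nat" where
  "gate = (SOME r. (\<forall>x\<in>verts G. r x < n) \<and> (\<forall>i<n. r (vs ! i) = i) \<and>
     (\<forall>s t. {s, t} \<in> edges G - F \<longrightarrow> r s = r t))"

lemma gate:
  shows gate_less: "x \<in> verts G \<Longrightarrow> gate x < n"
    and gate_vs: "i < n \<Longrightarrow> gate (vs ! i) = i"
    and gate_edge: "{s, t} \<in> edges G \<Longrightarrow> {s, t} \<notin> F \<Longrightarrow> gate s = gate t"
  using someI_ex[OF gate_exists] unfolding gate_def[symmetric] by blast+

text \<open>Descending from \<open>j\<close> to a neighbour with an entry smaller by 1 traces a walk
  of length \<open>M i j\<close> inside the core.\<close>

lemma dist_vs_le: "i < n \<Longrightarrow> j < n \<Longrightarrow> dist_graph G (vs ! i) (vs ! j) \<le> M i j"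
proof (induction "M i j" arbitrary: j rule: less_induct)
  case less
  show ?case
  proof (cases "i = j")
    case True
    then show ?thesis using less.prems vs_verts by simp
  next
    case False
    then obtain a b where ab: "(a, b) \<in> set A"
      "a = j \<and> M i j = M i b + 1 \<or> b = j \<and> M i j = M i a + 1"
      using metric_pred[OF less.prems False] by blast
    then have E: "{vs ! a, vs ! b} \<in> edges G" "a < n" "b < n"
      using edges A(2) by (auto simp: index_edges_def)
    define k where "k = (if a = j \<and> M i j = M i b + 1 then b else a)"
    have k: "M i j = M i k + 1" "k < n" "{vs ! k, vs ! j} \<in> edges G"
      using ab(2) E by (auto simp: k_def insert_commute)
    have "dist_graph G (vs ! i) (vs ! j) \<le> dist_graph G (vs ! i) (vs ! k) + 1"
      using k(3) reach_all vs_verts less.prems k(2) by (intro dist_step) auto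
    also have "\<dots> \<le> M i j" using less.hyps[of k] k less.prems by simp
    finally show ?thesis .
  qed
qed

text \<open>A walk enters a tree through its gate. For the lower bound the right-hand side is
  1-Lipschitz in \<open>x\<close>: along a core edge the second summand is 0 and the row of
  \<open>M\<close> changes by at most 1, along a tree edge the gate stays the same.\<close>

lemma dist_vs:
  assumes "i < n" "x \<in> verts G"
  shows "dist_graph G (vs ! i) x = M i (gate x) + dist_graph G (vs ! gate x) x"
proof (rule antisym)
  have g: "gate x < n" using gate_less assms by blast
  have "dist_graph G (vs ! i) x
      \<le> dist_graph G (vs ! i) (vs ! gate x) + dist_graph G (vs ! gate x) x"
    using reach_all vs_verts assms g by (intro dist_triangle) auto
  then show "dist_graph G (vs ! i) x \<le> M i (gate x) + dist_graph G (vs ! gate x) x"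
    using dist_vs_le[OF assms(1) g] by simp
  define \<phi> where "\<phi> y = int (M i (gate y) + dist_graph G (vs ! gate y) y)" for y
  have "\<phi> t \<le> \<phi> s + 1" if st: "s \<in> verts G" "t \<in> verts G" "{s, t} \<in> edges G" for s t
  proof (cases "{s, t} \<in> F")
    case True
    then obtain a b where ab: "(a, b) \<in> set A" "{s, t} = {vs ! a, vs ! b}"
      by (auto simp: index_edges_def)
    then have l: "a < n" "b < n" using A(2) by auto
    have "M i a \<le> M i b + 1 \<and> M i b \<le> M i a + 1"
      by (rule metric_step[OF assms(1) ab(1)])
    moreover have "\<phi> (vs ! a) = int (M i a)" "\<phi> (vs ! b) = int (M i b)"
      using l gate_vs vs_verts by (auto simp: \<phi>_def)
    ultimately show ?thesis using ab(2) by (auto simp: doubleton_eq_iff)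
  next
    case False
    then have "gate s = gate t" using gate_edge st by blast
    moreover have "dist_graph G (vs ! gate s) t \<le> dist_graph G (vs ! gate s) s + 1"
      using st reach_all vs_verts gate_less by (intro dist_step) auto
    ultimately show ?thesis by (simp add: \<phi>_def)
  qed
  from dist_ge[where \<phi> = \<phi>, OF reach_all[OF vs_verts[OF assms(1)] assms(2)] this]
  show "M i (gate x) + dist_graph G (vs ! gate x) x \<le> dist_graph G (vs ! i) x"
    using gate_vs[OF assms(1)] metric_self assms(1) vs_verts by (simp add: \<phi>_def)
qed

text \<open>For an edge outside the core both ends have the same gate, so the choice of the end is
  immaterial.\<close>

definition edge_gate :: "'v set \<Rightarrow> nat" where
  "edge_gate f = gate (SOME x. x \<in> f)"

lemma edge_gate: "{s, t} \<in> edges G - F \<Longrightarrow> edge_gate {s, t} = gate s"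
  unfolding edge_gate_def using someI[of "\<lambda>x. x \<in> {s, t}" s] gate_edge[of s t] by auto

definition weight :: "nat \<Rightarrow> nat" where
  "weight z = card {f \<in> edges G - F. edge_gate f = z}"

lemma edge_gate_less: "f \<in> edges G - F \<Longrightarrow> edge_gate f < n"
  using simple_edgeE[OF simple] edge_gate gate_less by (metis DiffD1)

lemma sum_weight: "(\<Sum>z\<leftarrow>[0..<n]. int (weight z)) + int (length A) = int (card (edges G))"
proof -
  have "(\<Sum>z\<in>{0..<n}. \<Sum>f\<in>{f \<in> edges G - F. edge_gate f = z}. 1) = (\<Sum>f\<in>edges G - F. 1 :: nat)"
    using finite_E edge_gate_less by (intro sum.group) auto
  then have "(\<Sum>z\<in>{0..<n}. weight z) = card (edges G - F)" by (simp add: weight_def)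
  also have "\<dots> + length A = card (edges G)"
    using edges finite_E by (subst card_F[symmetric])
      (simp add: card_Diff_subset card_mono finite_subset[OF edges])
  finally have "int (\<Sum>z\<in>{0..<n}. weight z) + int (length A) = int (card (edges G))" by linarith
  then show ?thesis by (simp add: interv_sum_list_conv_sum_set_nat)
qed

lemma dist_edge_core:
  assumes "(a, b) \<in> set A" "i < n"
  shows "dist_edge G (vs ! i) {vs ! a, vs ! b} = min (M i a) (M i b)"
proof -
  have "a < n" "b < n" using A(2) assms by auto
  then show ?thesis
    using dist_vs[OF assms(2)] gate_vs vs_verts by (simp add: dist_edge_pair)
qed

text \<open>The offset \<open>k\<close> does not depend on the core vertex, so it cancels in every
  comparison made by \<open>cmp\<close>.\<close>

lemma dist_edge_branch:
  assumes "f \<in> edges G - F"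
  shows "\<exists>k. \<forall>i<n. dist_edge G (vs ! i) f = M i (edge_gate f) + k"
proof -
  obtain s t where f: "f = {s, t}" "s \<in> verts G" "t \<in> verts G"
    using simple_edgeE[OF simple] assms by (metis DiffD1)
  have g: "gate s = edge_gate f" "gate t = edge_gate f"
    using edge_gate[of s t] gate_edge[of s t] assms by (auto simp: f)
  show ?thesis
    by (intro exI[of _ "min (dist_graph G (vs ! edge_gate f) s) (dist_graph G (vs ! edge_gate f) t)"] allI impI)
      (simp add: f(1) dist_edge_pair dist_vs f(2,3) g[unfolded f(1)])
qed

lemma closer_edges_balance:
  assumes "i < n" "j < n"
  shows "int (closer_edges G (vs ! i) (vs ! j)) - int (closer_edges G (vs ! j) (vs ! i))
    = balance A M n weight i j"
proof -
  let ?c = "\<lambda>f. cmp (dist_edge G (vs ! i) f) (dist_edge G (vs ! j) f)"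
  have "(\<Sum>f\<in>edges G. ?c f) = (\<Sum>f\<in>F. ?c f) + (\<Sum>f\<in>edges G - F. ?c f)"
    using sum.subset_diff[OF edges finite_E, of ?c] by simp
  also have "(\<Sum>f\<in>F. ?c f) = (\<Sum>(a, b)\<leftarrow>A. cmp (min (M i a) (M i b)) (min (M j a) (M j b)))"
    unfolding index_edges_def
    by (simp add: sum.reindex[OF inj_A] sum_list_distinct_conv_sum_set[OF A(1)])
      (rule sum.cong, auto simp: dist_edge_core assms)
  also have "(\<Sum>f\<in>edges G - F. ?c f) = (\<Sum>f\<in>edges G - F. cmp (M i (edge_gate f)) (M j (edge_gate f)))"
  proof (rule sum.cong[OF refl])
    fix f assume "f \<in> edges G - F"
    from dist_edge_branch[OF this] assms show "?c f = cmp (M i (edge_gate f)) (M j (edge_gate f))"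
      by auto
  qed
  also have "\<dots> = (\<Sum>z\<in>{0..<n}. \<Sum>f\<in>{f \<in> edges G - F. edge_gate f = z}.
      cmp (M i (edge_gate f)) (M j (edge_gate f)))"
    using finite_E edge_gate_less by (intro sum.group[symmetric]) auto
  also have "\<dots> = (\<Sum>z\<in>{0..<n}. cmp (M i z) (M j z) * int (weight z))"
    by (rule sum.cong[OF refl]) (simp add: weight_def mult.commute)
  finally show ?thesis
    unfolding closer_edges_diff[OF finite_E] balance_def
    by (simp add: interv_sum_list_conv_sum_set_nat)
qed

lemma deficit_sum_core:
  "deficit_sum G = (\<Sum>(i, j)\<leftarrow>A. int (card (edges G)) - 1 - \<bar>balance A M n weight i j\<bar>)
     + (\<Sum>f\<in>edges G - F. deficit G f)"
proof -
  have "deficit_sum G = (\<Sum>f\<in>F. deficit G f) + (\<Sum>f\<in>edges G - F. deficit G f)"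
    unfolding deficit_sum_def using sum.subset_diff[OF edges finite_E, of "deficit G"] by simp
  also have "(\<Sum>f\<in>F. deficit G f)
      = (\<Sum>(i, j)\<leftarrow>A. int (card (edges G)) - 1 - \<bar>balance A M n weight i j\<bar>)"
    unfolding index_edges_def
    by (simp add: sum.reindex[OF inj_A] sum_list_distinct_conv_sum_set[OF A(1)])
      (rule sum.cong, use A(2) in \<open>auto simp: closer_edges_balance deficit_def edge_contribution_insert\<close>)
  finally show ?thesis .
qed

lemma branch_deficit_nonneg: "0 \<le> (\<Sum>f\<in>edges G - F. deficit G f)"
  using deficit_nonneg[OF simple connected] by (intro sum_nonneg) auto

end

text \<open>A core all of whose other vertices are joined to \<open>vs ! k\<close> and to nothing
  else. All five extremal graphs have this form, so that isomorphism with one of them becomes the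
  existence of a suitable list \<open>vs\<close>.\<close>

definition star_shape :: "'v ugraph \<Rightarrow> 'v list \<Rightarrow> (nat \<times> nat) list \<Rightarrow> nat \<Rightarrow> bool" where
  "star_shape G vs A k \<longleftrightarrow> distinct vs \<and> set vs \<subseteq> verts G \<and> k < length vs \<and>
     (\<forall>(i, j)\<in>set A. i < j \<and> j < length vs) \<and>
     edges G = index_edges vs A \<union> (\<lambda>x. {vs ! k, x}) ` (verts G - set vs)"

lemma index_edgesE:
  assumes "f \<in> index_edges vs A"
  obtains i j where "(i, j) \<in> set A" "f = {vs ! i, vs ! j}"
  using assms by (auto simp: index_edges_def)

lemma image_index_edges:
  assumes "\<forall>(i, j)\<in>set A. i < j \<and> j < length vs"
  shows "(`) f ` index_edges vs A = index_edges (map f vs) A"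
  unfolding index_edges_def image_image using assms by (intro image_cong) auto

lemma isomorphicI:
  assumes "bij_betw f (verts G) (verts H)" "edges G \<subseteq> Pow (verts G)" "edges H = (`) f ` edges G"
  shows "G \<simeq> H"
  unfolding isomorphic_def
proof (intro exI[of _ f] conjI ballI)
  fix u v assume uv: "u \<in> verts G" "v \<in> verts G"
  have inj: "inj_on f (verts G)" using assms(1) by (simp add: bij_betw_def)
  show "{u, v} \<in> edges G \<longleftrightarrow> {f u, f v} \<in> edges H"
  proof
    assume "{u, v} \<in> edges G"
    then show "{f u, f v} \<in> edges H" unfolding assms(3) by (rule image_eqI[rotated]) simp
  next
    assume "{f u, f v} \<in> edges H"
    then obtain e where e: "e \<in> edges G" "f ` {u, v} = f ` e" unfolding assms(3) by auto
    then have "{u, v} = e"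
      using inj_on_image_eq_iff[OF inj, of "{u, v}" e] uv assms(2) by blast
    then show "{u, v} \<in> edges G" using e by simp
  qed
qed (rule assms(1))

lemma star_shape_edges:
  assumes "star_shape G vs A k"
  shows "edges G \<subseteq> Pow (verts G)"
proof -
  have V: "vs ! i \<in> verts G" if "i < length vs" for i
    using assms that by (auto simp: star_shape_def)
  have "f \<subseteq> verts G" if f: "f \<in> index_edges vs A" for f
  proof -
    obtain i j where ij: "(i, j) \<in> set A" "f = {vs ! i, vs ! j}"
      using index_edgesE[OF f] .
    then have "i < length vs" "j < length vs" using assms by (auto simp: star_shape_def)
    then show ?thesis using ij(2) V by simp
  qed
  moreover have "edges G = index_edges vs A \<union> (\<lambda>x. {vs ! k, x}) ` (verts G - set vs)" "k < length vs"
    using assms by (simp_all add: star_shape_def)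
  ultimately show ?thesis using V by auto
qed

text \<open>The cores are matched by position and the remaining vertices by an arbitrary bijection,
  which exists because the two graphs have equally many of them.\<close>

lemma star_shape_isomorphic:
  assumes "star_shape G vs A k" "star_shape H us A k" "length vs = length us"
    "finite (verts G)" "finite (verts H)" "card (verts G) = card (verts H)"
  shows "G \<simeq> H"
proof -
  have G: "distinct vs" "set vs \<subseteq> verts G" "k < length vs" "\<forall>(i, j)\<in>set A. i < j \<and> j < length vs"
    "edges G = index_edges vs A \<union> (\<lambda>x. {vs ! k, x}) ` (verts G - set vs)"
    and H: "distinct us" "set us \<subseteq> verts H"
    "edges H = index_edges us A \<union> (\<lambda>x. {us ! k, x}) ` (verts H - set us)"
    using assms by (simp_all add: star_shape_def)
  have "card (verts G - set vs) = card (verts H - set us)"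
    using G H assms by (simp add: card_Diff_subset distinct_card)
  then obtain g where g: "bij_betw g (verts G - set vs) (verts H - set us)"
    using assms(4,5) finite_same_card_bij by blast
  define h where "h x = (THE y. \<exists>i<length vs. x = vs ! i \<and> y = us ! i)" for x
  have h: "h (vs ! i) = us ! i" if "i < length vs" for i
    unfolding h_def using that G(1) by (intro the_equality) (auto simp: nth_eq_iff_index_eq)
  then have mh: "map h vs = us" using assms(3) by (intro nth_equalityI) auto
  define f where "f x = (if x \<in> set vs then h x else g x)" for x
  have mf: "map f vs = us" using mh by (auto simp: f_def)
  have "inj_on h (set vs)" using mh H(1) G(1) by (metis distinct_map)
  then have "bij_betw h (set vs) (set us)" using mh by (auto simp: bij_betw_def)
  then have b1: "bij_betw f (set vs) (set us)"
    by (subst bij_betw_cong[of _ f h]) (auto simp: f_def)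
  have b2: "bij_betw f (verts G - set vs) (verts H - set us)"
    using g by (subst bij_betw_cong[of _ f g]) (auto simp: f_def)
  have bij: "bij_betw f (verts G) (verts H)"
    using bij_betw_combine[OF b1 b2] G(2) H(2) by (simp add: Un_absorb1)
  have fk: "f (vs ! k) = us ! k" using mf G(3) by (metis nth_map)
  have "(`) f ` edges G = index_edges us A \<union> (\<lambda>x. {us ! k, x}) ` (f ` (verts G - set vs))"
    unfolding G(5) image_Un image_index_edges[OF G(4)] mf by (simp add: image_image fk)
  also have "f ` (verts G - set vs) = verts H - set us" using b2 by (simp add: bij_betw_def)
  finally show ?thesis using H(3) by (intro isomorphicI[OF bij star_shape_edges[OF assms(1)]]) simp
qed

lemma isomorphic_star_shape:
  assumes "G \<simeq> H" "simple_graph G" "star_shape H us A k"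
  shows "\<exists>vs. star_shape G vs A k \<and> length vs = length us"
proof -
  obtain f where f: "bij_betw f (verts G) (verts H)"
    "\<forall>u\<in>verts G. \<forall>v\<in>verts G. {u, v} \<in> edges G \<longleftrightarrow> {f u, f v} \<in> edges H"
    using assms(1) by (auto simp: isomorphic_def)
  have H: "distinct us" "set us \<subseteq> verts H" "k < length us" "\<forall>(i, j)\<in>set A. i < j \<and> j < length us"
    "edges H = index_edges us A \<union> (\<lambda>x. {us ! k, x}) ` (verts H - set us)"
    using assms by (simp_all add: star_shape_def)
  define g where "g = inv_into (verts G) f"
  have g: "bij_betw g (verts H) (verts G)" using f(1) by (simp add: g_def bij_betw_inv_into)
  have fg: "f (g y) = y" if "y \<in> verts H" for y
    using f(1) that by (simp add: g_def bij_betw_inv_into_right)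
  have gf: "g (f x) = x" if "x \<in> verts G" for x
    using f(1) that by (simp add: g_def bij_betw_inv_into_left)
  have fV: "f x \<in> verts H" if "x \<in> verts G" for x using f(1) that by (auto simp: bij_betw_def)
  have gV: "g x \<in> verts G" if "x \<in> verts H" for x using g that by (auto simp: bij_betw_def)
  have usV: "us ! i \<in> verts H" if "i < length us" for i using H(2) that by auto
  have pair: "\<exists>u v. e = {u, v} \<and> u \<in> verts H \<and> v \<in> verts H" if e: "e \<in> edges H" for e
  proof (cases "e \<in> index_edges us A")
    case True
    then obtain i j where ij: "(i, j) \<in> set A" "e = {us ! i, us ! j}"
      using index_edgesE by metis
    then have "i < length us" "j < length us" using H(4) by auto
    then show ?thesis using ij(2) usV by blast
  next
    case False
    then have "e \<in> (\<lambda>x. {us ! k, x}) ` (verts H - set us)" using e unfolding H(5) by simp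
    then show ?thesis using usV[OF H(3)] by blast
  qed
  have E: "edges G = (`) g ` edges H"
  proof
    show "edges G \<subseteq> (`) g ` edges H"
    proof
      fix e assume e: "e \<in> edges G"
      obtain u v where uv: "e = {u, v}" "u \<in> verts G" "v \<in> verts G"
        using simple_edgeE[OF assms(2) e] by metis
      then have "{f u, f v} \<in> edges H" using f(2) e by blast
      moreover have "e = g ` {f u, f v}" using uv gf by simp
      ultimately show "e \<in> (`) g ` edges H" by blast
    qed
    show "(`) g ` edges H \<subseteq> edges G"
    proof
      fix e assume "e \<in> (`) g ` edges H"
      then obtain u v where uv: "{u, v} \<in> edges H" "e = {g u, g v}" "u \<in> verts H" "v \<in> verts H"
        using pair by (metis (no_types, opaque_lifting) image_empty image_iff image_insert)
      then show "e \<in> edges G" using f(2) gV fg by simp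
    qed
  qed
  have "(`) g ` edges H = index_edges (map g us) A \<union> (\<lambda>x. {map g us ! k, x}) ` (g ` (verts H - set us))"
    unfolding H(5) image_Un image_index_edges[OF H(4)] using H(3) by (simp add: image_image)
  moreover have "g ` (verts H - set us) = verts G - set (map g us)"
  proof -
    have "g ` (verts H - set us) = g ` verts H - g ` set us"
      using g H(2) by (intro inj_on_image_set_diff) (auto simp: bij_betw_def)
    then show ?thesis using g by (simp add: bij_betw_def)
  qed
  ultimately have "star_shape G (map g us) A k"
    unfolding star_shape_def E using H g inj_on_subset[OF bij_betw_imp_inj_on[OF g] H(2)] gV
    by (auto simp: distinct_map)
  then show ?thesis by (intro exI[of _ "map g us"]) simp
qed

lemma star_shape_attach_pendent:
  assumes "verts K = set us" "distinct us" "edges K = index_edges us A"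
    "\<forall>(i, j)\<in>set A. i < j \<and> j < length us" "i < length us"
  shows "star_shape (attach_pendent K (us ! i) k) (map Inl us) A i"
    "finite (verts (attach_pendent K (us ! i) k))"
    "card (verts (attach_pendent K (us ! i) k)) = length us + k"
proof -
  let ?G = "attach_pendent K (us ! i) k"
  have V: "verts ?G = Inl ` set us \<union> Inr ` {..<k}" by (simp add: attach_pendent_def assms(1))
  have "verts ?G - set (map Inl us) = Inr ` {..<k}" unfolding V by auto
  moreover have "edges ?G = index_edges (map Inl us) A \<union> {{Inl (us ! i), Inr j} | j. j < k}"
    by (simp add: attach_pendent_def assms(3) image_index_edges[OF assms(4)])
  ultimately show "star_shape ?G (map Inl us) A i"
    using assms V by (auto simp: star_shape_def distinct_map)
  show "finite (verts ?G)" by (simp add: V)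
  have "card (verts ?G) = card (Inl ` set us :: ('a + nat) set) + card (Inr ` {..<k} :: ('a + nat) set)"
    unfolding V by (rule card_Un_disjoint) auto
  then show "card (verts ?G) = length us + k"
    by (simp add: card_image distinct_card[OF assms(2)])
qed

section \<open>Pendent edges at one core vertex, in terms of weights and deficits\<close>

context core
begin

lemma star_shape_weight:
  assumes "star_shape G vs A k"
  shows "i < n \<Longrightarrow> i \<noteq> k \<Longrightarrow> weight i = 0" "(\<Sum>f\<in>edges G - F. deficit G f) = 0"
proof -
  have S: "k < n" "edges G = F \<union> (\<lambda>x. {vs ! k, x}) ` (verts G - set vs)"
    using assms by (auto simp: star_shape_def)
  have FW: "f \<subseteq> set vs" if "f \<in> F" for f using that A(2) by (auto simp: index_edges_def)
  have "edge_gate f = k \<and> deficit G f = 0" if f: "f \<in> edges G - F" for f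
  proof -
    obtain x where x: "f = {vs ! k, x}" "x \<in> verts G" "x \<notin> set vs" using f S(2) by blast
    have "g = {vs ! k, x}" if g: "g \<in> edges G" "x \<in> g" for g
    proof -
      have "g \<notin> F" using FW[of g] g(2) x(3) by blast
      then have "g \<in> (\<lambda>x. {vs ! k, x}) ` (verts G - set vs)" using g(1) unfolding S(2) by simp
      then obtain y where y: "g = {vs ! k, y}" by (elim imageE) simp
      have "x \<noteq> vs ! k" using x(3) S(1) by auto
      then show ?thesis using g(2) unfolding y by simp
    qed
    then have "deficit G f = 0"
      unfolding x(1) using f x(1) by (intro deficit_pendent[OF simple connected]) blast+
    moreover have "edge_gate f = k" using edge_gate[of "vs ! k" x] f x(1) gate_vs[OF S(1)] by simp
    ultimately show ?thesis by simp
  qed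
  then show "i < n \<Longrightarrow> i \<noteq> k \<Longrightarrow> weight i = 0" "(\<Sum>f\<in>edges G - F. deficit G f) = 0"
    unfolding weight_def by (auto simp: card_eq_0_iff)
qed

text \<open>Deficits are nonnegative, so all edges outside the core have deficit 0 and are pendent
  by \<open>deficit_nonpendent\<close>. A tree of pendent edges only is a star, and the vanishing
  weights leave only the tree at vertex \<open>k\<close>.\<close>

lemma star_shapeI:
  assumes "k < n" "\<And>i. i < n \<Longrightarrow> i \<noteq> k \<Longrightarrow> weight i = 0" "(\<Sum>f\<in>edges G - F. deficit G f) \<le> 0"
  shows "star_shape G vs A k"
proof -
  define c where "c = vs ! k"
  have c: "c \<in> set vs" "c \<in> verts G" "gate c = k"
    using assms(1) vs_verts gate_vs by (auto simp: c_def)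
  have FW: "f \<subseteq> set vs" if "f \<in> F" for f using that A(2) by (auto simp: index_edges_def)
  have "(\<Sum>f\<in>edges G - F. deficit G f) = 0"
    using assms(3) branch_deficit_nonneg by simp
  then have def0: "deficit G f = 0" if "f \<in> edges G - F" for f
    using that finite_E deficit_nonneg[OF simple connected]
    by (subst (asm) sum_nonneg_eq_0_iff) auto
  have pendent: False if "{u, v} \<in> edges G - F" "{u, a} \<in> edges G" "a \<noteq> v" "{v, b} \<in> edges G" "b \<noteq> u"
    for u v a b
    using deficit_nonpendent[OF simple connected _ that(2-5)] def0[OF that(1)] that(1) by simp
  have g: "gate s = k" if "{s, t} \<in> edges G - F" for s t
  proof (rule ccontr)
    assume "gate s \<noteq> k"
    moreover have "gate s < n" using that simple_edge_verts[OF simple] gate_less by blast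
    ultimately have "weight (gate s) = 0" using assms(2) by blast
    then have "{f \<in> edges G - F. edge_gate f = gate s} = {}"
      using finite_E by (simp add: weight_def)
    then show False using edge_gate[OF that] that by blast
  qed
  have core_vertex: "s = c" if "s \<in> set vs" "gate s = k" for s
    using that gate_vs by (auto simp: in_set_conv_nth c_def)
  \<comment> \<open>A neighbour of \<open>c\<close> inside the core shows that an edge from
    \<open>c\<close> to the outside is never pendent at the end \<open>c\<close>.\<close>
  obtain b where b: "{c, b} \<in> F"
  proof -
    have "1 < n" using A by (cases A) auto
    then obtain i where "i < n" "i \<noteq> k" by (metis neq0_conv zero_neq_one not_less_zero less_trans zero_less_one)
    from metric_pred[OF this(1) assms(1) this(2)] show thesis
      using that unfolding index_edges_def c_def by (force simp: insert_commute)
  qed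
  \<comment> \<open>Otherwise a shortest path from \<open>c\<close> ends in vertices
    \<open>z\<close>, \<open>y\<close>, \<open>x\<close> with \<open>y\<close> outside the core. The
    edge \<open>{z, y}\<close> continues to \<open>x\<close> at one end, and at the other to
    \<open>b\<close> or to the vertex before \<open>z\<close>, so it is not pendent.\<close>
  have star: "{c, x} \<in> edges G" if x: "x \<in> verts G" "x \<notin> set vs" for x
  proof (rule ccontr)
    assume no: "{c, x} \<notin> edges G"
    note R = reach_all[OF c(2)]
    have "dist_graph G c x \<noteq> 0" using dist_eq_0[OF R[OF x(1)]] x c by blast
    then obtain d where d: "dist_graph G c x = Suc d" by (cases "dist_graph G c x") auto
    obtain y where y: "y \<in> verts G" "{y, x} \<in> edges G" "dist_graph G c y = d"
      using dist_pred[OF R[OF x(1)] d] by blast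
    have yc: "y \<noteq> c" using no y by auto
    have yx: "{y, x} \<in> edges G - F" using y FW x by blast
    then have "gate y = k" using g by blast
    then have yW: "y \<notin> set vs" using core_vertex yc by blast
    have "d \<noteq> 0" using dist_eq_0[OF R[OF y(1)]] yc y by auto
    then obtain d' where d': "dist_graph G c y = Suc d'" using y by (cases d) auto
    obtain z where z: "z \<in> verts G" "{z, y} \<in> edges G" "dist_graph G c z = d'"
      using dist_pred[OF R[OF y(1)] d'] by blast
    have zy: "{z, y} \<in> edges G - F" using z FW yW by blast
    have zx: "x \<noteq> z" using d y z d' by auto
    show False
    proof (cases "z = c")
      case True
      have "b \<noteq> y" using b FW yW by blast
      then show False using pendent[OF zy, of b x] b edges True y zx by auto
    next
      case False
      then have "d' \<noteq> 0" using dist_eq_0[OF R[OF z(1)]] z by auto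
      then obtain d'' where d'': "dist_graph G c z = Suc d''" using z by (cases d') auto
      obtain t where t: "{t, z} \<in> edges G" "dist_graph G c t = d''"
        using dist_pred[OF R[OF z(1)] d''] by blast
      then have "t \<noteq> y" using z d' d'' by auto
      then show False using pendent[OF zy, of t x] t y zx by (simp add: insert_commute)
    qed
  qed
  have "f \<in> (\<lambda>x. {c, x}) ` (verts G - set vs)" if f: "f \<in> edges G - F" for f
  proof -
    obtain s t where st: "f = {s, t}" "s \<noteq> t" "s \<in> verts G" "t \<in> verts G"
      using simple_edgeE[OF simple] f by (metis DiffD1)
    have gs: "gate s = k" "gate t = k" using g[of s t] g[of t s] f st by (auto simp: insert_commute)
    \<comment> \<open>Two adjacent vertices outside the core would form a triangle with
      \<open>c\<close>.\<close>
    have "\<not> (s \<notin> set vs \<and> t \<notin> set vs)"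
    proof
      assume a: "s \<notin> set vs \<and> t \<notin> set vs"
      then have "{c, s} \<in> edges G" "{c, t} \<in> edges G" using star st by auto
      then show False using pendent[of s t c c] f st a c by (auto simp: insert_commute)
    qed
    then consider "s \<in> set vs" | "t \<in> set vs" by blast
    then show ?thesis
    proof cases
      case 1
      then have "s = c" using core_vertex gs by blast
      moreover have "t \<notin> set vs" using core_vertex gs st \<open>s = c\<close> by blast
      ultimately show ?thesis using st by blast
    next
      case 2
      then have "t = c" using core_vertex gs by blast
      moreover have "s \<notin> set vs" using core_vertex gs st \<open>t = c\<close> by blast
      ultimately show ?thesis using st by (auto simp: insert_commute)
    qed
  qed
  then have "edges G = F \<union> (\<lambda>x. {c, x}) ` (verts G - set vs)" using edges star by blast
  then show ?thesis using vs A assms(1) by (simp add: star_shape_def c_def)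
qed

end

section \<open>The eight cores and their distance matrices\<close>

definition C44 :: "(nat \<times> nat) list" where
  "C44 = [(0, 1), (1, 2), (2, 3), (0, 3), (0, 4), (4, 5), (5, 6), (0, 6)]"

text \<open>In this core and in \<open>C34\<close> and \<open>C33\<close>, vertex 0 is the one
  shared by the two cycles.\<close>

definition C44_dist :: "nat \<Rightarrow> nat \<Rightarrow> nat" where
  "C44_dist i j = [[0, 1, 2, 1, 1, 2, 1], [1, 0, 1, 2, 2, 3, 2], [2, 1, 0, 1, 3, 4, 3], [1, 2, 1, 0, 2, 3, 2], [1, 2, 3, 2, 0, 1, 2], [2, 3, 4, 3, 1, 0, 1], [1, 2, 3, 2, 2, 1, 0]] ! i ! j"

definition C34 :: "(nat \<times> nat) list" where
  "C34 = [(0, 1), (1, 2), (0, 2), (0, 3), (3, 4), (4, 5), (0, 5)]"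

definition C34_dist :: "nat \<Rightarrow> nat \<Rightarrow> nat" where
  "C34_dist i j = [[0, 1, 1, 1, 2, 1], [1, 0, 1, 2, 3, 2], [1, 1, 0, 2, 3, 2], [1, 2, 2, 0, 1, 2], [2, 3, 3, 1, 0, 1], [1, 2, 2, 2, 1, 0]] ! i ! j"

definition C33 :: "(nat \<times> nat) list" where
  "C33 = [(0, 1), (1, 2), (0, 2), (0, 3), (3, 4), (0, 4)]"

definition C33_dist :: "nat \<Rightarrow> nat \<Rightarrow> nat" where
  "C33_dist i j = [[0, 1, 1, 1, 1], [1, 0, 1, 2, 2], [1, 1, 0, 2, 2], [1, 2, 2, 0, 1], [1, 2, 2, 1, 0]] ! i ! j"

text \<open>In every theta core 0 and 1 are the vertices of degree 3, and the inner vertices of the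
  three paths follow.\<close>

definition Theta122 :: "(nat \<times> nat) list" where
  "Theta122 = [(0, 1), (0, 2), (1, 2), (0, 3), (1, 3)]"

definition Theta122_dist :: "nat \<Rightarrow> nat \<Rightarrow> nat" where
  "Theta122_dist i j = [[0, 1, 1, 1], [1, 0, 1, 1], [1, 1, 0, 2], [1, 1, 2, 0]] ! i ! j"

definition Theta123 :: "(nat \<times> nat) list" where
  "Theta123 = [(0, 1), (0, 2), (1, 2), (0, 3), (3, 4), (1, 4)]"

definition Theta123_dist :: "nat \<Rightarrow> nat \<Rightarrow> nat" where
  "Theta123_dist i j = [[0, 1, 1, 1, 2], [1, 0, 1, 2, 1], [1, 1, 0, 2, 2], [1, 2, 2, 0, 1], [2, 1, 2, 1, 0]] ! i ! j"

definition Theta222 :: "(nat \<times> nat) list" where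
  "Theta222 = [(0, 2), (1, 2), (0, 3), (1, 3), (0, 4), (1, 4)]"

definition Theta222_dist :: "nat \<Rightarrow> nat \<Rightarrow> nat" where
  "Theta222_dist i j = [[0, 2, 1, 1, 1], [2, 0, 1, 1, 1], [1, 1, 0, 2, 2], [1, 1, 2, 0, 2], [1, 1, 2, 2, 0]] ! i ! j"

definition Theta133 :: "(nat \<times> nat) list" where
  "Theta133 = [(0, 1), (0, 2), (2, 3), (1, 3), (0, 4), (4, 5), (1, 5)]"

definition Theta133_dist :: "nat \<Rightarrow> nat \<Rightarrow> nat" where
  "Theta133_dist i j = [[0, 1, 1, 2, 1, 2], [1, 0, 2, 1, 2, 1], [1, 2, 0, 1, 2, 3], [2, 1, 1, 0, 3, 2], [1, 2, 2, 3, 0, 1], [2, 1, 3, 2, 1, 0]] ! i ! j"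

definition Theta223 :: "(nat \<times> nat) list" where
  "Theta223 = [(0, 2), (1, 2), (0, 3), (1, 3), (0, 4), (4, 5), (1, 5)]"

definition Theta223_dist :: "nat \<Rightarrow> nat \<Rightarrow> nat" where
  "Theta223_dist i j = [[0, 2, 1, 1, 1, 2], [2, 0, 1, 1, 2, 1], [1, 1, 0, 2, 2, 2], [1, 1, 2, 0, 2, 2], [1, 2, 2, 2, 0, 1], [2, 1, 2, 2, 1, 0]] ! i ! j"

lemmas core_tables =
  C44_def C34_def C33_def Theta122_def Theta123_def Theta222_def Theta133_def Theta223_def
  C44_dist_def C34_dist_def C33_dist_def Theta122_dist_def Theta123_dist_def Theta222_dist_def
  Theta133_dist_def Theta223_dist_def

lemma path_metrics:
  "path_metric 7 C44 C44_dist" "path_metric 6 C34 C34_dist" "path_metric 5 C33 C33_dist"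
  "path_metric 4 Theta122 Theta122_dist" "path_metric 5 Theta123 Theta123_dist"
  "path_metric 5 Theta222 Theta222_dist" "path_metric 6 Theta133 Theta133_dist"
  "path_metric 6 Theta223 Theta223_dist"
  by code_simp+

section \<open>The small cores\<close>

text \<open>The deficit of a core edge with the size of the graph written as the number of core
  edges plus all weights. It depends on the weights only, so each core yields one closed
  expression.\<close>

definition loss :: "(nat \<times> nat) list \<Rightarrow> (nat \<Rightarrow> nat \<Rightarrow> nat) \<Rightarrow> nat \<Rightarrow> (nat \<Rightarrow> nat) \<Rightarrow> nat \<Rightarrow> nat \<Rightarrow> int" where
  "loss A M n w i j =
     int (length A) + (\<Sum>z\<leftarrow>[0..<n]. int (w z)) - 1 - \<bar>balance A M n w i j\<bar>"

definition core_deficit :: "(nat \<times> nat) list \<Rightarrow> (nat \<Rightarrow> nat \<Rightarrow> nat) \<Rightarrow> nat \<Rightarrow> (nat \<Rightarrow> nat) \<Rightarrow> int" where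
  "core_deficit A M n w = (\<Sum>(i, j)\<leftarrow>A. loss A M n w i j)"

lemma upt_small:
  "[0..<4] = [0, 1, 2, 3::nat]" "[0..<5] = [0, 1, 2, 3, 4::nat]"
  "[0..<6] = [0, 1, 2, 3, 4, 5::nat]" "[0..<7] = [0, 1, 2, 3, 4, 5, 6::nat]"
  by code_simp+

text \<open>Each line is the number of equidistant edges minus 1, plus twice the smaller of the two
  sides; what both entries of the minimum have in common is taken out and doubled. The tables of the
  other cores follow the same pattern.\<close>

lemma C44_loss:
  "loss C44 C44_dist 7 w 0 1 = int (3 + 2 * min (4 + w 0 + w 3 + w 4 + w 5 + w 6) (w 1 + w 2))"
  "loss C44 C44_dist 7 w 1 2 = int (3 + 2 * min (4 + w 0 + w 1 + w 4 + w 5 + w 6) (w 2 + w 3))"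
  "loss C44 C44_dist 7 w 2 3 = int (3 + 2 * min (w 1 + w 2) (4 + w 0 + w 3 + w 4 + w 5 + w 6))"
  "loss C44 C44_dist 7 w 0 3 = int (3 + 2 * min (4 + w 0 + w 1 + w 4 + w 5 + w 6) (w 2 + w 3))"
  "loss C44 C44_dist 7 w 0 4 = int (3 + 2 * min (4 + w 0 + w 1 + w 2 + w 3 + w 6) (w 4 + w 5))"
  "loss C44 C44_dist 7 w 4 5 = int (3 + 2 * min (4 + w 0 + w 1 + w 2 + w 3 + w 4) (w 5 + w 6))"
  "loss C44 C44_dist 7 w 5 6 = int (3 + 2 * min (w 4 + w 5) (4 + w 0 + w 1 + w 2 + w 3 + w 6))"
  "loss C44 C44_dist 7 w 0 6 = int (3 + 2 * min (4 + w 0 + w 1 + w 2 + w 3 + w 4) (w 5 + w 6))"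
  by (simp_all add: loss_def balance_def upt_small cmp_def core_tables min_def)

lemma C44_core_deficit:
  "core_deficit C44 C44_dist 7 w = int (24) + 2 * int (
    min (4 + w 0 + w 3 + w 4 + w 5 + w 6) (w 1 + w 2) +
    min (4 + w 0 + w 1 + w 4 + w 5 + w 6) (w 2 + w 3) +
    min (w 1 + w 2) (4 + w 0 + w 3 + w 4 + w 5 + w 6) +
    min (4 + w 0 + w 1 + w 4 + w 5 + w 6) (w 2 + w 3) +
    min (4 + w 0 + w 1 + w 2 + w 3 + w 6) (w 4 + w 5) +
    min (4 + w 0 + w 1 + w 2 + w 3 + w 4) (w 5 + w 6) +
    min (w 4 + w 5) (4 + w 0 + w 1 + w 2 + w 3 + w 6) +
    min (4 + w 0 + w 1 + w 2 + w 3 + w 4) (w 5 + w 6))"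
  by (simp add: core_deficit_def C44_def C44_loss[unfolded C44_def, simplified])

lemma C34_loss:
  "loss C34 C34_dist 6 w 0 1 = int (2 + w 2 + 2 * min (4 + w 0 + w 3 + w 4 + w 5) (w 1))"
  "loss C34 C34_dist 6 w 1 2 = int (6 + w 0 + w 3 + w 4 + w 5 + 2 * min (w 1) (w 2))"
  "loss C34 C34_dist 6 w 0 2 = int (2 + w 1 + 2 * min (4 + w 0 + w 3 + w 4 + w 5) (w 2))"
  "loss C34 C34_dist 6 w 0 3 = int (3 + 2 * min (3 + w 0 + w 1 + w 2 + w 5) (w 3 + w 4))"
  "loss C34 C34_dist 6 w 3 4 = int (3 + 2 * min (3 + w 0 + w 1 + w 2 + w 3) (w 4 + w 5))"
  "loss C34 C34_dist 6 w 4 5 = int (3 + 2 * min (w 3 + w 4) (3 + w 0 + w 1 + w 2 + w 5))"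
  "loss C34 C34_dist 6 w 0 5 = int (3 + 2 * min (3 + w 0 + w 1 + w 2 + w 3) (w 4 + w 5))"
  by (simp_all add: loss_def balance_def upt_small cmp_def core_tables min_def)

lemma C34_core_deficit:
  "core_deficit C34 C34_dist 6 w = int (22 + w 0 + w 1 + w 2 + w 3 + w 4 + w 5) + 2 * int (
    min (4 + w 0 + w 3 + w 4 + w 5) (w 1) +
    min (w 1) (w 2) +
    min (4 + w 0 + w 3 + w 4 + w 5) (w 2) +
    min (3 + w 0 + w 1 + w 2 + w 5) (w 3 + w 4) +
    min (3 + w 0 + w 1 + w 2 + w 3) (w 4 + w 5) +
    min (w 3 + w 4) (3 + w 0 + w 1 + w 2 + w 5) +
    min (3 + w 0 + w 1 + w 2 + w 3) (w 4 + w 5))"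
  by (simp add: core_deficit_def C34_def C34_loss[unfolded C34_def, simplified])

lemma C33_loss:
  "loss C33 C33_dist 5 w 0 1 = int (2 + w 2 + 2 * min (3 + w 0 + w 3 + w 4) (w 1))"
  "loss C33 C33_dist 5 w 1 2 = int (5 + w 0 + w 3 + w 4 + 2 * min (w 1) (w 2))"
  "loss C33 C33_dist 5 w 0 2 = int (2 + w 1 + 2 * min (3 + w 0 + w 3 + w 4) (w 2))"
  "loss C33 C33_dist 5 w 0 3 = int (2 + w 4 + 2 * min (3 + w 0 + w 1 + w 2) (w 3))"
  "loss C33 C33_dist 5 w 3 4 = int (5 + w 0 + w 1 + w 2 + 2 * min (w 3) (w 4))"
  "loss C33 C33_dist 5 w 0 4 = int (2 + w 3 + 2 * min (3 + w 0 + w 1 + w 2) (w 4))"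
  by (simp_all add: loss_def balance_def upt_small cmp_def core_tables min_def)

lemma C33_core_deficit:
  "core_deficit C33 C33_dist 5 w = int (18 + 2 * w 0 + 2 * w 1 + 2 * w 2 + 2 * w 3 + 2 * w 4) + 2 * int (
    min (3 + w 0 + w 3 + w 4) (w 1) +
    min (w 1) (w 2) +
    min (3 + w 0 + w 3 + w 4) (w 2) +
    min (3 + w 0 + w 1 + w 2) (w 3) +
    min (w 3) (w 4) +
    min (3 + w 0 + w 1 + w 2) (w 4))"
  by (simp add: core_deficit_def C33_def C33_loss[unfolded C33_def, simplified])

lemma Theta122_loss:
  "loss Theta122 Theta122_dist 4 w 0 1 = int (4 + w 2 + w 3 + 2 * min (w 0) (w 1))"
  "loss Theta122 Theta122_dist 4 w 0 2 = int (3 + w 1 + 2 * min (1 + w 0 + w 3) (w 2))"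
  "loss Theta122 Theta122_dist 4 w 1 2 = int (3 + w 0 + 2 * min (1 + w 1 + w 3) (w 2))"
  "loss Theta122 Theta122_dist 4 w 0 3 = int (3 + w 1 + 2 * min (1 + w 0 + w 2) (w 3))"
  "loss Theta122 Theta122_dist 4 w 1 3 = int (3 + w 0 + 2 * min (1 + w 1 + w 2) (w 3))"
  by (simp_all add: loss_def balance_def upt_small cmp_def core_tables min_def)

lemma Theta122_core_deficit:
  "core_deficit Theta122 Theta122_dist 4 w = int (16 + 2 * w 0 + 2 * w 1 + w 2 + w 3) + 2 * int (
    min (w 0) (w 1) +
    min (1 + w 0 + w 3) (w 2) +
    min (1 + w 1 + w 3) (w 2) +
    min (1 + w 0 + w 2) (w 3) +
    min (1 + w 1 + w 2) (w 3))"
  by (simp add: core_deficit_def Theta122_def Theta122_loss[unfolded Theta122_def, simplified])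

lemma Theta123_loss:
  "loss Theta123 Theta123_dist 5 w 0 1 = int (5 + w 2 + 2 * min (w 0 + w 3) (w 1 + w 4))"
  "loss Theta123 Theta123_dist 5 w 0 2 = int (3 + w 1 + w 4 + 2 * min (2 + w 0 + w 3) (w 2))"
  "loss Theta123 Theta123_dist 5 w 1 2 = int (3 + w 0 + w 3 + 2 * min (2 + w 1 + w 4) (w 2))"
  "loss Theta123 Theta123_dist 5 w 0 3 = int (3 + 2 * min (2 + w 0 + w 1 + w 2) (w 3 + w 4))"
  "loss Theta123 Theta123_dist 5 w 3 4 = int (5 + w 2 + 2 * min (w 0 + w 3) (w 1 + w 4))"
  "loss Theta123 Theta123_dist 5 w 1 4 = int (3 + 2 * min (2 + w 0 + w 1 + w 2) (w 3 + w 4))"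
  by (simp_all add: loss_def balance_def upt_small cmp_def core_tables min_def)

lemma Theta123_core_deficit:
  "core_deficit Theta123 Theta123_dist 5 w = int (22 + w 0 + w 1 + 2 * w 2 + w 3 + w 4) + 2 * int (
    min (w 0 + w 3) (w 1 + w 4) +
    min (2 + w 0 + w 3) (w 2) +
    min (2 + w 1 + w 4) (w 2) +
    min (2 + w 0 + w 1 + w 2) (w 3 + w 4) +
    min (w 0 + w 3) (w 1 + w 4) +
    min (2 + w 0 + w 1 + w 2) (w 3 + w 4))"
  by (simp add: core_deficit_def Theta123_def Theta123_loss[unfolded Theta123_def, simplified])

lemma Theta222_loss:
  "loss Theta222 Theta222_dist 5 w 0 2 = int (4 + 2 * min (1 + w 0 + w 3 + w 4) (w 1 + w 2))"
  "loss Theta222 Theta222_dist 5 w 1 2 = int (4 + 2 * min (1 + w 1 + w 3 + w 4) (w 0 + w 2))"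
  "loss Theta222 Theta222_dist 5 w 0 3 = int (4 + 2 * min (1 + w 0 + w 2 + w 4) (w 1 + w 3))"
  "loss Theta222 Theta222_dist 5 w 1 3 = int (4 + 2 * min (1 + w 1 + w 2 + w 4) (w 0 + w 3))"
  "loss Theta222 Theta222_dist 5 w 0 4 = int (4 + 2 * min (1 + w 0 + w 2 + w 3) (w 1 + w 4))"
  "loss Theta222 Theta222_dist 5 w 1 4 = int (4 + 2 * min (1 + w 1 + w 2 + w 3) (w 0 + w 4))"
  by (simp_all add: loss_def balance_def upt_small cmp_def core_tables min_def)

lemma Theta222_core_deficit:
  "core_deficit Theta222 Theta222_dist 5 w = int (24) + 2 * int (
    min (1 + w 0 + w 3 + w 4) (w 1 + w 2) +
    min (1 + w 1 + w 3 + w 4) (w 0 + w 2) +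
    min (1 + w 0 + w 2 + w 4) (w 1 + w 3) +
    min (1 + w 1 + w 2 + w 4) (w 0 + w 3) +
    min (1 + w 0 + w 2 + w 3) (w 1 + w 4) +
    min (1 + w 1 + w 2 + w 3) (w 0 + w 4))"
  by (simp add: core_deficit_def Theta222_def Theta222_loss[unfolded Theta222_def, simplified])

lemma Theta133_loss:
  "loss Theta133 Theta133_dist 6 w 0 1 = int (6 + 2 * min (w 0 + w 2 + w 4) (w 1 + w 3 + w 5))"
  "loss Theta133 Theta133_dist 6 w 0 2 = int (3 + 2 * min (3 + w 0 + w 1 + w 4 + w 5) (w 2 + w 3))"
  "loss Theta133 Theta133_dist 6 w 2 3 = int (6 + 2 * min (w 0 + w 2 + w 4) (w 1 + w 3 + w 5))"
  "loss Theta133 Theta133_dist 6 w 1 3 = int (3 + 2 * min (3 + w 0 + w 1 + w 4 + w 5) (w 2 + w 3))"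
  "loss Theta133 Theta133_dist 6 w 0 4 = int (3 + 2 * min (3 + w 0 + w 1 + w 2 + w 3) (w 4 + w 5))"
  "loss Theta133 Theta133_dist 6 w 4 5 = int (6 + 2 * min (w 0 + w 2 + w 4) (w 1 + w 3 + w 5))"
  "loss Theta133 Theta133_dist 6 w 1 5 = int (3 + 2 * min (3 + w 0 + w 1 + w 2 + w 3) (w 4 + w 5))"
  by (simp_all add: loss_def balance_def upt_small cmp_def core_tables min_def)

lemma Theta133_core_deficit:
  "core_deficit Theta133 Theta133_dist 6 w = int (30) + 2 * int (
    min (w 0 + w 2 + w 4) (w 1 + w 3 + w 5) +
    min (3 + w 0 + w 1 + w 4 + w 5) (w 2 + w 3) +
    min (w 0 + w 2 + w 4) (w 1 + w 3 + w 5) +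
    min (3 + w 0 + w 1 + w 4 + w 5) (w 2 + w 3) +
    min (3 + w 0 + w 1 + w 2 + w 3) (w 4 + w 5) +
    min (w 0 + w 2 + w 4) (w 1 + w 3 + w 5) +
    min (3 + w 0 + w 1 + w 2 + w 3) (w 4 + w 5))"
  by (simp add: core_deficit_def Theta133_def Theta133_loss[unfolded Theta133_def, simplified])

lemma Theta223_loss:
  "loss Theta223 Theta223_dist 6 w 0 2 = int (5 + w 5 + 2 * min (1 + w 0 + w 3 + w 4) (w 1 + w 2))"
  "loss Theta223 Theta223_dist 6 w 1 2 = int (5 + w 4 + 2 * min (1 + w 1 + w 3 + w 5) (w 0 + w 2))"
  "loss Theta223 Theta223_dist 6 w 0 3 = int (5 + w 5 + 2 * min (1 + w 0 + w 2 + w 4) (w 1 + w 3))"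
  "loss Theta223 Theta223_dist 6 w 1 3 = int (5 + w 4 + 2 * min (1 + w 1 + w 2 + w 5) (w 0 + w 3))"
  "loss Theta223 Theta223_dist 6 w 0 4 = int (4 + w 1 + 2 * min (2 + w 0 + w 2 + w 3) (w 4 + w 5))"
  "loss Theta223 Theta223_dist 6 w 4 5 = int (6 + w 2 + w 3 + 2 * min (w 0 + w 4) (w 1 + w 5))"
  "loss Theta223 Theta223_dist 6 w 1 5 = int (4 + w 0 + 2 * min (2 + w 1 + w 2 + w 3) (w 4 + w 5))"
  by (simp_all add: loss_def balance_def upt_small cmp_def core_tables min_def)

lemma Theta223_core_deficit:
  "core_deficit Theta223 Theta223_dist 6 w = int (34 + w 0 + w 1 + w 2 + w 3 + 2 * w 4 + 2 * w 5) + 2 * int (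
    min (1 + w 0 + w 3 + w 4) (w 1 + w 2) +
    min (1 + w 1 + w 3 + w 5) (w 0 + w 2) +
    min (1 + w 0 + w 2 + w 4) (w 1 + w 3) +
    min (1 + w 1 + w 2 + w 5) (w 0 + w 3) +
    min (2 + w 0 + w 2 + w 3) (w 4 + w 5) +
    min (w 0 + w 4) (w 1 + w 5) +
    min (2 + w 1 + w 2 + w 3) (w 4 + w 5))"
  by (simp add: core_deficit_def Theta223_def Theta223_loss[unfolded Theta223_def, simplified])

lemma (in core) deficit_sum_core_deficit:
  "deficit_sum G = core_deficit A M n weight + (\<Sum>f\<in>edges G - F. deficit G f)"
proof -
  have "int (length A) + (\<Sum>z\<leftarrow>[0..<n]. int (weight z)) = int (card (edges G))"
    using sum_weight by simp
  then show ?thesis unfolding deficit_sum_core core_deficit_def loss_def by simp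
qed

section \<open>Recognising the extremal graphs by their star shapes\<close>

lemma core_of_star_shape:
  assumes "bicyclic G" "star_shape G vs A k" "path_metric (length vs) A M" "distinct A" "length A = length vs + 1"
  shows "core G vs A M"
  using assms by (auto simp: core_def star_shape_def)

text \<open>Given the core, equality of the numbers of vertices fixes the number of pendent
  edges.\<close>

lemma isomorphic_iff_star_shape:
  assumes "simple_graph G" "star_shape H us A k" "finite (verts H)" "card (verts G) = card (verts H)"
  shows "G \<simeq> H \<longleftrightarrow> (\<exists>vs. star_shape G vs A k \<and> length vs = length us)"
  using isomorphic_star_shape[OF _ assms(1,2)] star_shape_isomorphic[OF _ assms(2)] assms
    simple_finite_verts by metis

lemma verts_two_cycles:
  "verts (two_cycles 3 3) = {(0, 0), (1, 1), (1, 2), (2, 1), (2, 2)}"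
  "verts (two_cycles 3 4) = {(0, 0), (1, 1), (1, 2), (2, 1), (2, 2), (2, 3)}"
  "verts (two_cycles 4 4) = {(0, 0), (1, 1), (1, 2), (1, 3), (2, 1), (2, 2), (2, 3)}"
  by (auto simp: construction_simps cycle_graph_def lessThan_small)

lemma verts_theta_graph_1_2_2: "verts (theta_graph 1 2 2) = {(0, 0), (0, 1), (2, 1), (3, 1)}"
proof -
  have "{..2::nat} = {0, 1, 2}" "{..1::nat} = {0, 1}" by auto
  then show ?thesis by (auto simp: construction_simps path_graph_def)
qed

lemma isomorphic_attach_pendent:
  assumes "simple_graph G" "verts K = set us" "distinct us" "edges K = index_edges us A"
    "\<forall>(i, j)\<in>set A. i < j \<and> j < length us" "i < length us" "length us = l" "card (verts G) = l + k"
  shows "G \<simeq> attach_pendent K (us ! i) k \<longleftrightarrow> (\<exists>vs. star_shape G vs A i \<and> length vs = l)"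
  using isomorphic_iff_star_shape[OF assms(1) star_shape_attach_pendent(1,2)[OF assms(2-6)]]
    star_shape_attach_pendent(3)[OF assms(2-6)] assms(7,8) by simp

lemma isomorphic_B:
  assumes "simple_graph G" "card (verts G) + 1 = m" "8 \<le> m"
  shows "G \<simeq> B m \<longleftrightarrow> (\<exists>vs. star_shape G vs C44 0 \<and> length vs = 7)"
  using isomorphic_attach_pendent[OF assms(1), of "two_cycles 4 4"
      "[(0, 0), (1, 1), (1, 2), (1, 3), (2, 1), (2, 2), (2, 3)]" C44 0 7 "m - 8"] assms(2,3)
  by (simp add: B_def verts_two_cycles edges_two_cycles_4_4 index_edges_def C44_def insert_commute)

lemma isomorphic_B1:
  assumes "simple_graph G" "card (verts G) + 1 = m" "7 \<le> m"
  shows "G \<simeq> B1 m \<longleftrightarrow> (\<exists>vs. star_shape G vs C34 0 \<and> length vs = 6)"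
  using isomorphic_attach_pendent[OF assms(1), of "two_cycles 3 4"
      "[(0, 0), (1, 1), (1, 2), (2, 1), (2, 2), (2, 3)]" C34 0 6 "m - 7"] assms(2,3)
  by (simp add: B1_def verts_two_cycles edges_two_cycles_3_4 index_edges_def C34_def insert_commute)

lemma isomorphic_B2:
  assumes "simple_graph G" "card (verts G) + 1 = m" "6 \<le> m"
  shows "G \<simeq> B2 m \<longleftrightarrow> (\<exists>vs. star_shape G vs C33 0 \<and> length vs = 5)"
  using isomorphic_attach_pendent[OF assms(1), of "two_cycles 3 3"
      "[(0, 0), (1, 1), (1, 2), (2, 1), (2, 2)]" C33 0 5 "m - 6"] assms(2,3)
  by (simp add: B2_def verts_two_cycles edges_two_cycles_3_3 index_edges_def C33_def insert_commute)

lemma theta_graph_edges_index: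
  "edges (theta_graph 1 2 2) = index_edges [(0, 0), (0, 1), (2, 1), (3, 1)] Theta122"
  by (simp add: edges_theta_graph_1_2_2[simplified] index_edges_def Theta122_def insert_commute)

lemma isomorphic_B3:
  assumes "simple_graph G" "card (verts G) + 1 = m" "5 \<le> m"
  shows "G \<simeq> B3 m \<longleftrightarrow> (\<exists>vs. star_shape G vs Theta122 0 \<and> length vs = 4)"
  using isomorphic_attach_pendent[OF assms(1), of "theta_graph 1 2 2"
      "[(0, 0), (0, 1), (2, 1), (3, 1)]" Theta122 0 4 "m - 5", OF _ _ theta_graph_edges_index] assms(2,3)
  by (simp add: B3_def verts_theta_graph_1_2_2[simplified] Theta122_def)

lemma isomorphic_B4:
  assumes "simple_graph G" "card (verts G) + 1 = m" "5 \<le> m"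
  shows "G \<simeq> B4 m \<longleftrightarrow> (\<exists>vs. star_shape G vs Theta122 2 \<and> length vs = 4)"
  using isomorphic_attach_pendent[OF assms(1), of "theta_graph 1 2 2"
      "[(0, 0), (0, 1), (2, 1), (3, 1)]" Theta122 2 4 "m - 5", OF _ _ theta_graph_edges_index] assms(2,3)
  by (simp add: B4_def verts_theta_graph_1_2_2[simplified] Theta122_def)

text \<open>Read with \<open>l\<close> the linear part of a core deficit, \<open>x\<close> its sum
  of minima and \<open>b\<close> the deficit outside the core: equality with the linear part forces
  all minima and the outside deficit to vanish.\<close>

lemma excess_ge:
  assumes "D = int l + 2 * int x + b" "0 \<le> b"
  shows "int l \<le> D" "D \<le> int l \<Longrightarrow> x = 0" "D \<le> int l \<Longrightarrow> b \<le> 0"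
  using assms by simp_all

lemma min_eq_0_nat: "min a b = (0::nat) \<longleftrightarrow> a = 0 \<or> b = 0"
  by auto

lemma all_less_small:
  "(\<forall>i<7. P i) \<longleftrightarrow> P 0 \<and> P 1 \<and> P 2 \<and> P 3 \<and> P 4 \<and> P 5 \<and> P (6::nat)"
  "(\<forall>i<6. P i) \<longleftrightarrow> P 0 \<and> P 1 \<and> P 2 \<and> P 3 \<and> P 4 \<and> P (5::nat)"
  "(\<forall>i<5. P i) \<longleftrightarrow> P 0 \<and> P 1 \<and> P 2 \<and> P 3 \<and> P (4::nat)"
  "(\<forall>i<4. P i) \<longleftrightarrow> P 0 \<and> P 1 \<and> P 2 \<and> P (3::nat)"
proof -
  have *: "(\<forall>i<n. P i) \<longleftrightarrow> (\<forall>i\<in>set [0..<n]. P i)" for n by auto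
  show "(\<forall>i<7. P i) \<longleftrightarrow> P 0 \<and> P 1 \<and> P 2 \<and> P 3 \<and> P 4 \<and> P 5 \<and> P (6::nat)"
    "(\<forall>i<6. P i) \<longleftrightarrow> P 0 \<and> P 1 \<and> P 2 \<and> P 3 \<and> P 4 \<and> P (5::nat)"
    "(\<forall>i<5. P i) \<longleftrightarrow> P 0 \<and> P 1 \<and> P 2 \<and> P 3 \<and> P (4::nat)"
    "(\<forall>i<4. P i) \<longleftrightarrow> P 0 \<and> P 1 \<and> P 2 \<and> P (3::nat)"
    unfolding * upt_small by simp_all
qed

section \<open>The least deficit over each core, and equality\<close>

lemma sum_weight_small:
  assumes "core G vs A M"
  shows "length vs = 4 \<Longrightarrow> card (edges G) = 5 +
      core.weight G vs A 0 + core.weight G vs A 1 + core.weight G vs A 2 + core.weight G vs A 3"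
    "length vs = 5 \<Longrightarrow> card (edges G) = 6 + core.weight G vs A 0 + core.weight G vs A 1 +
      core.weight G vs A 2 + core.weight G vs A 3 + core.weight G vs A 4"
    "length vs = 6 \<Longrightarrow> card (edges G) = 7 + core.weight G vs A 0 + core.weight G vs A 1 +
      core.weight G vs A 2 + core.weight G vs A 3 + core.weight G vs A 4 + core.weight G vs A 5"
  using core.sum_weight[OF assms] core.A(3)[OF assms] by (simp_all add: upt_small)

text \<open>Each minimum has one entry with the positive constant 4, so it vanishes only if the
  other entry does. Together the other entries contain every weight except that of vertex 0.\<close>

lemma deficit_sum_C44:
  assumes "core G vs C44 C44_dist"
  shows "24 \<le> deficit_sum G" "deficit_sum G \<le> 24 \<Longrightarrow> star_shape G vs C44 0"
    "star_shape G vs C44 0 \<Longrightarrow> deficit_sum G = 24"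
proof -
  interpret core G vs C44 C44_dist by fact
  have n: "n = 7" using A(3) by (simp add: C44_def)
  note D = deficit_sum_core_deficit[unfolded n C44_core_deficit]
  note X = excess_ge[OF D branch_deficit_nonneg]
  have l: "int 24 = 24" by simp
  show "24 \<le> deficit_sum G" using X(1) unfolding l .
  show "star_shape G vs C44 0" if "deficit_sum G \<le> 24"
  proof (rule star_shapeI)
    have "\<forall>i<7. i \<noteq> 0 \<longrightarrow> weight i = 0"
      using X(2)[unfolded l, OF that] unfolding all_less_small by (simp add: min_eq_0_nat)
    then show "\<And>i. i < n \<Longrightarrow> i \<noteq> 0 \<Longrightarrow> weight i = 0" by (simp add: n)
    show "(\<Sum>f\<in>edges G - F. deficit G f) \<le> 0" using X(3)[unfolded l, OF that] .
  qed (simp add: n)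
  show "deficit_sum G = 24" if "star_shape G vs C44 0"
    unfolding D l star_shape_weight(2)[OF that] using star_shape_weight(1)[OF that] by (simp add: n)
qed

text \<open>The linear part 22 plus all weights is m + 15, since this core has 7 edges. The minima
  force the weights away from vertex 0 to vanish as for \<open>C44\<close>.\<close>

lemma deficit_sum_C34:
  assumes "core G vs C34 C34_dist" and m: "card (edges G) = m"
  shows "int m + 15 \<le> deficit_sum G" "deficit_sum G \<le> int m + 15 \<Longrightarrow> star_shape G vs C34 0"
    "star_shape G vs C34 0 \<Longrightarrow> deficit_sum G = int m + 15"
proof -
  interpret core G vs C34 C34_dist by fact
  have n: "n = 6" using A(3) by (simp add: C34_def)
  note D = deficit_sum_core_deficit[unfolded n C34_core_deficit] and S = sum_weight_small(3)[OF assms(1) n, unfolded m]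
  note X = excess_ge[OF D branch_deficit_nonneg]
  have l: "int (22 + weight 0 + weight 1 + weight 2 + weight 3 + weight 4 + weight 5) = int m + 15"
    using S by simp
  show "int m + 15 \<le> deficit_sum G" using X(1) unfolding l .
  show "star_shape G vs C34 0" if "deficit_sum G \<le> int m + 15"
  proof (rule star_shapeI)
    have "\<forall>i<6. i \<noteq> 0 \<longrightarrow> weight i = 0"
      using X(2)[unfolded l, OF that] unfolding all_less_small by (simp add: min_eq_0_nat)
    then show "\<And>i. i < n \<Longrightarrow> i \<noteq> 0 \<Longrightarrow> weight i = 0" by (simp add: n)
    show "(\<Sum>f\<in>edges G - F. deficit G f) \<le> 0" using X(3)[unfolded l, OF that] .
  qed (simp add: n)
  show "deficit_sum G = int m + 15" if "star_shape G vs C34 0"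
    unfolding D l star_shape_weight(2)[OF that] using star_shape_weight(1)[OF that] by (simp add: n)
qed

lemma deficit_sum_C33:
  assumes "core G vs C33 C33_dist" and m: "card (edges G) = m"
  shows "2 * int m + 6 \<le> deficit_sum G" "deficit_sum G \<le> 2 * int m + 6 \<Longrightarrow> star_shape G vs C33 0"
    "star_shape G vs C33 0 \<Longrightarrow> deficit_sum G = 2 * int m + 6"
proof -
  interpret core G vs C33 C33_dist by fact
  have n: "n = 5" using A(3) by (simp add: C33_def)
  note D = deficit_sum_core_deficit[unfolded n C33_core_deficit] and S = sum_weight_small(2)[OF assms(1) n, unfolded m]
  note X = excess_ge[OF D branch_deficit_nonneg]
  have l: "int (18 + 2 * weight 0 + 2 * weight 1 + 2 * weight 2 + 2 * weight 3 + 2 * weight 4) = 2 * int m + 6"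
    using S by simp
  show "2 * int m + 6 \<le> deficit_sum G" using X(1) unfolding l .
  show "star_shape G vs C33 0" if "deficit_sum G \<le> 2 * int m + 6"
  proof (rule star_shapeI)
    have "\<forall>i<5. i \<noteq> 0 \<longrightarrow> weight i = 0"
      using X(2)[unfolded l, OF that] unfolding all_less_small by (simp add: min_eq_0_nat)
    then show "\<And>i. i < n \<Longrightarrow> i \<noteq> 0 \<Longrightarrow> weight i = 0" by (simp add: n)
    show "(\<Sum>f\<in>edges G - F. deficit G f) \<le> 0" using X(3)[unfolded l, OF that] .
  qed (simp add: n)
  show "deficit_sum G = 2 * int m + 6" if "star_shape G vs C33 0"
    unfolding D l star_shape_weight(2)[OF that] using star_shape_weight(1)[OF that] by (simp add: n)
qed

text \<open>The two automorphisms of the core: one exchanges its vertices of degree 3, the other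
  those of degree 2.\<close>

lemma star_shape_Theta122_swap:
  assumes "star_shape G vs Theta122 k" "length vs = 4"
  shows "k = 1 \<Longrightarrow> \<exists>us. star_shape G us Theta122 0 \<and> length us = 4"
    "k = 3 \<Longrightarrow> \<exists>us. star_shape G us Theta122 2 \<and> length us = 4"
proof -
  obtain a b c d where vs: "vs = [a, b, c, d]"
    using assms(2) by (auto simp: length_Suc_conv numeral_eq_Suc)
  have "index_edges [b, a, c, d] Theta122 = index_edges vs Theta122"
    "index_edges [a, b, d, c] Theta122 = index_edges vs Theta122"
    by (auto simp: vs index_edges_def Theta122_def)
  moreover have "set [b, a, c, d] = set vs" "set [a, b, d, c] = set vs" by (auto simp: vs)
  ultimately have "k = 1 \<Longrightarrow> star_shape G [b, a, c, d] Theta122 0"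
    "k = 3 \<Longrightarrow> star_shape G [a, b, d, c] Theta122 2"
    using assms unfolding star_shape_def by (simp_all add: vs) auto
  then show "k = 1 \<Longrightarrow> \<exists>us. star_shape G us Theta122 0 \<and> length us = 4"
    "k = 3 \<Longrightarrow> \<exists>us. star_shape G us Theta122 2 \<and> length us = 4"
    by - (rule exI[of _ "[b, a, c, d]"], simp, rule exI[of _ "[a, b, d, c]"], simp)
qed

text \<open>With all weight at vertex 2, two minima have the form min(1, w 2). They add 4 as soon as
  there is one pendent edge and nothing for m = 5, hence the exception.\<close>

lemma deficit_sum_Theta122_star:
  assumes "core G vs Theta122 Theta122_dist" and m: "card (edges G) = m"
  shows "star_shape G vs Theta122 0 \<Longrightarrow> deficit_sum G = 2 * int m + 6"
    "star_shape G vs Theta122 2 \<Longrightarrow> deficit_sum G = (if m = 5 then 16 else int m + 15)"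
proof -
  interpret core G vs Theta122 Theta122_dist by fact
  have n: "n = 4" using A(3) by (simp add: Theta122_def)
  note D = deficit_sum_core_deficit[unfolded n Theta122_core_deficit]
  note S = sum_weight_small(1)[OF assms(1) n, unfolded m]
  show "deficit_sum G = 2 * int m + 6" if "star_shape G vs Theta122 0"
    unfolding D S star_shape_weight(2)[OF that] using star_shape_weight(1)[OF that] by (simp add: n)
  show "deficit_sum G = (if m = 5 then 16 else int m + 15)" if "star_shape G vs Theta122 2"
    unfolding D S star_shape_weight(2)[OF that] using star_shape_weight(1)[OF that]
    by (cases "weight 2") (simp_all add: n)
qed

text \<open>Weight at a vertex of degree 2 enters the linear part only once, but costs an extra 4
  through its two minima. With one of \<open>c\<close>, \<open>d\<close> nonzero, the bound 2m + 6
  gives \<open>4 \<le> c + d\<close> and the bound 24 gives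
  \<open>2 * a + 2 * b + c + d \<le> 4\<close>; so all is tight and m = 9. With both nonzero the
  extra cost is 8 and the bounds contradict each other.\<close>

lemma Theta122_arith:
  fixes a b c d x p q r s :: nat and y :: int
  assumes "int (16 + 2 * a + 2 * b + c + d) + 2 * int (x + p + q + r + s) + y \<le> min (2 * int (5 + a + b + c + d) + 6) 24"
    and "0 \<le> y" "c \<noteq> 0 \<longrightarrow> 1 \<le> p \<and> 1 \<le> q" "d \<noteq> 0 \<longrightarrow> 1 \<le> r \<and> 1 \<le> s" "c \<noteq> 0 \<or> d \<noteq> 0"
  shows "a = 0 \<and> b = 0 \<and> y \<le> 0 \<and> (c = 0 \<or> d = 0)"
proof (cases "c = 0 \<or> d = 0")
  case True
  then have "2 \<le> p + q + r + s" using assms(3-5) by auto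
  then show ?thesis using assms(1,2) True by auto
next
  case False
  then have "4 \<le> p + q + r + s" using assms(3,4) by auto
  then show ?thesis using assms(1,2) False by auto
qed

lemma deficit_sum_Theta122:
  assumes "core G vs Theta122 Theta122_dist" and m: "card (edges G) = m"
    and le: "deficit_sum G \<le> min (2 * int m + 6) 24"
  shows "\<exists>us k. star_shape G us Theta122 k \<and> length us = 4 \<and> (k = 0 \<or> k = 2)"
proof -
  interpret core G vs Theta122 Theta122_dist by fact
  have n: "n = 4" using A(3) by (simp add: Theta122_def)
  note D = deficit_sum_core_deficit[unfolded n Theta122_core_deficit]
  note S = sum_weight_small(1)[OF assms(1) n, unfolded m]
  let ?b = "\<Sum>f\<in>edges G - F. deficit G f"
  let ?w = weight
  have b: "0 \<le> ?b" by (rule branch_deficit_nonneg)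
  have star: "star_shape G vs Theta122 k"
    if "k < 4" "\<forall>i<4. i \<noteq> k \<longrightarrow> ?w i = 0" "?b \<le> 0" for k
    using that by (intro star_shapeI) (simp_all add: n)
  have "star_shape G vs Theta122 0 \<or> star_shape G vs Theta122 1 \<or> star_shape G vs Theta122 2
      \<or> star_shape G vs Theta122 3"
  proof (cases "?w 2 = 0 \<and> ?w 3 = 0")
    case True
    then have "min (?w 0) (?w 1) = 0" "?b \<le> 0" using le b unfolding D S by simp_all
    then show ?thesis
      using star[of 0] star[of 1] True by (auto simp: all_less_small min_eq_0_nat)
  next
    case False
    have "?w 0 = 0 \<and> ?w 1 = 0 \<and> ?b \<le> 0 \<and> (?w 2 = 0 \<or> ?w 3 = 0)"
      by (rule Theta122_arith[OF le[unfolded D S] b]) (use False in auto)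
    then show ?thesis using star[of 2] star[of 3] by (auto simp: all_less_small)
  qed
  then show ?thesis using star_shape_Theta122_swap[OF _ n] n by blast
qed

text \<open>The linear part is at least m + 16 and so exceeds m + 15, the mean of 2m + 6 and 24;
  this core never reaches the minimum.\<close>

lemma deficit_sum_Theta123:
  assumes "core G vs Theta123 Theta123_dist" and m: "card (edges G) = m"
  shows "int m + 16 \<le> deficit_sum G"
proof -
  interpret core G vs Theta123 Theta123_dist by fact
  have n: "n = 5" using A(3) by (simp add: Theta123_def)
  note D = deficit_sum_core_deficit[unfolded n Theta123_core_deficit]
  show ?thesis
    using excess_ge(1)[OF D branch_deficit_nonneg] sum_weight_small(2)[OF assms(1) n] m by simp
qed

text \<open>The value 24 is attained by the bare core alone, for m = 6, where the competing bound 2m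
  + 6 = 18 is smaller.\<close>

lemma deficit_sum_Theta222:
  assumes "core G vs Theta222 Theta222_dist" and m: "card (edges G) = m"
  shows "24 \<le> deficit_sum G" "deficit_sum G \<le> 24 \<Longrightarrow> m = 6"
proof -
  interpret core G vs Theta222 Theta222_dist by fact
  have n: "n = 5" using A(3) by (simp add: Theta222_def)
  note D = deficit_sum_core_deficit[unfolded n Theta222_core_deficit]
  note X = excess_ge[OF D branch_deficit_nonneg, unfolded of_nat_numeral]
  show "24 \<le> deficit_sum G" by (rule X(1))
  show "m = 6" if "deficit_sum G \<le> 24"
    using X(2)[OF that] sum_weight_small(2)[OF assms(1) n] m by (auto simp: min_eq_0_nat)
qed

lemma deficit_sum_Theta133:
  assumes "core G vs Theta133 Theta133_dist"
  shows "30 \<le> deficit_sum G"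
proof -
  interpret core G vs Theta133 Theta133_dist by fact
  have n: "n = 6" using A(3) by (simp add: Theta133_def)
  note D = deficit_sum_core_deficit[unfolded n Theta133_core_deficit]
  show ?thesis using excess_ge(1)[OF D branch_deficit_nonneg] by simp
qed

lemma deficit_sum_Theta223:
  assumes "core G vs Theta223 Theta223_dist"
  shows "34 \<le> deficit_sum G"
proof -
  interpret core G vs Theta223 Theta223_dist by fact
  have n: "n = 6" using A(3) by (simp add: Theta223_def)
  note D = deficit_sum_core_deficit[unfolded n Theta223_core_deficit]
  show ?thesis using excess_ge(1)[OF D branch_deficit_nonneg] by simp
qed

section \<open>Structure of bicyclic graphs\<close>

text \<open>All candidates at once, whatever the size; which of them attain the minimum is decided
  at the end from their explicit deficits.\<close>

definition extremal :: "'v ugraph \<Rightarrow> bool" where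
  "extremal G \<longleftrightarrow> (\<exists>vs. star_shape G vs C44 0 \<and> length vs = 7) \<or>
     (\<exists>vs. star_shape G vs C34 0 \<and> length vs = 6) \<or> (\<exists>vs. star_shape G vs C33 0 \<and> length vs = 5) \<or>
     (\<exists>vs. star_shape G vs Theta122 0 \<and> length vs = 4) \<or> (\<exists>vs. star_shape G vs Theta122 2 \<and> length vs = 4)"

lemma cycle_edges_rotate1: "cycle_edges (xs @ [x]) = cycle_edges (x # xs)"
proof (cases xs rule: rev_cases)
  case (snoc ys y)
  have "path_edges (ys @ [y, x]) = insert {y, x} (path_edges (ys @ [y]))"
    using path_edges_append[of ys y "[x]"] by simp
  moreover have "path_edges (x # ys @ [y]) = insert {x, hd (ys @ [y])} (path_edges (ys @ [y]))"
    by (cases ys) auto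
  moreover have "hd (ys @ [y, x]) = hd (ys @ [y])" by (cases ys) auto
  ultimately show ?thesis unfolding snoc cycle_edges_def by (auto simp: insert_commute)
qed (simp add: cycle_edges_def)

lemma cycle_edges_rotate: "cycle_edges (rotate k xs) = cycle_edges xs"
proof (induction k)
  case (Suc k)
  then show ?case
    using cycle_edges_rotate1[of "tl (rotate k xs)" "hd (rotate k xs)"]
    by (cases "rotate k xs") auto
qed simp

lemma is_cycle_rotate:
  assumes "is_cycle G cs" "x \<in> set cs"
  obtains ds where "is_cycle G (x # ds)" "Suc (length ds) = length cs" "set (x # ds) = set cs"
    "cycle_edges (x # ds) = cycle_edges cs"
proof -
  obtain ys zs where cs: "cs = ys @ x # zs" using assms(2) by (meson split_list)
  have "rotate (length ys) cs = x # zs @ ys" using rotate_append[of ys "x # zs"] by (simp add: cs)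
  then have "cycle_edges (x # zs @ ys) = cycle_edges cs" by (metis cycle_edges_rotate)
  then show thesis
    using assms(1) by (intro that[of "zs @ ys"]) (auto simp: is_cycle_edges cs)
qed

lemma ear_cong: "set cs = set ds \<Longrightarrow> cycle_edges cs = cycle_edges ds \<Longrightarrow> ear G cs P = ear G ds P"
  by (simp add: ear_def)

lemma cycle_neighbour:
  assumes "is_cycle G cs" "x \<in> set cs"
  shows "\<exists>y\<in>set cs. {x, y} \<in> edges G"
proof -
  obtain ds where ds: "is_cycle G (x # ds)" "set (x # ds) = set cs"
    using is_cycle_rotate[OF assms] by metis
  obtain y es where "ds = y # es" using ds(1) by (cases ds) (auto simp: is_cycle_def)
  then show ?thesis using ds by (intro bexI[of _ y]) (auto simp: is_cycle_def)
qed

text \<open>The edge is where the component of the second cycle, in the graph without the vertices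
  of the first, meets the first cycle. Beyond \<open>b\<close> it continues along the first cycle,
  beyond \<open>a\<close> towards or along the second, so it is not pendent.\<close>

lemma separating_edge:
  assumes "simple_graph G" "connected_graph G" "is_cycle G cs" "is_cycle G cs'" "set cs \<inter> set cs' = {}"
  shows "\<exists>e\<in>edges G. e \<notin> cycle_edges cs \<and> e \<notin> cycle_edges cs' \<and> 2 \<le> deficit G e"
proof -
  have C: "set cs \<subseteq> verts G" "cs \<noteq> []" "set cs' \<subseteq> verts G" "cs' \<noteq> []"
    using assms(3,4) by (auto simp: is_cycle_edges)
  let ?H = "UGraph (verts G - set cs) {e \<in> edges G. e \<inter> set cs = {}}"
  let ?R = "reach ?H (hd cs')"
  have h: "hd cs' \<in> set cs'" "hd cs \<in> set cs" using C by auto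
  have R0: "?R (hd cs')" using h C assms(5) by (intro reach_refl) auto
  have RV: "x \<in> verts G \<and> x \<notin> set cs" if "?R x" for x using reach_verts[OF that] by simp
  have "\<exists>a b. {a, b} \<in> edges G \<and> a \<in> verts G \<and> b \<in> verts G \<and> ?R a \<and> \<not> ?R b"
  proof (rule ccontr)
    assume n: "\<not> ?thesis"
    have "reach G (hd cs') (hd cs)" using connected_reach[OF assms(2)] C h by blast
    then have "?R (hd cs)" using reach_invariant[of G ?R "hd cs'" "hd cs"] R0 n by blast
    then show False using RV h by blast
  qed
  then obtain a b where ab: "{a, b} \<in> edges G" "a \<in> verts G" "b \<in> verts G" "?R a" "\<not> ?R b" by blast
  have aC: "a \<notin> set cs" using RV[OF ab(4)] by simp
  have bC: "b \<in> set cs"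
  proof (rule ccontr)
    assume "b \<notin> set cs"
    then have "reach ?H a b" using ab aC by (intro reach_edge) auto
    from reach_trans[OF ab(4) this] show False using ab(5) by contradiction
  qed
  \<comment> \<open>If \<open>a\<close> is the head of the second cycle, a neighbour on that cycle
    serves; otherwise the first step of a walk from \<open>a\<close> to this head that avoids the
    first cycle.\<close>
  obtain z where z: "{a, z} \<in> edges G" "z \<notin> set cs"
  proof (cases "a = hd cs'")
    case True
    then show thesis using that cycle_neighbour[OF assms(4), of a] h assms(5) by blast
  next
    case False
    have "reach ?H a (hd cs')" using ab(4) by (rule reach_sym)
    then obtain xs where xs: "walk ?H xs" "hd xs = a" "last xs = hd cs'" by (auto simp: reach_def)
    then obtain y ys where "xs = a # y # ys"
      using False by (cases xs; cases "tl xs") auto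
    then have "{a, y} \<in> edges G \<and> {a, y} \<inter> set cs = {}" using xs(1) by simp
    then show thesis using that[of y] by simp
  qed
  obtain y where y: "{b, y} \<in> edges G" "y \<in> set cs" using cycle_neighbour[OF assms(3) bC] by blast
  have "2 \<le> deficit G {a, b}"
    by (rule deficit_nonpendent[OF assms(1,2) ab(1) z(1) _ y(1)]) (use z y aC bC in auto)
  moreover have "{a, b} \<notin> cycle_edges cs" using cycle_edges_subset[OF C(2)] aC by blast
  moreover have "{a, b} \<notin> cycle_edges cs'" using cycle_edges_subset[OF C(4)] bC assms(5) by blast
  ultimately show ?thesis using ab by blast
qed

section \<open>Two edge-disjoint cycles\<close>

lemma deficit_sum_disjoint:
  assumes "simple_graph G" "connected_graph G" "S \<subseteq> edges G" "T \<subseteq> edges G" "S \<inter> T = {}"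
  shows "(\<Sum>e\<in>S. deficit G e) + (\<Sum>e\<in>T. deficit G e) \<le> deficit_sum G"
proof -
  have "finite S" "finite T" using assms(3,4) simple_finite_edges[OF assms(1)] finite_subset by blast+
  then have "(\<Sum>e\<in>S. deficit G e) + (\<Sum>e\<in>T. deficit G e) = (\<Sum>e\<in>S \<union> T. deficit G e)"
    using assms(5) by (simp add: sum.union_disjoint)
  also have "\<dots> \<le> deficit_sum G" using assms by (intro deficit_sum_ge) auto
  finally show ?thesis .
qed

lemma deficit_sum_disjoint_cycles:
  assumes "simple_graph G" "connected_graph G" "is_cycle G cs" "is_cycle G cs'"
    "cycle_edges cs \<inter> cycle_edges cs' = {}" "set cs \<inter> set cs' = {}"
  shows "(\<Sum>e\<in>cycle_edges cs. deficit G e) + (\<Sum>e\<in>cycle_edges cs'. deficit G e) + 2 \<le> deficit_sum G"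
proof -
  obtain e where e: "e \<in> edges G" "e \<notin> cycle_edges cs" "e \<notin> cycle_edges cs'" "2 \<le> deficit G e"
    using separating_edge[OF assms(1-4,6)] by blast
  have "(\<Sum>e\<in>cycle_edges cs. deficit G e) + (\<Sum>e\<in>insert e (cycle_edges cs'). deficit G e) \<le> deficit_sum G"
    using assms e by (intro deficit_sum_disjoint) (auto simp: is_cycle_edges)
  then show ?thesis using e by (simp add: finite_cycle_edges)
qed

lemma cycle_deficits_ge:
  assumes "is_cycle G cs" "\<And>e. e \<in> cycle_edges cs \<Longrightarrow> d \<le> deficit G e"
  shows "int (length cs) * d \<le> (\<Sum>e\<in>cycle_edges cs. deficit G e)"
  using sum_bounded_below[of "cycle_edges cs" d "deficit G"] assms
  by (simp add: is_cycle_edges card_cycle_edges)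

lemma triangle_deficits_ge:
  assumes "simple_graph G" "connected_graph G" "is_cycle G cs" "length cs = 3"
  shows "int (card (edges G)) + 3 \<le> (\<Sum>e\<in>cycle_edges cs. deficit G e)"
proof -
  obtain a b c where cs: "cs = [a, b, c]"
    using assms(4) by (auto simp: length_Suc_conv numeral_eq_Suc)
  have E: "{a, b} \<in> edges G" "{b, c} \<in> edges G" "{c, a} \<in> edges G" and d: "a \<noteq> b" "b \<noteq> c" "a \<noteq> c"
    using assms(3) by (auto simp: is_cycle_def cs)
  have "cycle_edges cs = {{a, b}, {b, c}, {c, a}}"
    by (auto simp: cs cycle_edges_def)
  moreover have "{a, b} \<noteq> {b, c}" "{a, b} \<noteq> {c, a}" "{b, c} \<noteq> {c, a}"
    using d by (auto simp: doubleton_eq_iff)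
  ultimately show ?thesis using deficit_triangle[OF assms(1,2) E] by simp
qed

lemma coreI:
  assumes "bicyclic G" "path_metric k A M" "length vs = k" "distinct vs" "index_edges vs A \<subseteq> edges G"
    "set vs \<subseteq> \<Union>(index_edges vs A)" "distinct A" "\<forall>(i, j)\<in>set A. i < j \<and> j < k"
    "length A = k + 1"
  shows "core G vs A M"
proof -
  have "\<Union>(edges G) \<subseteq> verts G" using assms(1) by (auto simp: bicyclic_def simple_graph_def)
  then have "set vs \<subseteq> verts G" using assms(5,6) by blast
  then show ?thesis using assms by (auto simp: core_def)
qed

lemma shared_vertex_extremal:
  assumes "bicyclic G" "is_cycle G (c # cs)" "is_cycle G (c # ds)" "set cs \<inter> set ds = {}"
    and m: "card (edges G) = m"
  shows "length cs = 2 \<Longrightarrow> length ds = 2 \<Longrightarrow> deficit_sum G \<le> 2 * int m + 6 \<Longrightarrow> extremal G"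
    "length cs = 2 \<Longrightarrow> length ds = 3 \<Longrightarrow> deficit_sum G \<le> int m + 15 \<Longrightarrow> extremal G"
    "length cs = 3 \<Longrightarrow> length ds = 3 \<Longrightarrow> deficit_sum G \<le> 24 \<Longrightarrow> extremal G"
proof -
  show "extremal G" if len: "length cs = 2" "length ds = 2" and le: "deficit_sum G \<le> 2 * int m + 6"
  proof -
    obtain a b x y where l: "cs = [a, b]" "ds = [x, y]"
      using len by (auto simp: length_Suc_conv numeral_eq_Suc)
    have "core G [c, a, b, x, y] C33 C33_dist"
      using assms
      by (intro coreI[OF assms(1) path_metrics(3)]) (auto simp: l is_cycle_def index_edges_def C33_def insert_commute)
    from deficit_sum_C33(2)[OF this m le] show ?thesis by (auto simp: extremal_def)
  qed
  show "extremal G" if len: "length cs = 2" "length ds = 3" and le: "deficit_sum G \<le> int m + 15"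
  proof -
    obtain a b x y z where l: "cs = [a, b]" "ds = [x, y, z]"
      using len by (auto simp: length_Suc_conv numeral_eq_Suc)
    have "core G [c, a, b, x, y, z] C34 C34_dist"
      using assms
      by (intro coreI[OF assms(1) path_metrics(2)]) (auto simp: l is_cycle_def index_edges_def C34_def insert_commute)
    from deficit_sum_C34(2)[OF this m le] show ?thesis by (auto simp: extremal_def)
  qed
  show "extremal G" if len: "length cs = 3" "length ds = 3" and le: "deficit_sum G \<le> 24"
  proof -
    obtain a b d x y z where l: "cs = [a, b, d]" "ds = [x, y, z]"
      using len by (auto simp: length_Suc_conv numeral_eq_Suc)
    have "core G [c, a, b, d, x, y, z] C44 C44_dist"
      using assms
      by (intro coreI[OF assms(1) path_metrics(1)]) (auto simp: l is_cycle_def index_edges_def C44_def insert_commute)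
    from deficit_sum_C44(2)[OF this le] show ?thesis by (auto simp: extremal_def)
  qed
qed

text \<open>The second cycle itself joins any two of its vertices without an edge of the
  first.\<close>

lemma separated_shared_vertices:
  assumes "separated G cs" "is_cycle G cs'" "cycle_edges cs' \<inter> cycle_edges cs = {}"
    "x \<in> set cs" "x \<in> set cs'" "y \<in> set cs" "y \<in> set cs'"
  shows "x = y"
proof -
  let ?H = "UGraph (verts G) (edges G - cycle_edges cs)"
  have "set cs' \<subseteq> verts ?H" "path_edges cs' \<subseteq> edges ?H"
    using assms(2,3) by (auto simp: is_cycle_edges cycle_edges_def)
  then have "reach ?H x (last cs')" "reach ?H y (last cs')"
    using path_reach_hd_last(2)[of cs' ?H] assms(5,7) by blast+
  then have "reach ?H x y" by (meson reach_sym reach_trans)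
  then show ?thesis using assms by (simp add: separated_def)
qed

text \<open>The two cycles alone account for a deficit of \<open>t\<close>, so there is no room for
  the 2 that \<open>separating_edge\<close> adds when they are disjoint. They therefore meet, in one
  vertex by \<open>shared\<close>, and form one of the cores \<open>C33\<close>, \<open>C34\<close>,
  \<open>C44\<close>.\<close>

lemma two_cycles_extremal:
  assumes "bicyclic G" "is_cycle G cs" "is_cycle G cs'" "cycle_edges cs \<inter> cycle_edges cs' = {}"
    and shared: "\<And>x y. x \<in> set cs \<Longrightarrow> x \<in> set cs' \<Longrightarrow> y \<in> set cs \<Longrightarrow> y \<in> set cs' \<Longrightarrow> x = y"
    and m: "card (edges G) = m"
    and ge: "t \<le> (\<Sum>e\<in>cycle_edges cs. deficit G e) + (\<Sum>e\<in>cycle_edges cs'. deficit G e)"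
    and le: "deficit_sum G \<le> t"
    and t: "length cs = 3 \<and> length cs' = 3 \<and> t = 2 * int m + 6 \<or>
      length cs = 3 \<and> length cs' = 4 \<and> t = int m + 15 \<or> length cs = 4 \<and> length cs' = 4 \<and> t = 24"
  shows "extremal G"
proof -
  have G: "simple_graph G" "connected_graph G" using assms(1) by (auto simp: bicyclic_def)
  have "set cs \<inter> set cs' \<noteq> {}"
    using deficit_sum_disjoint_cycles[OF G assms(2-4)] ge le by fastforce
  then obtain c where c: "c \<in> set cs" "c \<in> set cs'" by blast
  obtain ds where ds: "is_cycle G (c # ds)" "Suc (length ds) = length cs" "set (c # ds) = set cs"
    using is_cycle_rotate[OF assms(2) c(1)] by metis
  obtain es where es: "is_cycle G (c # es)" "Suc (length es) = length cs'" "set (c # es) = set cs'"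
    using is_cycle_rotate[OF assms(3) c(2)] by metis
  have "set ds \<inter> set es = {}"
  proof (rule ccontr)
    assume "set ds \<inter> set es \<noteq> {}"
    then obtain x where x: "x \<in> set ds" "x \<in> set es" by blast
    then have "x = c" using shared[of x c] c ds(3) es(3) by auto
    then show False using ds(1) x by (simp add: is_cycle_def)
  qed
  from shared_vertex_extremal[OF assms(1) ds(1) es(1) this m] show ?thesis
    using t le ds(2) es(2) by auto
qed

lemma deficit_ge_3:
  assumes "simple_graph G" "connected_graph G" "nonbridge G e"
    "\<And>cs. is_cycle G cs \<Longrightarrow> e \<in> cycle_edges cs \<Longrightarrow> length cs \<noteq> 3"
  shows "3 \<le> deficit G e"
proof -
  have "4 \<le> length cs" if "is_cycle G cs" "e \<in> cycle_edges cs" for cs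
    using assms(4)[OF that] that(1) by (simp add: is_cycle_def)
  then have "int 3 \<le> deficit G e" by (intro deficit_ge_girth[OF assms(1-3)]) auto
  then show ?thesis by simp
qed

text \<open>The square arises because each of the \<open>length P - 1\<close> edges of the ear has
  deficit at least \<open>length P - 1\<close>.\<close>

lemma ear_deficits:
  assumes "bicyclic G" "is_cycle G cs" "ear G cs P"
  shows "int (length P - 1) * int (length P - 1) \<le> (\<Sum>e\<in>path_edges P. deficit G e)"
    "(\<Sum>e\<in>cycle_edges cs. deficit G e) + (\<Sum>e\<in>path_edges P. deficit G e) \<le> deficit_sum G"
proof -
  have G: "simple_graph G" "connected_graph G" using assms(1) by (auto simp: bicyclic_def)
  have P: "distinct P" "2 \<le> length P" "path_edges P \<subseteq> edges G" "path_edges P \<inter> cycle_edges cs = {}"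
    using assms(3) by (auto simp: ear_def walk_path_edges)
  have "of_nat (card (path_edges P)) * (int (length P) - 1) \<le> (\<Sum>e\<in>path_edges P. deficit G e)"
    using deficit_ear(1)[OF assms] by (intro sum_bounded_below) auto
  then show "int (length P - 1) * int (length P - 1) \<le> (\<Sum>e\<in>path_edges P. deficit G e)"
    using P by (simp add: card_path_edges of_nat_diff)
  show "(\<Sum>e\<in>cycle_edges cs. deficit G e) + (\<Sum>e\<in>path_edges P. deficit G e) \<le> deficit_sum G"
    using assms(2) P by (intro deficit_sum_disjoint[OF G]) (auto simp: is_cycle_edges)
qed

lemma ear_unfold:
  assumes "is_cycle G cs" "ear G cs P"
  obtains x ds Q y where "is_cycle G (x # ds)" "Suc (length ds) = length cs" "P = x # Q @ [y]"
    "y \<in> set ds" "set Q \<inter> set (x # ds) = {}" "distinct Q" "walk G P"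
    "path_edges P \<inter> cycle_edges (x # ds) = {}"
proof -
  have P: "2 \<le> length P" "hd P \<in> set cs" using assms(2) by (auto simp: ear_def)
  obtain x P' where "P = x # P'" using P by (cases P) auto
  then obtain Q y where PQ: "P = x # Q @ [y]"
    using P by (cases P' rule: rev_cases) auto
  obtain ds where ds: "is_cycle G (x # ds)" "Suc (length ds) = length cs" "set (x # ds) = set cs"
    "cycle_edges (x # ds) = cycle_edges cs"
    using is_cycle_rotate[OF assms(1), of x] P PQ by auto
  have "ear G (x # ds) P" using assms(2) ear_cong[OF ds(3,4)] by simp
  then show thesis by (intro that[OF ds(1,2) PQ]) (auto simp: ear_def PQ)
qed

section \<open>Case analysis by the length of a shortest cycle\<close>

lemma girth_ge_6:
  assumes "bicyclic G" "\<And>cs. is_cycle G cs \<Longrightarrow> 6 \<le> length cs"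
  shows "24 < deficit_sum G"
proof -
  have G: "simple_graph G" "connected_graph G" using assms(1) by (auto simp: bicyclic_def)
  obtain cs where cs: "is_cycle G cs" using bicyclic_has_cycle[OF assms(1)] by blast
  \<comment> \<open>Six edges with deficit at least 5 each already give 30.\<close>
  have "int 5 \<le> deficit G e" if "e \<in> cycle_edges cs" for e
    using assms(2) by (intro deficit_ge_girth[OF G cycle_nonbridge[OF cs that]]) auto
  then have "int (length cs) * int 5 \<le> (\<Sum>e\<in>cycle_edges cs. deficit G e)"
    by (intro cycle_deficits_ge[OF cs])
  also have "\<dots> \<le> deficit_sum G" using cs by (intro deficit_sum_ge[OF G]) (simp add: is_cycle_edges)
  finally show ?thesis using assms(2)[OF cs] by simp
qed

text \<open>The cycle contributes 5 * 4 = 20. A second cycle adds another 20, and an ear at least 2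
  * 4, since it cannot be a chord.\<close>

lemma girth_5:
  assumes "bicyclic G" "\<And>cs. is_cycle G cs \<Longrightarrow> 5 \<le> length cs" "is_cycle G cs" "length cs = 5"
  shows "24 < deficit_sum G"
proof -
  have G: "simple_graph G" "connected_graph G" using assms(1) by (auto simp: bicyclic_def)
  have d: "4 \<le> deficit G e" if "nonbridge G e" for e
  proof -
    have "int 4 \<le> deficit G e" using assms(2) by (intro deficit_ge_girth[OF G that]) auto
    then show ?thesis by simp
  qed
  have C: "20 \<le> (\<Sum>e\<in>cycle_edges cs. deficit G e)"
    using cycle_deficits_ge[OF assms(3), of 4] d[OF cycle_nonbridge[OF assms(3)]] assms(4) by simp
  show ?thesis
  proof (cases "separated G cs")
    case True
    then obtain cs' where cs': "is_cycle G cs'" "cycle_edges cs' \<inter> cycle_edges cs = {}"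
      using separated_second_cycle[OF assms(1,3)] by blast
    have "int (length cs') * 4 \<le> (\<Sum>e\<in>cycle_edges cs'. deficit G e)"
      using d[OF cycle_nonbridge[OF cs'(1)]] by (rule cycle_deficits_ge[OF cs'(1)])
    moreover have "(\<Sum>e\<in>cycle_edges cs. deficit G e) + (\<Sum>e\<in>cycle_edges cs'. deficit G e) \<le> deficit_sum G"
      using assms(3) cs' by (intro deficit_sum_disjoint[OF G]) (auto simp: is_cycle_edges)
    ultimately show ?thesis using C assms(2)[OF cs'(1)] by simp
  next
    case False
    then obtain P where P: "ear G cs P" using not_separated_ear by blast
    have "length P \<noteq> 2"
    proof
      assume l2: "length P = 2"
      obtain x ds Q y where U: "is_cycle G (x # ds)" "Suc (length ds) = length cs" "P = x # Q @ [y]"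
        "y \<in> set ds" "walk G P" "path_edges P \<inter> cycle_edges (x # ds) = {}"
        by (rule ear_unfold[OF assms(3) P])
      have P2: "P = [x, y]" using l2 U(3) by simp
      obtain a b c d where ds: "ds = [a, b, c, d]"
        using U(2) assms(4) by (auto simp: length_Suc_conv numeral_eq_Suc)
      \<comment> \<open>A chord of a 5-cycle cuts off a triangle.\<close>
      have "y = b \<or> y = c" using U(4,6) by (auto simp: ds P2 cycle_edges_def insert_commute)
      then have "is_cycle G [x, a, b] \<or> is_cycle G [x, c, d]"
        using U(1,5) by (auto simp: ds P2 is_cycle_def insert_commute)
      then show False using assms(2) by fastforce
    qed
    then have l: "3 \<le> length P" using P by (simp add: ear_def)
    have "distinct P" using P by (simp add: ear_def)
    then have "of_nat (length P - 1) * 4 \<le> (\<Sum>e\<in>path_edges P. deficit G e)"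
      using sum_bounded_below[of "path_edges P" 4 "deficit G"] d deficit_ear(2)[OF assms(1,3) P]
      by (simp add: card_path_edges)
    then have "8 \<le> (\<Sum>e\<in>path_edges P. deficit G e)" using l by simp
    then show ?thesis using C ear_deficits(2)[OF assms(1,3) P] by simp
  qed
qed

text \<open>The cycle contributes 4 * 3 = 12. A second cycle of length 4 brings this to exactly 24,
  a longer one to at least 27. An ear with at least 4 edges adds 16; shorter ears lead to
  \<open>Theta222\<close>, \<open>Theta133\<close> and \<open>Theta223\<close>.\<close>

lemma girth_4:
  assumes "bicyclic G" "\<And>cs. is_cycle G cs \<Longrightarrow> 4 \<le> length cs" "is_cycle G cs" "length cs = 4"
    and m: "card (edges G) = m"
  shows "min (2 * int m + 6) 24 < deficit_sum G \<or> extremal G"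
proof -
  have G: "simple_graph G" "connected_graph G" using assms(1) by (auto simp: bicyclic_def)
  have d: "3 \<le> deficit G e" if "nonbridge G e" for e
    using assms(2) by (intro deficit_ge_3[OF G that]) fastforce
  have C: "12 \<le> (\<Sum>e\<in>cycle_edges cs. deficit G e)"
    using cycle_deficits_ge[OF assms(3), of 3] d[OF cycle_nonbridge[OF assms(3)]] assms(4) by simp
  show ?thesis
  proof (cases "separated G cs")
    case True
    then obtain cs' where cs': "is_cycle G cs'" "cycle_edges cs' \<inter> cycle_edges cs = {}"
      using separated_second_cycle[OF assms(1,3)] by blast
    have C': "int (length cs') * 3 \<le> (\<Sum>e\<in>cycle_edges cs'. deficit G e)"
      using d[OF cycle_nonbridge[OF cs'(1)]] by (rule cycle_deficits_ge[OF cs'(1)])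
    have D: "(\<Sum>e\<in>cycle_edges cs. deficit G e) + (\<Sum>e\<in>cycle_edges cs'. deficit G e) \<le> deficit_sum G"
      using assms(3) cs' by (intro deficit_sum_disjoint[OF G]) (auto simp: is_cycle_edges)
    show ?thesis
    proof (cases "length cs' = 4 \<and> deficit_sum G \<le> 24")
      case le: True
      have "extremal G"
      proof (rule two_cycles_extremal[OF assms(1,3) cs'(1) _ _ m])
        show "24 \<le> (\<Sum>e\<in>cycle_edges cs. deficit G e) + (\<Sum>e\<in>cycle_edges cs'. deficit G e)"
          using C C' le by simp
      qed (use le assms(4) cs' separated_shared_vertices[OF True cs'] in auto)
      then show ?thesis by simp
    next
      case False
      then show ?thesis using C C' D assms(2)[OF cs'(1)] by auto
    qed
  next
    case False
    then obtain P where P: "ear G cs P" using not_separated_ear by blast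
    obtain x ds Q y where U: "is_cycle G (x # ds)" "Suc (length ds) = length cs" "P = x # Q @ [y]"
      "y \<in> set ds" "set Q \<inter> set (x # ds) = {}" "distinct Q" "walk G P"
      "path_edges P \<inter> cycle_edges (x # ds) = {}"
      by (rule ear_unfold[OF assms(3) P])
    obtain a b c where ds: "ds = [a, b, c]"
      using U(2) assms(4) by (auto simp: length_Suc_conv numeral_eq_Suc)
    have y: "y = a \<or> y = b \<or> y = c" using U(4) by (simp add: ds)
    have no3: "\<not> is_cycle G [u, v, w]" for u v w using assms(2)[of "[u, v, w]"] by auto
    have E: "{x, a} \<in> edges G" "{a, b} \<in> edges G" "{b, c} \<in> edges G" "{c, x} \<in> edges G"
      "distinct [x, a, b, c]" "{x, a, b, c} \<subseteq> verts G"
      using U(1) by (auto simp: ds is_cycle_def)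
    consider (1) "Q = []" | (2) p where "Q = [p]" | (3) p q where "Q = [p, q]" | (4) "3 \<le> length Q"
    proof (cases Q)
      case (Cons p Q')
      then show ?thesis using that by (cases Q'; cases "tl Q'") auto
    qed
    then show ?thesis
    proof cases
      case 1
      then have "y = b" using y U(8) by (auto simp: U(3) ds cycle_edges_def insert_commute)
      then have "is_cycle G [x, a, b]" using E U(7) by (simp add: U(3) 1 is_cycle_def insert_commute)
      then show ?thesis using no3 by blast
    next
      case 2
      have p: "p \<notin> {x, a, b, c}" "{x, p} \<in> edges G" "{p, y} \<in> edges G" "p \<in> verts G"
        using U(5,7) by (auto simp: U(3) 2 ds)
      \<comment> \<open>An ear with two edges between neighbours on the cycle would close a
        triangle, so its ends are opposite vertices.\<close>
      have "y \<noteq> a" using no3[of x p a] p E by (auto simp: is_cycle_def insert_commute)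
      moreover have "y \<noteq> c" using no3[of x p c] p E by (auto simp: is_cycle_def insert_commute)
      ultimately have yb: "y = b" using y by blast
      have "core G [x, b, a, c, p] Theta222 Theta222_dist"
        using assms(1) E p
        by (intro coreI[OF assms(1) path_metrics(6)]) (auto simp: yb index_edges_def Theta222_def insert_commute)
      from deficit_sum_Theta222[OF this m] show ?thesis by (cases "deficit_sum G = 24") auto
    next
      case 3
      have p: "distinct [x, a, b, c, p, q]" "{x, p} \<in> edges G" "{p, q} \<in> edges G" "{q, y} \<in> edges G"
        using U(5-7) E by (auto simp: U(3) 3 ds)
      have r: ?thesis if "core G vs Theta133 Theta133_dist" for vs
        using deficit_sum_Theta133[OF that] by linarith
      from y show ?thesis
      proof (elim disjE)
        assume "y = a"
        then have "core G [x, a, p, q, c, b] Theta133 Theta133_dist"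
          using assms(1) E p
          by (intro coreI[OF assms(1) path_metrics(7)]) (auto simp: index_edges_def Theta133_def insert_commute)
        then show ?thesis by (rule r)
      next
        assume "y = c"
        then have "core G [x, c, p, q, a, b] Theta133 Theta133_dist"
          using assms(1) E p
          by (intro coreI[OF assms(1) path_metrics(7)]) (auto simp: index_edges_def Theta133_def insert_commute)
        then show ?thesis by (rule r)
      next
        assume "y = b"
        then have "core G [x, b, a, c, p, q] Theta223 Theta223_dist"
          using assms(1) E p
          by (intro coreI[OF assms(1) path_metrics(8)]) (auto simp: index_edges_def Theta223_def insert_commute)
        from deficit_sum_Theta223[OF this] show ?thesis by linarith
      qed
    next
      case 4
      then have "4 \<le> length P - 1" by (simp add: U(3))
      then have "4 * 4 \<le> int (length P - 1) * int (length P - 1)" by (intro mult_mono) auto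
      then show ?thesis using ear_deficits[OF assms(1,3) P] C by linarith
    qed
  qed
qed

text \<open>The triangle contributes m + 3. A second edge-disjoint triangle gives 2m + 6, any other
  edge-disjoint cycle at least m + 3 + 4 * 3 = m + 15. An ear with at least 4 edges gives m + 3 +
  16, shorter ones lead to \<open>Theta122\<close> and \<open>Theta123\<close>.\<close>

lemma girth_3:
  assumes "bicyclic G" "is_cycle G cs" "length cs = 3" and m: "card (edges G) = m"
  shows "min (2 * int m + 6) 24 < deficit_sum G \<or> extremal G"
proof -
  have G: "simple_graph G" "connected_graph G" using assms(1) by (auto simp: bicyclic_def)
  have C: "int m + 3 \<le> (\<Sum>e\<in>cycle_edges cs. deficit G e)"
    using triangle_deficits_ge[OF G assms(2,3)] m by simp
  have side: "{x, y} \<in> cycle_edges zs"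
    if "length zs = 3" "x \<in> set zs" "y \<in> set zs" "x \<noteq> y" for x y and zs :: "'a list"
    using that by (auto simp: length_Suc_conv numeral_eq_Suc cycle_edges_def insert_commute)
  show ?thesis
  proof (cases "\<exists>cs'. is_cycle G cs' \<and> length cs' = 3 \<and> cycle_edges cs' \<inter> cycle_edges cs = {}")
    case True
    then obtain cs' where cs': "is_cycle G cs'" "length cs' = 3" "cycle_edges cs' \<inter> cycle_edges cs = {}"
      by blast
    have C': "int m + 3 \<le> (\<Sum>e\<in>cycle_edges cs'. deficit G e)"
      using triangle_deficits_ge[OF G cs'(1,2)] m by simp
    have "extremal G" if le: "deficit_sum G \<le> 2 * int m + 6"
    proof (rule two_cycles_extremal[OF assms(1,2) cs'(1) _ _ m _ le])
      show "2 * int m + 6 \<le> (\<Sum>e\<in>cycle_edges cs. deficit G e) + (\<Sum>e\<in>cycle_edges cs'. deficit G e)"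
        using C C' by simp
      show "x = y" if "x \<in> set cs" "x \<in> set cs'" "y \<in> set cs" "y \<in> set cs'" for x y
        using side[of cs x y] side[of cs' x y] that cs' assms(3) by blast
    qed (use cs' assms(3) in auto)
    then show ?thesis by linarith
  next
    case False
    note no_triangle = this
    show ?thesis
    proof (cases "separated G cs")
      case True
      then obtain cs' where cs': "is_cycle G cs'" "cycle_edges cs' \<inter> cycle_edges cs = {}"
        using separated_second_cycle[OF assms(1,2)] by blast
      \<comment> \<open>No edge of the second cycle lies on a triangle. Such a triangle would share
        an edge \<open>{u, v}\<close> with \<open>cs\<close>. If its third vertex \<open>w\<close>
        is on \<open>cs\<close> as well, then \<open>e\<close> is an edge of \<open>cs\<close>; if
        not, the path \<open>u\<close>, \<open>w\<close>, \<open>v\<close> contradicts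
        \<open>separated\<close>.\<close>
      have d: "3 \<le> deficit G e" if e: "e \<in> cycle_edges cs'" for e
      proof (rule deficit_ge_3[OF G cycle_nonbridge[OF cs'(1) e]])
        fix zs assume zs: "is_cycle G zs" "e \<in> cycle_edges zs"
        show "length zs \<noteq> 3"
        proof
          assume l3: "length zs = 3"
          then obtain f where f: "f \<in> cycle_edges zs" "f \<in> cycle_edges cs"
            using no_triangle zs(1) by blast
          obtain u v where uv: "f = {u, v}" "u \<noteq> v"
            using simple_edgeE[OF G(1)] f(1) zs(1) unfolding is_cycle_edges by blast
          have ne: "cs \<noteq> []" "zs \<noteq> []" using assms(3) l3 by auto
          then have u: "u \<in> set cs" "v \<in> set cs" "u \<in> set zs" "v \<in> set zs"
            using cycle_edges_subset[of cs f] cycle_edges_subset[of zs f] f uv by auto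
          have "card (set zs - {u, v}) = 1"
            using l3 zs(1) u(3,4) uv(2) by (simp add: card_Diff_subset distinct_card is_cycle_def)
          then obtain w where "set zs - {u, v} = {w}" by (rule card_1_singletonE)
          then have w: "w \<in> set zs" "w \<noteq> u" "w \<noteq> v" "set zs = {u, v, w}"
            using u(3,4) by blast+
          have sides: "{u, w} \<in> edges G" "{w, v} \<in> edges G"
            using side[OF l3] u w zs(1) unfolding is_cycle_edges by blast+
          have wV: "w \<in> verts G" "u \<in> verts G" "v \<in> verts G"
            using zs(1) w u unfolding is_cycle_edges by auto
          show False
          proof (cases "w \<in> set cs")
            case True
            have eE: "e \<in> edges G" using zs unfolding is_cycle_edges by blast
            obtain s t where st: "e = {s, t}" "s \<noteq> t" by (rule simple_edgeE[OF G(1) eE])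
            have "e \<subseteq> set zs" by (rule cycle_edges_subset[OF ne(2) zs(2)])
            then have "s \<in> set cs" "t \<in> set cs" unfolding w(4) st(1) using True u by blast+
            then have "e \<in> cycle_edges cs" using side[OF assms(3)] st by blast
            then show False using cs'(2) e by blast
          next
            case False
            then have "{u, w} \<notin> cycle_edges cs" "{w, v} \<notin> cycle_edges cs"
              using cycle_edges_subset[OF ne(1)] by blast+
            then have "walk (UGraph (verts G) (edges G - cycle_edges cs)) [u, w, v]"
              using sides wV by simp
            from walk_reach[OF this] have "u = v" using \<open>separated G cs\<close> u by (simp add: separated_def)
            then show False using uv by simp
          qed
        qed
      qed
      have C': "int (length cs') * 3 \<le> (\<Sum>e\<in>cycle_edges cs'. deficit G e)"
        by (rule cycle_deficits_ge[OF cs'(1) d])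
      have D: "(\<Sum>e\<in>cycle_edges cs. deficit G e) + (\<Sum>e\<in>cycle_edges cs'. deficit G e) \<le> deficit_sum G"
        using assms(2) cs' by (intro deficit_sum_disjoint[OF G]) (auto simp: is_cycle_edges)
      have l: "4 \<le> length cs'" using no_triangle cs' by (auto simp: is_cycle_def le_less)
      show ?thesis
      proof (cases "length cs' = 4 \<and> deficit_sum G \<le> int m + 15")
        case le: True
        have "extremal G"
        proof (rule two_cycles_extremal[OF assms(1,2) cs'(1) _ _ m])
          show "int m + 15 \<le> (\<Sum>e\<in>cycle_edges cs. deficit G e) + (\<Sum>e\<in>cycle_edges cs'. deficit G e)"
            using C C' le by simp
        qed (use le assms(3) cs' separated_shared_vertices[OF True cs'] in auto)
        then show ?thesis by simp
      next
        case False
        \<comment> \<open>Exceeding the mean of 2m + 6 and 24 means exceeding the smaller of the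
          two.\<close>
        then have "int m + 15 < deficit_sum G" using C C' D l by auto
        then show ?thesis by linarith
      qed
    next
      case False
      then obtain P where P: "ear G cs P" using not_separated_ear by blast
      obtain x ds Q y where U: "is_cycle G (x # ds)" "Suc (length ds) = length cs" "P = x # Q @ [y]"
        "y \<in> set ds" "set Q \<inter> set (x # ds) = {}" "distinct Q" "walk G P"
        "path_edges P \<inter> cycle_edges (x # ds) = {}"
        by (rule ear_unfold[OF assms(2) P])
      obtain a b where ds: "ds = [a, b]"
        using U(2) assms(3) by (auto simp: length_Suc_conv numeral_eq_Suc)
      have ab: "distinct [x, a, b]" "{x, a} \<in> edges G" "{a, b} \<in> edges G" "{x, b} \<in> edges G"
        using U(1) by (auto simp: ds is_cycle_def insert_commute)
      obtain z where z: "distinct [x, y, z]" "{x, y} \<in> edges G" "{y, z} \<in> edges G"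
        "{x, z} \<in> edges G" "z \<in> set ds"
      proof (cases "y = a")
        case True
        show thesis by (rule that[of b]) (use ab in \<open>auto simp: ds True\<close>)
      next
        case False
        then have "y = b" using U(4) by (simp add: ds)
        then show thesis by (intro that[of a]) (use ab in \<open>auto simp: ds insert_commute\<close>)
      qed
      consider (1) "Q = []" | (2) p where "Q = [p]" | (3) p q where "Q = [p, q]" | (4) "3 \<le> length Q"
      proof (cases Q)
        case (Cons p Q')
        then show ?thesis using that by (cases Q'; cases "tl Q'") auto
      qed
      then show ?thesis
      proof cases
        case 1
        \<comment> \<open>A triangle has no chord.\<close>
        then have "{x, y} \<notin> cycle_edges (x # ds)" using U(8) by (auto simp: U(3))
        then show ?thesis using side[of "x # ds" x y] U(2,4) assms(3) z(1) by simp
      next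
        case 2
        then have c: "core G [x, y, z, p] Theta122 Theta122_dist"
          using assms(1) U(3,4,5,7) z
          by (intro coreI[OF assms(1) path_metrics(4)])
            (auto simp: index_edges_def Theta122_def insert_commute)
        show ?thesis
        proof (cases "deficit_sum G \<le> min (2 * int m + 6) 24")
          case True
          from deficit_sum_Theta122[OF c m this] show ?thesis unfolding extremal_def by blast
        next
          case False
          then show ?thesis by linarith
        qed
      next
        case 3
        then have "core G [x, y, z, p, q] Theta123 Theta123_dist"
          using assms(1) U(3,4,5,6,7) z
          by (intro coreI[OF assms(1) path_metrics(5)]) (auto simp: index_edges_def Theta123_def insert_commute)
        from deficit_sum_Theta123[OF this m] show ?thesis by linarith
      next
        case 4
        then have "4 \<le> length P - 1" by (simp add: U(3))
        then have "4 * 4 \<le> int (length P - 1) * int (length P - 1)" by (intro mult_mono) auto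
        then have "int m + 19 \<le> deficit_sum G" using ear_deficits[OF assms(1,2) P] C by linarith
        then show ?thesis by linarith
      qed
    qed
  qed
qed

theorem bicyclic_deficit:
  assumes "bicyclic G" "card (edges G) = m"
  shows "min (2 * int m + 6) 24 < deficit_sum G \<or> extremal G"
proof -
  obtain cs where cs: "is_cycle G cs" and least: "\<And>ds. is_cycle G ds \<Longrightarrow> length cs \<le> length ds"
    using bicyclic_has_cycle[OF assms(1)] ex_has_least_nat[of "is_cycle G" _ length] by metis
  have "3 \<le> length cs" using cs by (simp add: is_cycle_def)
  then consider "length cs = 3" | "length cs = 4" | "length cs = 5" | "6 \<le> length cs" by linarith
  then show ?thesis
  proof cases
    case 1
    then show ?thesis using girth_3[OF assms(1) cs _ assms(2)] by blast
  next
    case 2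
    then show ?thesis using girth_4[OF assms(1) _ cs _ assms(2)] least by simp
  next
    case 3
    then have "24 < deficit_sum G" using girth_5[OF assms(1) _ cs] least by simp
    then show ?thesis by (simp add: min_less_iff_disj)
  next
    case 4
    then have "24 < deficit_sum G" using girth_ge_6[OF assms(1)] least by (meson le_trans)
    then show ?thesis by (simp add: min_less_iff_disj)
  qed
qed

section \<open>Deficits of the extremal graphs and comparison by size\<close>

lemma star_shape_core:
  assumes "bicyclic G"
  shows "star_shape G vs C44 0 \<Longrightarrow> length vs = 7 \<Longrightarrow> core G vs C44 C44_dist"
    "star_shape G vs C34 0 \<Longrightarrow> length vs = 6 \<Longrightarrow> core G vs C34 C34_dist"
    "star_shape G vs C33 0 \<Longrightarrow> length vs = 5 \<Longrightarrow> core G vs C33 C33_dist"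
    "star_shape G vs Theta122 k \<Longrightarrow> length vs = 4 \<Longrightarrow> core G vs Theta122 Theta122_dist"
  using core_of_star_shape[OF assms] path_metrics
  by (auto simp: C44_def C34_def C33_def Theta122_def)

text \<open>The lower bounds on \<open>m\<close> are the numbers of core edges. They ensure that the
  truncated subtractions in the definitions of \<open>B\<close>, \<open>B1\<close> and
  \<open>B2\<close> are genuine.\<close>

lemma extremal_cases:
  assumes "bicyclic G" and m: "card (edges G) = m"
  shows "star_shape G vs C44 0 \<Longrightarrow> length vs = 7 \<Longrightarrow> deficit_sum G = 24 \<and> 8 \<le> m"
    "star_shape G vs C34 0 \<Longrightarrow> length vs = 6 \<Longrightarrow> deficit_sum G = int m + 15 \<and> 7 \<le> m"
    "star_shape G vs C33 0 \<Longrightarrow> length vs = 5 \<Longrightarrow> deficit_sum G = 2 * int m + 6 \<and> 6 \<le> m"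
    "star_shape G vs Theta122 0 \<Longrightarrow> length vs = 4 \<Longrightarrow> deficit_sum G = 2 * int m + 6"
    "star_shape G vs Theta122 2 \<Longrightarrow> length vs = 4 \<Longrightarrow> deficit_sum G = (if m = 5 then 16 else int m + 15)"
proof -
  have len: "length A \<le> m" if "core G vs A M" for vs A M
    using core.card_F[OF that] card_mono[OF core.finite_E[OF that] core.edges[OF that]] m by simp
  note c = star_shape_core[OF assms(1)]
  show "deficit_sum G = 24 \<and> 8 \<le> m" if "star_shape G vs C44 0" "length vs = 7"
    using deficit_sum_C44(3)[OF c(1)[OF that]] len[OF c(1)[OF that]] that by (simp add: C44_def)
  show "deficit_sum G = int m + 15 \<and> 7 \<le> m" if "star_shape G vs C34 0" "length vs = 6"
    using deficit_sum_C34(3)[OF c(2)[OF that] m] len[OF c(2)[OF that]] that by (simp add: C34_def)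
  show "deficit_sum G = 2 * int m + 6 \<and> 6 \<le> m" if "star_shape G vs C33 0" "length vs = 5"
    using deficit_sum_C33(3)[OF c(3)[OF that] m] len[OF c(3)[OF that]] that by (simp add: C33_def)
  show "deficit_sum G = 2 * int m + 6" if "star_shape G vs Theta122 0" "length vs = 4"
    using deficit_sum_Theta122_star(1)[OF c(4)[OF that] m] that by simp
  show "deficit_sum G = (if m = 5 then 16 else int m + 15)" if "star_shape G vs Theta122 2" "length vs = 4"
    using deficit_sum_Theta122_star(2)[OF c(4)[OF that] m] that by simp
qed

theorem theorem1p1:
  fixes G :: "'v ugraph" and m :: nat
  assumes "bicyclic G" and "card (edges G) = m" and "m \<ge> 5"
  shows "(m = 5 \<longrightarrow>
            edge_mostar G \<le> 4 \<and>
            (edge_mostar G = 4 \<longleftrightarrow> G \<simeq> B3 m \<or> G \<simeq> B4 m)) \<and>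
         (6 \<le> m \<and> m \<le> 8 \<longrightarrow>
            edge_mostar G \<le> (int m)^2 - 3 * int m - 6 \<and>
            (edge_mostar G = (int m)^2 - 3 * int m - 6 \<longleftrightarrow> G \<simeq> B2 m \<or> G \<simeq> B3 m)) \<and>
         (m = 9 \<longrightarrow>
            edge_mostar G \<le> 48 \<and>
            (edge_mostar G = 48 \<longleftrightarrow>
               G \<simeq> B m \<or> G \<simeq> B1 m \<or> G \<simeq> B2 m \<or> G \<simeq> B3 m \<or> G \<simeq> B4 m)) \<and>
         (m \<ge> 10 \<longrightarrow>
            edge_mostar G \<le> (int m)^2 - int m - 24 \<and>
            (edge_mostar G = (int m)^2 - int m - 24 \<longleftrightarrow> G \<simeq> B m))"
proof -
  have G: "simple_graph G" "card (verts G) + 1 = m"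
    using assms(1,2) by (auto simp: bicyclic_def)
  define D where "D = deficit_sum G"
  have M: "edge_mostar G = (int m)^2 - int m - D"
    using edge_mostar_deficit[of G] assms(2) by (simp add: D_def power2_eq_square algebra_simps)
  note iso = isomorphic_B[OF G] isomorphic_B1[OF G] isomorphic_B2[OF G] isomorphic_B3[OF G] isomorphic_B4[OF G]
  note val = extremal_cases[OF assms(1,2)]
  have v: "8 \<le> m \<Longrightarrow> G \<simeq> B m \<Longrightarrow> D = 24" "7 \<le> m \<Longrightarrow> G \<simeq> B1 m \<Longrightarrow> D = int m + 15"
    "6 \<le> m \<Longrightarrow> G \<simeq> B2 m \<Longrightarrow> D = 2 * int m + 6" "G \<simeq> B3 m \<Longrightarrow> D = 2 * int m + 6"
    "G \<simeq> B4 m \<Longrightarrow> D = (if m = 5 then 16 else int m + 15)"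
    unfolding D_def using iso assms(3) val by blast+
  have "min (2 * int m + 6) 24 < D \<or> (8 \<le> m \<and> G \<simeq> B m) \<or> (7 \<le> m \<and> G \<simeq> B1 m) \<or> (6 \<le> m \<and> G \<simeq> B2 m)
      \<or> G \<simeq> B3 m \<or> G \<simeq> B4 m"
    using bicyclic_deficit[OF assms(1,2)] iso assms(3) val unfolding D_def extremal_def by blast
  \<comment> \<open>For m from 6 to 8 the order is 2m + 6 < m + 15 < 24, for m = 9 all three agree,
    and for larger m the order is reversed. For m = 5 both \<open>B3 m\<close> and
    \<open>B4 m\<close> have the value 16 = 2m + 6. The rest of the proof is this
    comparison.\<close>
  then have cases: "min (2 * int m + 6) 24 < D \<or> (8 \<le> m \<and> G \<simeq> B m \<and> D = 24)
      \<or> (7 \<le> m \<and> G \<simeq> B1 m \<and> D = int m + 15) \<or> (6 \<le> m \<and> G \<simeq> B2 m \<and> D = 2 * int m + 6)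
      \<or> (G \<simeq> B3 m \<and> D = 2 * int m + 6) \<or> (G \<simeq> B4 m \<and> D = (if m = 5 then 16 else int m + 15))"
    using v by blast
  show ?thesis
  proof (intro conjI impI)
    assume m: "m = 5"
    show "edge_mostar G \<le> 4" using cases unfolding M m by auto
    show "edge_mostar G = 4 \<longleftrightarrow> G \<simeq> B3 m \<or> G \<simeq> B4 m" using cases v(4,5) unfolding M m by auto
  next
    assume m: "6 \<le> m \<and> m \<le> 8"
    show "edge_mostar G \<le> (int m)^2 - 3 * int m - 6" using cases m unfolding M by auto
    show "edge_mostar G = (int m)^2 - 3 * int m - 6 \<longleftrightarrow> G \<simeq> B2 m \<or> G \<simeq> B3 m"
      using cases v(3,4) m unfolding M by auto
  next
    assume m: "m = 9"
    show "edge_mostar G \<le> 48" using cases unfolding M m by auto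
    show "edge_mostar G = 48 \<longleftrightarrow> G \<simeq> B m \<or> G \<simeq> B1 m \<or> G \<simeq> B2 m \<or> G \<simeq> B3 m \<or> G \<simeq> B4 m"
      using cases v unfolding M m by auto
  next
    assume m: "10 \<le> m"
    show "edge_mostar G \<le> (int m)^2 - int m - 24" using cases m unfolding M by auto
    show "edge_mostar G = (int m)^2 - int m - 24 \<longleftrightarrow> G \<simeq> B m" using cases v(1) m unfolding M by auto
  qed
qed

end
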